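(* Let $(\mathcal{A},\mu_B,\mu_C,{}_B\psi_B,{}_C\phi_C)$ be a measured regular multiplier Hopf algebroid, where $\mathcal{A}=(A,B,C,t_B,t_C,\Delta_B,\Delta_C)$ is locally projective. Then the following conditions are equivalent: (1) the dual $\hat{\mathcal A}$ is unital (that is, the algebra $\hat A$ has a unit); (2) there exists a left cointegral $l\in A$ such that ${}_C\phi_C(l)=1_C$; (3) there exists a right cointegral $r\in A$ such that ${}_B\psi_B(r)=1_B$. In that case, $l$ and $r$ can be chosen such that $\hat A\triangleright l=A=r\triangleleft\hat A$.
   Context: Conventions. All algebras are complex and associative, not necessarily unital; products of subspaces are linear spans; $\iota$ denotes identity maps. An algebra $A$ is non-degenerate if $aA=0$ or $Aa=0$ only for $a=0$, and idempotent if $AA=A$; $M(A)$ is its multiplier algebra. A module over $B$ is non-degenerate if no non-zero element is annihilated by $B$, and idempotent if it is spanned by products with elements of $B$. For commuting subalgebras $B,C\subseteq M(A)$ with anti-isomorphisms $t_B\colon B\to C$, $t_C\colon C\to B$, write ${}_BA,A_B,{}_CA,A_C$ for $A$ with left/right multiplication, and $A^B,{}^BA,A^C,{}^CA$ for $A$ with the structures $a\cdot x=t_B(x)a$, $x\cdot a=at_B(x)$, $a\cdot y=t_C(y)a$, $y\cdot a=at_C(y)$ ($x\in B$, $y\in C$). Balanced tensor products are written $A^C\otimes{}_CA$ (over $C$), $A_B\otimes{}^BA$ (over $B$), etc. $A^C\otimes{}_CA$ is a right and $A_B\otimes{}^BA$ a left $M(A)\otimes M(A)$-module; endomorphisms in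 $\operatorname{End}(A_B\otimes{}^BA)^{\mathrm{op}}$ are written on the right. $A^C\overline{\times}{}_CA\subseteq\operatorname{End}(A^C\otimes{}_CA)$ consists of all $T$ such that for all $a,b\in A$ there are $T(a\otimes1),T(1\otimes b)\in A^C\otimes{}_CA$ with $T(a\otimes b)=(T(a\otimes1))(1\otimes b)=(T(1\otimes b))(a\otimes1)$; $A_B\overline{\times}{}^BA\subseteq\operatorname{End}(A_B\otimes{}^BA)^{\mathrm{op}}$ consists of all $T$ such that for all $a,b$ there are $(a\otimes1)T,(1\otimes b)T\in A_B\otimes{}^BA$ with $(a\otimes b)T=(1\otimes b)((a\otimes1)T)=(a\otimes1)((1\otimes b)T)$. A multiplier bialgebroid $(A,B,C,t_B,t_C,\Delta_B,\Delta_C)$ consists of a non-degenerate idempotent algebra $A$, subalgebras $B,C\subseteq M(A)$, anti-isomorphisms $t_B\colon B\to C$, $t_C\colon C\to B$, and homomorphisms $\Delta_C\colon A\to A^C\overline{\times}{}_CA$ (left comultiplication), $\Delta_B\colon A\to A_B\overline{\times}{}^BA$ (right comultiplication) such that: (1) $B$ and $C$ commute and ${}_BA,A_B,{}_CA,A_C$ are non-degenerate and idempotent; (2) $A^C\otimes{}_CA$ is non-degenerate as a right module over $1\otimes A$ and over $A\otimes1$, and $A_B\otimes{}^BA$ as a left module over $1\otimes A$ and over $A\otimes1$; (3) $\Delta_C(xyax'y')=(y\otimes x)\Delta_C(a)(y'\otimes x')$ and $\Delta_B(xyax'y')=(y\otimes x)\Delta_B(a)(y'\otimes x')$ for $x,x'\in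 B$, $y,y'\in C$, $a\in A$; (4) for all $a,b,c\in A$: $(\Delta_C\otimes\iota)(\Delta_C(b)(1\otimes c))(a\otimes1\otimes1)=(\iota\otimes\Delta_C)(\Delta_C(b)(a\otimes1))(1\otimes1\otimes c)$; $(a\otimes1\otimes1)(\Delta_B\otimes\iota)((1\otimes c)\Delta_B(b))=(1\otimes1\otimes c)(\iota\otimes\Delta_B)((a\otimes1)\Delta_B(b))$; $(\Delta_C\otimes\iota)((1\otimes c)\Delta_B(b))(a\otimes1\otimes1)=(1\otimes1\otimes c)(\iota\otimes\Delta_B)(\Delta_C(b)(a\otimes1))$; $(a\otimes1\otimes1)(\Delta_B\otimes\iota)(\Delta_C(b)(1\otimes c))=(\iota\otimes\Delta_C)((a\otimes1)\Delta_B(b))(1\otimes1\otimes c)$. It is a regular multiplier Hopf algebroid if there exist (then unique) a left counit ${}_C\varepsilon\colon A\to C$, a right counit $\varepsilon_B\colon A\to B$ and an antipode $S$, i.e.: ${}_C\varepsilon(ya)=y\,{}_C\varepsilon(a)$, ${}_C\varepsilon(t_C(y)a)={}_C\varepsilon(a)y$, and $({}_C\varepsilon\odot\iota)(\Delta_C(a)(1\otimes b))=ab=(\iota\odot{}_C\varepsilon)(\Delta_C(a)(b\otimes1))$, where $({}_C\varepsilon\odot\iota)(a\otimes b)={}_C\varepsilon(a)b$, $(\iota\odot{}_C\varepsilon)(a\otimes b)=t_C({}_C\varepsilon(b))a$; $\varepsilon_B(ax)=\varepsilon_B(a)x$, $\varepsilon_B(at_B(x))=x\varepsilon_B(a)$,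 and $(\varepsilon_B\odot\iota)((1\otimes b)\Delta_B(a))=ba=(\iota\odot\varepsilon_B)((b\otimes1)\Delta_B(a))$, where $(\varepsilon_B\odot\iota)(a\otimes b)=bt_B(\varepsilon_B(a))$, $(\iota\odot\varepsilon_B)(a\otimes b)=a\varepsilon_B(b)$; $S$ is an anti-automorphism of $A$ whose extension to $M(A)$ satisfies $S|_B=t_C^{-1}$, $S|_C=t_B^{-1}$, and, with $m$ the multiplication, $m(S\otimes\iota)(\Delta_C(a)(1\otimes b))=\varepsilon_B(a)b$ and $m(\iota\otimes S)((a\otimes1)\Delta_B(b))=a\,{}_C\varepsilon(b)$. It is locally projective if $B$ and $C$ are firm (multiplication induces $B\otimes_BB\cong B$, and likewise for $C$) and ${}_BA,A_B,{}_CA,A_C$ are locally projective; a right module $M_D$ is locally projective if for any $m_1,\dots,m_k\in M$ there are finitely many $\upsilon_i\in\operatorname{Hom}(M_D,D_D)$, $e_i\in\operatorname{Hom}(D_D,M_D)$ with $m_j=\sum_ie_i(\upsilon_i(m_j))$ for all $j$ (similarly for left modules). A functional $\omega$ on an algebra $A$ is faithful if $\omega(dA)\neq0$ and $\omega(Ad)\neq0$ for all $d\neq0$. A measured regular multiplier Hopf algebroid is a regular multiplier Hopf algebroid with faithful functionals $\mu_B$ on $B$, $\mu_C$ on $C$, a $B$-bimodule map ${}_B\psi_B\colon A\to B$ and a $C$-bimodule map ${}_C\phi_C\colon A\to C$ (for left and right multiplication) such that: (1) $\mu_B\circ t_C=\mu_C$, $\mu_C\circ t_B=\mu_B$, $\mu_B\circ\varepsilon_B=\mu_C\circ{}_C\varepsilon$;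 (2) ${}_B\psi_B$ is a partial right integral: $((S\circ{}_B\psi_B)\odot\iota)(\Delta_C(a)(1\otimes b))={}_B\psi_B(a)b$ where the slice map is $a\otimes b\mapsto S({}_B\psi_B(a))b$, and ${}_C\phi_C$ is a partial left integral: $(\iota\odot{}_C\phi_C)(\Delta_C(b)(a\otimes1))={}_C\phi_C(b)a$ where the slice map is $a\otimes b\mapsto t_C({}_C\phi_C(b))a$; (3) $\psi:=\mu_B\circ{}_B\psi_B$ and $\phi:=\mu_C\circ{}_C\phi_C$ are faithful; (4) there are surjective module maps ${}_B\phi\colon{}_BA\to{}_BB$, $\phi_B\colon A_B\to B_B$, ${}_C\psi\colon{}_CA\to{}_CC$, $\psi_C\colon A_C\to C_C$ with $\phi=\mu_B\circ{}_B\phi=\mu_B\circ\phi_B$ and $\psi=\mu_C\circ{}_C\psi=\mu_C\circ\psi_C$. Dual algebra. For a functional $\omega$ on $A$ let ${}_B\omega,\omega_B,{}_C\omega,\omega_C$ be the (unique, if existing) module maps ${}_BA\to{}_BB$, $A_B\to B_B$, ${}_CA\to{}_CC$, $A_C\to C_C$ whose composition with $\mu_B$ or $\mu_C$, respectively, is $\omega$. Write $(a\cdot\omega)(b)=\omega(ba)$, $(\omega\cdot a)(b)=\omega(ab)$. Put $\hat A:=A\cdot\phi=\phi\cdot A=A\cdot\psi=\psi\cdot A\subseteq A^\vee$ (linear dual); for $\omega\in\hat A$ all four module maps exist. For $\omega\in\hat A$, $a\in A$ there are unique $\omega\triangleright a,a\triangleleft\omega\in A$ with $(\omega\triangleright a)b=(\iota\odot{}_C\omega)(\Delta_C(a)(b\otimes1))$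 and $b(a\triangleleft\omega)=(\omega_B\odot\iota)((1\otimes b)\Delta_B(a))$, where $(\iota\odot{}_C\omega)(a\otimes b)=t_C({}_C\omega(b))a$, $(\omega_B\odot\iota)(a\otimes b)=bt_B(\omega_B(a))$. $\hat A$, the algebra underlying the dual regular multiplier Hopf algebroid $\hat{\mathcal A}$, is a non-degenerate idempotent algebra with product $\upsilon\omega:=\upsilon(\omega\triangleright-)=\omega(-\triangleleft\upsilon)$. A left cointegral in $\mathcal A$ is an element $l\in A$ with $al={}_C\varepsilon(a)l$ for all $a\in A$; a right cointegral is an element $r\in A$ with $ra=r\varepsilon_B(a)$ for all $a\in A$. $1_C$, $1_B$ are the units of $C$, $B$. *)

theory Defs
  imports Complex_Main "HOL-Library.Poly_Mapping"
begin

section \<open>Complex vector spaces and (not necessarily unital) complex algebras\<close>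

class complex_space = ab_group_add +
  fixes scaleC :: "complex \<Rightarrow> 'a \<Rightarrow> 'a" (infixr \<open>*\<^sub>C\<close> 75)
  assumes scaleC_add_right: "c *\<^sub>C (a + b) = c *\<^sub>C a + c *\<^sub>C b"
    and scaleC_add_left: "(c + d) *\<^sub>C a = c *\<^sub>C a + d *\<^sub>C a"
    and scaleC_scaleC: "c *\<^sub>C d *\<^sub>C a = (c * d) *\<^sub>C a"
    and scaleC_one: "1 *\<^sub>C a = a"

class complex_alg = complex_space + ring +
  assumes scaleC_mult_left: "(c *\<^sub>C a) * b = c *\<^sub>C (a * b)"
    and scaleC_mult_right: "a * (c *\<^sub>C b) = c *\<^sub>C (a * b)"

global_interpretation complex_space: vector_space "scaleC :: complex \<Rightarrow> 'a \<Rightarrow> 'a::complex_space"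
  by unfold_locales (simp_all add: scaleC_add_right scaleC_add_left scaleC_scaleC scaleC_one)

abbreviation cspan :: "'a::complex_space set \<Rightarrow> 'a set"
  where "cspan \<equiv> module.span scaleC"

abbreviation csubspace :: "'a::complex_space set \<Rightarrow> bool"
  where "csubspace \<equiv> module.subspace scaleC"

abbreviation clinear :: "('a::complex_space \<Rightarrow> 'b::complex_space) \<Rightarrow> bool"
  where "clinear \<equiv> Vector_Spaces.linear scaleC scaleC"

lemma clinear_iff:
  "clinear f \<longleftrightarrow> (\<forall>u v. f (u + v) = f u + f v) \<and> (\<forall>c u. f (c *\<^sub>C u) = c *\<^sub>C f u)"
  by (simp add: Vector_Spaces.linear_iff complex_space.vector_space_axioms)

definition clinear_on :: "'a::complex_space set \<Rightarrow> ('a \<Rightarrow> 'b::complex_space) \<Rightarrow> bool"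
  where "clinear_on V f \<longleftrightarrow>
    (\<forall>u\<in>V. \<forall>v\<in>V. f (u + v) = f u + f v) \<and> (\<forall>c. \<forall>u\<in>V. f (c *\<^sub>C u) = c *\<^sub>C f u)"

instantiation complex :: complex_space
begin

definition scaleC_complex :: "complex \<Rightarrow> complex \<Rightarrow> complex"
  where "scaleC_complex c z = c * z"

instance
  by standard (simp_all add: scaleC_complex_def algebra_simps)

end

instantiation poly_mapping :: (type, complex_space) complex_space
begin

lift_definition scaleC_poly_mapping :: "complex \<Rightarrow> ('a \<Rightarrow>\<^sub>0 'b) \<Rightarrow> 'a \<Rightarrow>\<^sub>0 'b"
  is "\<lambda>c f x. c *\<^sub>C f x"
  by (rule rev_finite_subset, assumption) (auto simp: complex_space.scale_zero_right)

instance
  by standard (transfer, auto simp: fun_eq_iff scaleC_add_right scaleC_add_left scaleC_scaleC scaleC_one)+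

end

definition nondegenerate_alg :: "'a::complex_alg itself \<Rightarrow> bool"
  where "nondegenerate_alg _ \<longleftrightarrow>
    (\<forall>a::'a. (\<forall>b. a * b = 0) \<longrightarrow> a = 0) \<and> (\<forall>a::'a. (\<forall>b. b * a = 0) \<longrightarrow> a = 0)"

definition idempotent_alg :: "'a::complex_alg itself \<Rightarrow> bool"
  where "idempotent_alg _ \<longleftrightarrow> cspan {a * b |a b :: 'a. True} = UNIV"

definition subalgebra :: "'a::complex_alg set \<Rightarrow> bool"
  where "subalgebra D \<longleftrightarrow> csubspace D \<and> (\<forall>x\<in>D. \<forall>y\<in>D. x * y \<in> D)"

definition anti_iso :: "'a::complex_alg set \<Rightarrow> 'b::complex_alg set \<Rightarrow> ('a \<Rightarrow> 'b) \<Rightarrow> bool"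
  where "anti_iso D E t \<longleftrightarrow>
    bij_betw t D E \<and> clinear_on D t \<and> (\<forall>x\<in>D. \<forall>y\<in>D. t (x * y) = t y * t x)"

definition unit_element :: "'a set \<Rightarrow> ('a \<Rightarrow> 'a \<Rightarrow> 'a) \<Rightarrow> 'a \<Rightarrow> bool"
  where "unit_element D m e \<longleftrightarrow> e \<in> D \<and> (\<forall>d\<in>D. m e d = d \<and> m d e = d)"

definition faithful :: "'a::complex_alg set \<Rightarrow> ('a \<Rightarrow> complex) \<Rightarrow> bool"
  where "faithful D f \<longleftrightarrow>
    (\<forall>d\<in>D. d \<noteq> 0 \<longrightarrow> (\<exists>x\<in>D. f (d * x) \<noteq> 0) \<and> (\<exists>x\<in>D. f (x * d) \<noteq> 0))"


section \<open>The multiplier algebra\<close>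

text \<open>A multiplier \<open>m\<close> is encoded by the pair of maps \<open>a \<mapsto> m a\<close> and \<open>a \<mapsto> a m\<close>; the
  product of multipliers composes the second components in the opposite order.\<close>

typedef (overloaded) 'a multiplier =
  "{(L, R). clinear (L :: 'a::complex_alg \<Rightarrow> 'a) \<and> clinear (R :: 'a \<Rightarrow> 'a) \<and>
     (\<forall>a b. L (a * b) = L a * b \<and> R (a * b) = a * R b \<and> R a * b = a * L b)}"
  by (rule exI[of _ "(\<lambda>a. a, \<lambda>a. a)"]) (simp add: clinear_iff)

setup_lifting type_definition_multiplier

lift_definition lact :: "'a::complex_alg multiplier \<Rightarrow> 'a \<Rightarrow> 'a" (infixr \<open>\<rightharpoonup>\<close> 75) is fst .

lift_definition ract :: "'a \<Rightarrow> 'a::complex_alg multiplier \<Rightarrow> 'a" (infixl \<open>\<leftharpoonup>\<close> 75)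
  is "\<lambda>a m. snd m a" .

instantiation multiplier :: (complex_alg) complex_alg
begin

lift_definition zero_multiplier :: "'a multiplier" is "(\<lambda>_. 0, \<lambda>_. 0)"
  by (simp add: clinear_iff)

lift_definition plus_multiplier :: "'a multiplier \<Rightarrow> 'a multiplier \<Rightarrow> 'a multiplier"
  is "\<lambda>(L, R) (L', R'). (\<lambda>a. L a + L' a, \<lambda>a. R a + R' a)"
  by (auto simp: clinear_iff scaleC_add_right algebra_simps)

lift_definition uminus_multiplier :: "'a multiplier \<Rightarrow> 'a multiplier"
  is "\<lambda>(L, R). (\<lambda>a. - L a, \<lambda>a. - R a)"
  by (auto simp: clinear_iff)

lift_definition minus_multiplier :: "'a multiplier \<Rightarrow> 'a multiplier \<Rightarrow> 'a multiplier"
  is "\<lambda>(L, R) (L', R'). (\<lambda>a. L a - L' a, \<lambda>a. R a - R' a)"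
  by (auto simp: clinear_iff complex_space.scale_right_diff_distrib algebra_simps)

lift_definition times_multiplier :: "'a multiplier \<Rightarrow> 'a multiplier \<Rightarrow> 'a multiplier"
  is "\<lambda>(L, R) (L', R'). (\<lambda>a. L (L' a), \<lambda>a. R' (R a))"
  by (auto simp: clinear_iff)

lift_definition scaleC_multiplier :: "complex \<Rightarrow> 'a multiplier \<Rightarrow> 'a multiplier"
  is "\<lambda>c (L, R). (\<lambda>a. c *\<^sub>C L a, \<lambda>a. c *\<^sub>C R a)"
  by (auto simp: clinear_iff scaleC_add_right scaleC_mult_left scaleC_mult_right
      scaleC_scaleC mult.commute)

instance
  by standard (transfer, auto simp: clinear_iff algebra_simps scaleC_add_right scaleC_add_left
      scaleC_scaleC scaleC_one)+

end


section \<open>Modules\<close>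

text \<open>An action is a map \<open>r\<close> taking first the acting element and then the module element,
  for left and for right modules alike; the algebra \<open>D\<close> itself is a left module via
  \<open>\<lambda>d d'. d * d'\<close> and a right module via \<open>\<lambda>d d'. d' * d\<close>.\<close>

definition nondegenerate_mod :: "'d set \<Rightarrow> ('d \<Rightarrow> 'm::zero \<Rightarrow> 'm) \<Rightarrow> bool"
  where "nondegenerate_mod D r \<longleftrightarrow> (\<forall>m. (\<forall>d\<in>D. r d m = 0) \<longrightarrow> m = 0)"

definition idempotent_mod :: "'d set \<Rightarrow> ('d \<Rightarrow> 'm::complex_space \<Rightarrow> 'm) \<Rightarrow> bool"
  where "idempotent_mod D r \<longleftrightarrow> cspan {r d m |d m. d \<in> D} = UNIV"

definition module_map ::
    "'d set \<Rightarrow> 'm::complex_space set \<Rightarrow> ('d \<Rightarrow> 'm \<Rightarrow> 'm) \<Rightarrow>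
     'n::complex_space set \<Rightarrow> ('d \<Rightarrow> 'n \<Rightarrow> 'n) \<Rightarrow> ('m \<Rightarrow> 'n) \<Rightarrow> bool"
  where "module_map D X r Y s f \<longleftrightarrow>
    clinear_on X f \<and> f ` X \<subseteq> Y \<and> (\<forall>d\<in>D. \<forall>x\<in>X. f (r d x) = s d (f x))"

definition locally_projective_mod ::
    "'d::complex_alg set \<Rightarrow> ('d \<Rightarrow> 'm::complex_space \<Rightarrow> 'm) \<Rightarrow> ('d \<Rightarrow> 'd \<Rightarrow> 'd) \<Rightarrow> bool"
  where "locally_projective_mod D r s \<longleftrightarrow>
    (\<forall>M. finite M \<longrightarrow> (\<exists>(n::nat) v e.
       (\<forall>i<n. module_map D UNIV r D s (v i) \<and> module_map D D s UNIV r (e i)) \<and>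
       (\<forall>m\<in>M. m = (\<Sum>i<n. e i (v i m)))))"


section \<open>Balanced tensor products\<close>

text \<open>Tensor products are quotients of the free complex vector space on pairs (or triples); their
  elements are cosets of the subspace of relations.\<close>

abbreviation tens :: "'x \<Rightarrow> 'x \<Rightarrow>\<^sub>0 complex"
  where "tens x \<equiv> Poly_Mapping.single x 1"

definition linext :: "('x \<Rightarrow> 'v::complex_space) \<Rightarrow> ('x \<Rightarrow>\<^sub>0 complex) \<Rightarrow> 'v"
  where "linext f u = (\<Sum>x\<in>Poly_Mapping.keys u. Poly_Mapping.lookup u x *\<^sub>C f x)"

definition coset :: "'v::complex_space set \<Rightarrow> 'v \<Rightarrow> 'v set"
  where "coset N u = {v. v - u \<in> N}"

definition qspace :: "'v::complex_space set \<Rightarrow> 'v set set"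
  where "qspace N = range (coset N)"

definition rep :: "'v set \<Rightarrow> 'v"
  where "rep X = (SOME u. u \<in> X)"

definition qadd :: "'v::complex_space set \<Rightarrow> 'v set \<Rightarrow> 'v set \<Rightarrow> 'v set"
  where "qadd N X Y = coset N (rep X + rep Y)"

definition qscale :: "'v::complex_space set \<Rightarrow> complex \<Rightarrow> 'v set \<Rightarrow> 'v set"
  where "qscale N c X = coset N (c *\<^sub>C rep X)"

definition qzero :: "'v::complex_space set \<Rightarrow> 'v set"
  where "qzero N = coset N 0"

definition qend :: "'v::complex_space set \<Rightarrow> ('v set \<Rightarrow> 'v set) set"
  where "qend N = {T. (\<forall>X\<in>qspace N. T X \<in> qspace N) \<and>
    (\<forall>X\<in>qspace N. \<forall>Y\<in>qspace N. T (qadd N X Y) = qadd N (T X) (T Y)) \<and>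
    (\<forall>c. \<forall>X\<in>qspace N. T (qscale N c X) = qscale N c (T X))}"

text \<open>\<open>r\<close> is the right action on the first factor and \<open>l\<close> the left action on the second one.\<close>

definition tensor_rel ::
    "'m::complex_space set \<Rightarrow> 'n::complex_space set \<Rightarrow> 'd set \<Rightarrow>
     ('d \<Rightarrow> 'm \<Rightarrow> 'm) \<Rightarrow> ('d \<Rightarrow> 'n \<Rightarrow> 'n) \<Rightarrow> ('m \<times> 'n \<Rightarrow>\<^sub>0 complex) set"
  where "tensor_rel X Y D r l = cspan (
      {tens (a + a', b) - tens (a, b) - tens (a', b) |a a' b. a \<in> X \<and> a' \<in> X \<and> b \<in> Y}
    \<union> {tens (a, b + b') - tens (a, b) - tens (a, b') |a b b'. a \<in> X \<and> b \<in> Y \<and> b' \<in> Y}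
    \<union> {tens (c *\<^sub>C a, b) - c *\<^sub>C tens (a, b) |c a b. a \<in> X \<and> b \<in> Y}
    \<union> {tens (a, c *\<^sub>C b) - c *\<^sub>C tens (a, b) |c a b. a \<in> X \<and> b \<in> Y}
    \<union> {tens (r d a, b) - tens (a, l d b) |d a b. d \<in> D \<and> a \<in> X \<and> b \<in> Y})"

definition tensor3_rel ::
    "'d set \<Rightarrow> ('d \<Rightarrow> 'm \<Rightarrow> 'm) \<Rightarrow> ('d \<Rightarrow> 'n \<Rightarrow> 'n) \<Rightarrow>
     'e set \<Rightarrow> ('e \<Rightarrow> 'n \<Rightarrow> 'n) \<Rightarrow> ('e \<Rightarrow> 'k \<Rightarrow> 'k) \<Rightarrow>
     ('m::complex_space \<times> 'n::complex_space \<times> 'k::complex_space \<Rightarrow>\<^sub>0 complex) set"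
  where "tensor3_rel D r l E r' l' = cspan (
      {tens (a + a', b, c) - tens (a, b, c) - tens (a', b, c) |a a' b c. True}
    \<union> {tens (a, b + b', c) - tens (a, b, c) - tens (a, b', c) |a b b' c. True}
    \<union> {tens (a, b, c + c') - tens (a, b, c) - tens (a, b, c') |a b c c'. True}
    \<union> {tens (z *\<^sub>C a, b, c) - z *\<^sub>C tens (a, b, c) |z a b c. True}
    \<union> {tens (a, z *\<^sub>C b, c) - z *\<^sub>C tens (a, b, c) |z a b c. True}
    \<union> {tens (a, b, z *\<^sub>C c) - z *\<^sub>C tens (a, b, c) |z a b c. True}
    \<union> {tens (r d a, b, c) - tens (a, l d b, c) |d a b c. d \<in> D}
    \<union> {tens (a, r' d b, c) - tens (a, b, l' d c) |d a b c. d \<in> E})"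

text \<open>For a balanced bilinear \<open>f\<close>, the induced linear map \<open>a \<otimes> b \<mapsto> f a b\<close>.\<close>

definition slice ::
    "('m \<Rightarrow> 'n \<Rightarrow> 'v::complex_space) \<Rightarrow> ('m \<times> 'n \<Rightarrow>\<^sub>0 complex) set \<Rightarrow> 'v"
  where "slice f X = linext (\<lambda>(a, b). f a b) (rep X)"

text \<open>The map \<open>f \<otimes> g\<close> on the quotient by \<open>N\<close>.\<close>

definition tmap ::
    "('m \<times> 'm \<Rightarrow>\<^sub>0 complex) set \<Rightarrow> ('m \<Rightarrow> 'm) \<Rightarrow> ('m \<Rightarrow> 'm) \<Rightarrow>
     ('m \<times> 'm \<Rightarrow>\<^sub>0 complex) set \<Rightarrow> ('m \<times> 'm \<Rightarrow>\<^sub>0 complex) set"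
  where "tmap N f g X = coset N (slice (\<lambda>a b. tens (f a, g b)) X)"

text \<open>For \<open>T :: A \<rightarrow> A \<otimes> A\<close>, the maps \<open>T \<otimes> \<iota>\<close> and \<open>\<iota> \<otimes> T\<close> into the quotient by \<open>N\<close> of the free
  vector space on triples.\<close>

definition leg12 ::
    "('m \<times> 'm \<times> 'm \<Rightarrow>\<^sub>0 complex) set \<Rightarrow> ('m \<Rightarrow> ('m \<times> 'm \<Rightarrow>\<^sub>0 complex) set) \<Rightarrow>
     ('m \<times> 'm \<Rightarrow>\<^sub>0 complex) set \<Rightarrow> ('m \<times> 'm \<times> 'm \<Rightarrow>\<^sub>0 complex) set"
  where "leg12 N T X = coset N (slice (\<lambda>d c. slice (\<lambda>p q. tens (p, q, c)) (T d)) X)"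

definition leg23 ::
    "('m \<times> 'm \<times> 'm \<Rightarrow>\<^sub>0 complex) set \<Rightarrow> ('m \<Rightarrow> ('m \<times> 'm \<Rightarrow>\<^sub>0 complex) set) \<Rightarrow>
     ('m \<times> 'm \<Rightarrow>\<^sub>0 complex) set \<Rightarrow> ('m \<times> 'm \<times> 'm \<Rightarrow>\<^sub>0 complex) set"
  where "leg23 N T X = coset N (slice (\<lambda>a d. slice (\<lambda>p q. tens (a, p, q)) (T d)) X)"

definition firm :: "'d::complex_alg set \<Rightarrow> bool"
  where "firm D \<longleftrightarrow> bij_betw (slice (*))
    (coset (tensor_rel D D D (\<lambda>d a. a * d) (\<lambda>d b. d * b)) ` {u. Poly_Mapping.keys u \<subseteq> D \<times> D}) D"


section \<open>The Takeuchi products\<close>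

text \<open>The two Takeuchi products are treated uniformly: \<open>m p a\<close> is the result of \<open>a\<close> acting on a
  tensor factor \<open>p\<close>, i.e. \<open>m = (*)\<close> for \<open>A\<^sup>C \<otimes> \<^sub>CA\<close> (right multiplication by \<open>a\<close>) and
  \<open>m = (\<lambda>p a. a * p)\<close> for \<open>A\<^sub>B \<otimes> \<^sup>BA\<close> (left multiplication, endomorphisms being written on the
  right).  In the first case \<open>first_leg N m T a = T (a \<otimes> 1)\<close> and
  \<open>second_leg N m T b = T (1 \<otimes> b)\<close>; in the second case they are \<open>(a \<otimes> 1) T\<close> and \<open>(1 \<otimes> b) T\<close>.\<close>

definition takeuchi ::
    "('a::complex_space \<times> 'a \<Rightarrow>\<^sub>0 complex) set \<Rightarrow> ('a \<Rightarrow> 'a \<Rightarrow> 'a) \<Rightarrow>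
     (('a \<times> 'a \<Rightarrow>\<^sub>0 complex) set \<Rightarrow> ('a \<times> 'a \<Rightarrow>\<^sub>0 complex) set) set"
  where "takeuchi N m = {T \<in> qend N.
    (\<forall>a. \<exists>X\<in>qspace N. \<forall>b. T (coset N (tens (a, b))) = tmap N id (\<lambda>q. m q b) X) \<and>
    (\<forall>b. \<exists>Y\<in>qspace N. \<forall>a. T (coset N (tens (a, b))) = tmap N (\<lambda>p. m p a) id Y)}"

definition first_leg ::
    "('a::complex_space \<times> 'a \<Rightarrow>\<^sub>0 complex) set \<Rightarrow> ('a \<Rightarrow> 'a \<Rightarrow> 'a) \<Rightarrow>
     (('a \<times> 'a \<Rightarrow>\<^sub>0 complex) set \<Rightarrow> ('a \<times> 'a \<Rightarrow>\<^sub>0 complex) set) \<Rightarrow>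
     'a \<Rightarrow> ('a \<times> 'a \<Rightarrow>\<^sub>0 complex) set"
  where "first_leg N m T a = (THE X. X \<in> qspace N \<and>
    (\<forall>b. T (coset N (tens (a, b))) = tmap N id (\<lambda>q. m q b) X))"

definition second_leg ::
    "('a::complex_space \<times> 'a \<Rightarrow>\<^sub>0 complex) set \<Rightarrow> ('a \<Rightarrow> 'a \<Rightarrow> 'a) \<Rightarrow>
     (('a \<times> 'a \<Rightarrow>\<^sub>0 complex) set \<Rightarrow> ('a \<times> 'a \<Rightarrow>\<^sub>0 complex) set) \<Rightarrow>
     'a \<Rightarrow> ('a \<times> 'a \<Rightarrow>\<^sub>0 complex) set"
  where "second_leg N m T b = (THE Y. Y \<in> qspace N \<and>
    (\<forall>a. T (coset N (tens (a, b))) = tmap N (\<lambda>p. m p a) id Y))"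


section \<open>Multiplier bialgebroids\<close>

record (overloaded) 'a bialgebroid =
  baseB :: "'a multiplier set"
  baseC :: "'a multiplier set"
  tB :: "'a multiplier \<Rightarrow> 'a multiplier"
  tC :: "'a multiplier \<Rightarrow> 'a multiplier"
  DeltaB :: "'a \<Rightarrow> ('a \<times> 'a \<Rightarrow>\<^sub>0 complex) set \<Rightarrow> ('a \<times> 'a \<Rightarrow>\<^sub>0 complex) set"
  DeltaC :: "'a \<Rightarrow> ('a \<times> 'a \<Rightarrow>\<^sub>0 complex) set \<Rightarrow> ('a \<times> 'a \<Rightarrow>\<^sub>0 complex) set"

text \<open>The relations defining \<open>A\<^sup>C \<otimes> \<^sub>CA\<close>, where \<open>t\<^sub>C(y)a \<otimes> b = a \<otimes> yb\<close>, and \<open>A\<^sub>B \<otimes> \<^sup>BA\<close>, where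
  \<open>ax \<otimes> b = a \<otimes> bt\<^sub>B(x)\<close>.\<close>

definition relC :: "'a::complex_alg bialgebroid \<Rightarrow> ('a \<times> 'a \<Rightarrow>\<^sub>0 complex) set"
  where "relC \<A> = tensor_rel UNIV UNIV (baseC \<A>) (\<lambda>y a. tC \<A> y \<rightharpoonup> a) (\<lambda>y b. y \<rightharpoonup> b)"

definition relB :: "'a::complex_alg bialgebroid \<Rightarrow> ('a \<times> 'a \<Rightarrow>\<^sub>0 complex) set"
  where "relB \<A> = tensor_rel UNIV UNIV (baseB \<A>) (\<lambda>x a. a \<leftharpoonup> x) (\<lambda>x b. b \<leftharpoonup> tB \<A> x)"

text \<open>The relations for the four triple tensor products; e.g. \<open>relCB\<close> belongs to
  \<open>A\<^sup>C \<otimes> \<^sub>CA\<^sub>B \<otimes> \<^sup>BA\<close>.\<close>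

definition relCC :: "'a::complex_alg bialgebroid \<Rightarrow> ('a \<times> 'a \<times> 'a \<Rightarrow>\<^sub>0 complex) set"
  where "relCC \<A> = tensor3_rel
    (baseC \<A>) (\<lambda>y a. tC \<A> y \<rightharpoonup> a) (\<lambda>y b. y \<rightharpoonup> b) (baseC \<A>) (\<lambda>y a. tC \<A> y \<rightharpoonup> a) (\<lambda>y b. y \<rightharpoonup> b)"

definition relBB :: "'a::complex_alg bialgebroid \<Rightarrow> ('a \<times> 'a \<times> 'a \<Rightarrow>\<^sub>0 complex) set"
  where "relBB \<A> = tensor3_rel
    (baseB \<A>) (\<lambda>x a. a \<leftharpoonup> x) (\<lambda>x b. b \<leftharpoonup> tB \<A> x) (baseB \<A>) (\<lambda>x a. a \<leftharpoonup> x) (\<lambda>x b. b \<leftharpoonup> tB \<A> x)"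

definition relCB :: "'a::complex_alg bialgebroid \<Rightarrow> ('a \<times> 'a \<times> 'a \<Rightarrow>\<^sub>0 complex) set"
  where "relCB \<A> = tensor3_rel
    (baseC \<A>) (\<lambda>y a. tC \<A> y \<rightharpoonup> a) (\<lambda>y b. y \<rightharpoonup> b) (baseB \<A>) (\<lambda>x a. a \<leftharpoonup> x) (\<lambda>x b. b \<leftharpoonup> tB \<A> x)"

definition relBC :: "'a::complex_alg bialgebroid \<Rightarrow> ('a \<times> 'a \<times> 'a \<Rightarrow>\<^sub>0 complex) set"
  where "relBC \<A> = tensor3_rel
    (baseB \<A>) (\<lambda>x a. a \<leftharpoonup> x) (\<lambda>x b. b \<leftharpoonup> tB \<A> x) (baseC \<A>) (\<lambda>y a. tC \<A> y \<rightharpoonup> a) (\<lambda>y b. y \<rightharpoonup> b)"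

text \<open>\<open>DeltaC_first \<A> b a = \<Delta>\<^sub>C(b)(a \<otimes> 1)\<close>, \<open>DeltaC_second \<A> a b = \<Delta>\<^sub>C(a)(1 \<otimes> b)\<close>,
  \<open>DeltaB_first \<A> b a = (a \<otimes> 1)\<Delta>\<^sub>B(b)\<close> and \<open>DeltaB_second \<A> a b = (1 \<otimes> b)\<Delta>\<^sub>B(a)\<close>: the
  argument of the comultiplication always comes first.\<close>

definition DeltaC_first ::
    "'a::complex_alg bialgebroid \<Rightarrow> 'a \<Rightarrow> 'a \<Rightarrow> ('a \<times> 'a \<Rightarrow>\<^sub>0 complex) set"
  where "DeltaC_first \<A> b a = first_leg (relC \<A>) (*) (DeltaC \<A> b) a"

definition DeltaC_second ::
    "'a::complex_alg bialgebroid \<Rightarrow> 'a \<Rightarrow> 'a \<Rightarrow> ('a \<times> 'a \<Rightarrow>\<^sub>0 complex) set"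
  where "DeltaC_second \<A> a b = second_leg (relC \<A>) (*) (DeltaC \<A> a) b"

definition DeltaB_first ::
    "'a::complex_alg bialgebroid \<Rightarrow> 'a \<Rightarrow> 'a \<Rightarrow> ('a \<times> 'a \<Rightarrow>\<^sub>0 complex) set"
  where "DeltaB_first \<A> b a = first_leg (relB \<A>) (\<lambda>p a. a * p) (DeltaB \<A> b) a"

definition DeltaB_second ::
    "'a::complex_alg bialgebroid \<Rightarrow> 'a \<Rightarrow> 'a \<Rightarrow> ('a \<times> 'a \<Rightarrow>\<^sub>0 complex) set"
  where "DeltaB_second \<A> a b = second_leg (relB \<A>) (\<lambda>p a. a * p) (DeltaB \<A> a) b"

text \<open>\<open>DeltaB \<A> a\<close> is an endomorphism written on the right, hence the reversed order in
  \<open>DeltaB_mult\<close> and \<open>DeltaB_bimodule\<close>.\<close>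

locale multiplier_bialgebroid =
  fixes \<A> :: "'a::complex_alg bialgebroid"
  assumes nondegenerate: "nondegenerate_alg TYPE('a)"
    and idempotent: "idempotent_alg TYPE('a)"
    and subalgebra_B: "subalgebra (baseB \<A>)"
    and subalgebra_C: "subalgebra (baseC \<A>)"
    and anti_iso_tB: "anti_iso (baseB \<A>) (baseC \<A>) (tB \<A>)"
    and anti_iso_tC: "anti_iso (baseC \<A>) (baseB \<A>) (tC \<A>)"
    and DeltaC_takeuchi: "DeltaC \<A> a \<in> takeuchi (relC \<A>) (*)"
    and DeltaC_add: "X \<in> qspace (relC \<A>) \<Longrightarrow>
      DeltaC \<A> (a + b) X = qadd (relC \<A>) (DeltaC \<A> a X) (DeltaC \<A> b X)"
    and DeltaC_scale: "X \<in> qspace (relC \<A>) \<Longrightarrow>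
      DeltaC \<A> (z *\<^sub>C a) X = qscale (relC \<A>) z (DeltaC \<A> a X)"
    and DeltaC_mult: "X \<in> qspace (relC \<A>) \<Longrightarrow> DeltaC \<A> (a * b) X = DeltaC \<A> a (DeltaC \<A> b X)"
    and DeltaB_takeuchi: "DeltaB \<A> a \<in> takeuchi (relB \<A>) (\<lambda>p a. a * p)"
    and DeltaB_add: "X \<in> qspace (relB \<A>) \<Longrightarrow>
      DeltaB \<A> (a + b) X = qadd (relB \<A>) (DeltaB \<A> a X) (DeltaB \<A> b X)"
    and DeltaB_scale: "X \<in> qspace (relB \<A>) \<Longrightarrow>
      DeltaB \<A> (z *\<^sub>C a) X = qscale (relB \<A>) z (DeltaB \<A> a X)"
    and DeltaB_mult: "X \<in> qspace (relB \<A>) \<Longrightarrow> DeltaB \<A> (a * b) X = DeltaB \<A> b (DeltaB \<A> a X)"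
    and commute: "x \<in> baseB \<A> \<Longrightarrow> y \<in> baseC \<A> \<Longrightarrow> x * y = y * x"
    and nondegenerate_B: "nondegenerate_mod (baseB \<A>) (\<lambda>x a. x \<rightharpoonup> a)"
      "nondegenerate_mod (baseB \<A>) (\<lambda>x a. a \<leftharpoonup> x)"
    and nondegenerate_C: "nondegenerate_mod (baseC \<A>) (\<lambda>y a. y \<rightharpoonup> a)"
      "nondegenerate_mod (baseC \<A>) (\<lambda>y a. a \<leftharpoonup> y)"
    and idempotent_B: "idempotent_mod (baseB \<A>) (\<lambda>x a. x \<rightharpoonup> a)"
      "idempotent_mod (baseB \<A>) (\<lambda>x a. a \<leftharpoonup> x)"
    and idempotent_C: "idempotent_mod (baseC \<A>) (\<lambda>y a. y \<rightharpoonup> a)"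
      "idempotent_mod (baseC \<A>) (\<lambda>y a. a \<leftharpoonup> y)"
    and nondegenerate_tensorC:
      "X \<in> qspace (relC \<A>) \<Longrightarrow> (\<And>a. tmap (relC \<A>) id (\<lambda>q. q * a) X = qzero (relC \<A>)) \<Longrightarrow>
        X = qzero (relC \<A>)"
      "X \<in> qspace (relC \<A>) \<Longrightarrow> (\<And>a. tmap (relC \<A>) (\<lambda>p. p * a) id X = qzero (relC \<A>)) \<Longrightarrow>
        X = qzero (relC \<A>)"
    and nondegenerate_tensorB:
      "X \<in> qspace (relB \<A>) \<Longrightarrow> (\<And>a. tmap (relB \<A>) id (\<lambda>q. a * q) X = qzero (relB \<A>)) \<Longrightarrow>
        X = qzero (relB \<A>)"
      "X \<in> qspace (relB \<A>) \<Longrightarrow> (\<And>a. tmap (relB \<A>) (\<lambda>p. a * p) id X = qzero (relB \<A>)) \<Longrightarrow>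
        X = qzero (relB \<A>)"
    and DeltaC_bimodule: "x \<in> baseB \<A> \<Longrightarrow> x' \<in> baseB \<A> \<Longrightarrow> y \<in> baseC \<A> \<Longrightarrow> y' \<in> baseC \<A> \<Longrightarrow>
      X \<in> qspace (relC \<A>) \<Longrightarrow>
      DeltaC \<A> (x \<rightharpoonup> (y \<rightharpoonup> ((a \<leftharpoonup> x') \<leftharpoonup> y'))) X =
        tmap (relC \<A>) (\<lambda>p. y \<rightharpoonup> p) (\<lambda>q. x \<rightharpoonup> q)
          (DeltaC \<A> a (tmap (relC \<A>) (\<lambda>p. y' \<rightharpoonup> p) (\<lambda>q. x' \<rightharpoonup> q) X))"
    and DeltaB_bimodule: "x \<in> baseB \<A> \<Longrightarrow> x' \<in> baseB \<A> \<Longrightarrow> y \<in> baseC \<A> \<Longrightarrow> y' \<in> baseC \<A> \<Longrightarrow>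
      X \<in> qspace (relB \<A>) \<Longrightarrow>
      DeltaB \<A> (x \<rightharpoonup> (y \<rightharpoonup> ((a \<leftharpoonup> x') \<leftharpoonup> y'))) X =
        tmap (relB \<A>) (\<lambda>p. p \<leftharpoonup> y') (\<lambda>q. q \<leftharpoonup> x')
          (DeltaB \<A> a (tmap (relB \<A>) (\<lambda>p. p \<leftharpoonup> y) (\<lambda>q. q \<leftharpoonup> x) X))"
    and coassoc_CC:
      "leg12 (relCC \<A>) (\<lambda>d. DeltaC_first \<A> d a) (DeltaC_second \<A> b c) =
       leg23 (relCC \<A>) (\<lambda>d. DeltaC_second \<A> d c) (DeltaC_first \<A> b a)"
    and coassoc_BB:
      "leg12 (relBB \<A>) (\<lambda>d. DeltaB_first \<A> d a) (DeltaB_second \<A> b c) =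
       leg23 (relBB \<A>) (\<lambda>d. DeltaB_second \<A> d c) (DeltaB_first \<A> b a)"
    and coassoc_CB:
      "leg12 (relCB \<A>) (\<lambda>d. DeltaC_first \<A> d a) (DeltaB_second \<A> b c) =
       leg23 (relCB \<A>) (\<lambda>d. DeltaB_second \<A> d c) (DeltaC_first \<A> b a)"
    and coassoc_BC:
      "leg12 (relBC \<A>) (\<lambda>d. DeltaB_first \<A> d a) (DeltaC_second \<A> b c) =
       leg23 (relBC \<A>) (\<lambda>d. DeltaC_second \<A> d c) (DeltaB_first \<A> b a)"


section \<open>Counits, antipode and integrals\<close>

definition left_counit ::
    "'a::complex_alg bialgebroid \<Rightarrow> ('a \<Rightarrow> 'a multiplier) \<Rightarrow> bool"
  where "left_counit \<A> e \<longleftrightarrow> clinear e \<and> range e \<subseteq> baseC \<A> \<and>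
    (\<forall>y\<in>baseC \<A>. \<forall>a. e (y \<rightharpoonup> a) = y * e a \<and> e (tC \<A> y \<rightharpoonup> a) = e a * y) \<and>
    (\<forall>a b. slice (\<lambda>p q. e p \<rightharpoonup> q) (DeltaC_second \<A> a b) = a * b \<and>
           slice (\<lambda>p q. tC \<A> (e q) \<rightharpoonup> p) (DeltaC_first \<A> a b) = a * b)"

definition right_counit ::
    "'a::complex_alg bialgebroid \<Rightarrow> ('a \<Rightarrow> 'a multiplier) \<Rightarrow> bool"
  where "right_counit \<A> e \<longleftrightarrow> clinear e \<and> range e \<subseteq> baseB \<A> \<and>
    (\<forall>x\<in>baseB \<A>. \<forall>a. e (a \<leftharpoonup> x) = e a * x \<and> e (a \<leftharpoonup> tB \<A> x) = x * e a) \<and>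
    (\<forall>a b. slice (\<lambda>p q. q \<leftharpoonup> tB \<A> (e p)) (DeltaB_second \<A> a b) = b * a \<and>
           slice (\<lambda>p q. p \<leftharpoonup> e q) (DeltaB_first \<A> a b) = b * a)"

text \<open>The extension of an anti-automorphism of \<open>A\<close> to multipliers.\<close>

definition ext_anti :: "('a::complex_alg \<Rightarrow> 'a) \<Rightarrow> 'a multiplier \<Rightarrow> 'a multiplier"
  where "ext_anti S m = (THE n. \<forall>a. n \<rightharpoonup> S a = S (a \<leftharpoonup> m) \<and> S a \<leftharpoonup> n = S (m \<rightharpoonup> a))"

definition antipode ::
    "'a::complex_alg bialgebroid \<Rightarrow> ('a \<Rightarrow> 'a multiplier) \<Rightarrow> ('a \<Rightarrow> 'a multiplier) \<Rightarrow>
     ('a \<Rightarrow> 'a) \<Rightarrow> bool"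
  where "antipode \<A> epsC epsB S \<longleftrightarrow> anti_iso UNIV UNIV S \<and>
    (\<forall>x\<in>baseB \<A>. ext_anti S x = inv_into (baseC \<A>) (tC \<A>) x) \<and>
    (\<forall>y\<in>baseC \<A>. ext_anti S y = inv_into (baseB \<A>) (tB \<A>) y) \<and>
    (\<forall>a b. slice (\<lambda>p q. S p * q) (DeltaC_second \<A> a b) = epsB a \<rightharpoonup> b) \<and>
    (\<forall>a b. slice (\<lambda>p q. p * S q) (DeltaB_first \<A> b a) = a \<leftharpoonup> epsC b)"

locale regular_multiplier_Hopf_algebroid = multiplier_bialgebroid \<A>
  for \<A> :: "'a::complex_alg bialgebroid" +
  fixes epsC epsB :: "'a \<Rightarrow> 'a multiplier" and S :: "'a \<Rightarrow> 'a"
  assumes left_counit: "left_counit \<A> epsC"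
    and right_counit: "right_counit \<A> epsB"
    and antipode: "antipode \<A> epsC epsB S"

definition locally_projective :: "'a::complex_alg bialgebroid \<Rightarrow> bool"
  where "locally_projective \<A> \<longleftrightarrow> firm (baseB \<A>) \<and> firm (baseC \<A>) \<and>
    locally_projective_mod (baseB \<A>) (\<lambda>x a. x \<rightharpoonup> a) (\<lambda>x z. x * z) \<and>
    locally_projective_mod (baseB \<A>) (\<lambda>x a. a \<leftharpoonup> x) (\<lambda>x z. z * x) \<and>
    locally_projective_mod (baseC \<A>) (\<lambda>y a. y \<rightharpoonup> a) (\<lambda>y z. y * z) \<and>
    locally_projective_mod (baseC \<A>) (\<lambda>y a. a \<leftharpoonup> y) (\<lambda>y z. z * y)"

text \<open>\<open>f\<close> is a surjective module map from \<open>A\<close> to \<open>D\<close> with \<open>\<mu> \<circ> f = \<omega>\<close>.\<close>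

definition surjective_factor ::
    "'d::complex_space set \<Rightarrow> ('d \<Rightarrow> 'a::complex_space \<Rightarrow> 'a) \<Rightarrow> ('d \<Rightarrow> 'd \<Rightarrow> 'd) \<Rightarrow>
     ('d \<Rightarrow> complex) \<Rightarrow> ('a \<Rightarrow> complex) \<Rightarrow> ('a \<Rightarrow> 'd) \<Rightarrow> bool"
  where "surjective_factor D r s \<mu> \<omega> f \<longleftrightarrow>
    module_map D UNIV r D s f \<and> range f = D \<and> (\<forall>a. \<omega> a = \<mu> (f a))"

locale measured_regular_multiplier_Hopf_algebroid =
  regular_multiplier_Hopf_algebroid \<A> epsC epsB S
  for \<A> :: "'a::complex_alg bialgebroid"
    and epsC epsB :: "'a \<Rightarrow> 'a multiplier" and S :: "'a \<Rightarrow> 'a" +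
  fixes \<mu>\<^sub>B \<mu>\<^sub>C :: "'a multiplier \<Rightarrow> complex" and \<psi> \<phi> :: "'a \<Rightarrow> 'a multiplier"
  assumes functional_muB: "clinear_on (baseB \<A>) \<mu>\<^sub>B"
    and faithful_muB: "faithful (baseB \<A>) \<mu>\<^sub>B"
    and functional_muC: "clinear_on (baseC \<A>) \<mu>\<^sub>C"
    and faithful_muC: "faithful (baseC \<A>) \<mu>\<^sub>C"
    and bimodule_psi: "module_map (baseB \<A>) UNIV (\<lambda>x a. x \<rightharpoonup> a) (baseB \<A>) (\<lambda>x z. x * z) \<psi>"
      "module_map (baseB \<A>) UNIV (\<lambda>x a. a \<leftharpoonup> x) (baseB \<A>) (\<lambda>x z. z * x) \<psi>"
    and bimodule_phi: "module_map (baseC \<A>) UNIV (\<lambda>y a. y \<rightharpoonup> a) (baseC \<A>) (\<lambda>y z. y * z) \<phi>"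
      "module_map (baseC \<A>) UNIV (\<lambda>y a. a \<leftharpoonup> y) (baseC \<A>) (\<lambda>y z. z * y) \<phi>"
    and mu_tC: "y \<in> baseC \<A> \<Longrightarrow> \<mu>\<^sub>B (tC \<A> y) = \<mu>\<^sub>C y"
    and mu_tB: "x \<in> baseB \<A> \<Longrightarrow> \<mu>\<^sub>C (tB \<A> x) = \<mu>\<^sub>B x"
    and mu_eps: "\<mu>\<^sub>B (epsB a) = \<mu>\<^sub>C (epsC a)"
    and right_integral: "slice (\<lambda>p q. ext_anti S (\<psi> p) \<rightharpoonup> q) (DeltaC_second \<A> a b) = \<psi> a \<rightharpoonup> b"
    and left_integral: "slice (\<lambda>p q. tC \<A> (\<phi> q) \<rightharpoonup> p) (DeltaC_first \<A> b a) = \<phi> b \<rightharpoonup> a"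
    and faithful_psi: "faithful UNIV (\<lambda>a. \<mu>\<^sub>B (\<psi> a))"
    and faithful_phi: "faithful UNIV (\<lambda>a. \<mu>\<^sub>C (\<phi> a))"
    and factor_phi:
      "\<exists>f. surjective_factor (baseB \<A>) (\<lambda>x a. x \<rightharpoonup> a) (\<lambda>x z. x * z) \<mu>\<^sub>B (\<lambda>a. \<mu>\<^sub>C (\<phi> a)) f"
      "\<exists>f. surjective_factor (baseB \<A>) (\<lambda>x a. a \<leftharpoonup> x) (\<lambda>x z. z * x) \<mu>\<^sub>B (\<lambda>a. \<mu>\<^sub>C (\<phi> a)) f"
    and factor_psi:
      "\<exists>f. surjective_factor (baseC \<A>) (\<lambda>y a. y \<rightharpoonup> a) (\<lambda>y z. y * z) \<mu>\<^sub>C (\<lambda>a. \<mu>\<^sub>B (\<psi> a)) f"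
      "\<exists>f. surjective_factor (baseC \<A>) (\<lambda>y a. a \<leftharpoonup> y) (\<lambda>y z. z * y) \<mu>\<^sub>C (\<lambda>a. \<mu>\<^sub>B (\<psi> a)) f"


section \<open>The dual algebra and cointegrals\<close>

text \<open>The unique module map \<open>f\<close> with \<open>\<mu> \<circ> f = \<omega>\<close>; \<open>left_C\<close> and \<open>right_B\<close> give \<open>\<^sub>C\<omega>\<close> and
  \<open>\<omega>\<^sub>B\<close>.  It is unique because \<open>\<mu>\<close> is faithful.\<close>

definition mod_factor ::
    "'d::complex_space set \<Rightarrow> ('d \<Rightarrow> 'a::complex_space \<Rightarrow> 'a) \<Rightarrow> ('d \<Rightarrow> 'd \<Rightarrow> 'd) \<Rightarrow>
     ('d \<Rightarrow> complex) \<Rightarrow> ('a \<Rightarrow> complex) \<Rightarrow> 'a \<Rightarrow> 'd"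
  where "mod_factor D r s \<mu> \<omega> = (THE f. module_map D UNIV r D s f \<and> (\<forall>a. \<mu> (f a) = \<omega> a))"

definition left_C ::
    "'a::complex_alg bialgebroid \<Rightarrow> ('a multiplier \<Rightarrow> complex) \<Rightarrow> ('a \<Rightarrow> complex) \<Rightarrow> 'a \<Rightarrow> 'a multiplier"
  where "left_C \<A> \<mu>\<^sub>C \<omega> = mod_factor (baseC \<A>) (\<lambda>y a. y \<rightharpoonup> a) (\<lambda>y z. y * z) \<mu>\<^sub>C \<omega>"

definition right_B ::
    "'a::complex_alg bialgebroid \<Rightarrow> ('a multiplier \<Rightarrow> complex) \<Rightarrow> ('a \<Rightarrow> complex) \<Rightarrow> 'a \<Rightarrow> 'a multiplier"
  where "right_B \<A> \<mu>\<^sub>B \<omega> = mod_factor (baseB \<A>) (\<lambda>x a. a \<leftharpoonup> x) (\<lambda>x z. z * x) \<mu>\<^sub>B \<omega>"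

text \<open>\<open>dual_left \<A> \<mu>\<^sub>C \<omega> a = \<omega> \<triangleright> a\<close> and \<open>dual_right \<A> \<mu>\<^sub>B a \<omega> = a \<triangleleft> \<omega>\<close>.\<close>

definition dual_left ::
    "'a::complex_alg bialgebroid \<Rightarrow> ('a multiplier \<Rightarrow> complex) \<Rightarrow> ('a \<Rightarrow> complex) \<Rightarrow> 'a \<Rightarrow> 'a"
  where "dual_left \<A> \<mu>\<^sub>C \<omega> a = (THE c. \<forall>b.
    c * b = slice (\<lambda>p q. tC \<A> (left_C \<A> \<mu>\<^sub>C \<omega> q) \<rightharpoonup> p) (DeltaC_first \<A> a b))"

definition dual_right ::
    "'a::complex_alg bialgebroid \<Rightarrow> ('a multiplier \<Rightarrow> complex) \<Rightarrow> 'a \<Rightarrow> ('a \<Rightarrow> complex) \<Rightarrow> 'a"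
  where "dual_right \<A> \<mu>\<^sub>B a \<omega> = (THE c. \<forall>b.
    b * c = slice (\<lambda>p q. q \<leftharpoonup> tB \<A> (right_B \<A> \<mu>\<^sub>B \<omega> p)) (DeltaB_second \<A> a b))"

text \<open>The underlying space \<open>A\<cdot>\<phi>\<close> of the dual algebra, with \<open>\<phi>\<close> here the \<open>C\<close>-valued map, and its
  product \<open>\<upsilon>\<omega> = \<upsilon>(\<omega> \<triangleright> -)\<close>.\<close>

definition dual_space ::
    "('a multiplier \<Rightarrow> complex) \<Rightarrow> ('a::complex_alg \<Rightarrow> 'a multiplier) \<Rightarrow> ('a \<Rightarrow> complex) set"
  where "dual_space \<mu>\<^sub>C \<phi> = {\<lambda>b. \<mu>\<^sub>C (\<phi> (b * a)) |a. True}"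

definition dual_mult ::
    "'a::complex_alg bialgebroid \<Rightarrow> ('a multiplier \<Rightarrow> complex) \<Rightarrow>
     ('a \<Rightarrow> complex) \<Rightarrow> ('a \<Rightarrow> complex) \<Rightarrow> 'a \<Rightarrow> complex"
  where "dual_mult \<A> \<mu>\<^sub>C \<upsilon> \<omega> = (\<lambda>a. \<upsilon> (dual_left \<A> \<mu>\<^sub>C \<omega> a))"

definition left_cointegral :: "('a::complex_alg \<Rightarrow> 'a multiplier) \<Rightarrow> 'a \<Rightarrow> bool"
  where "left_cointegral epsC l \<longleftrightarrow> (\<forall>a. a * l = epsC a \<rightharpoonup> l)"

definition right_cointegral :: "('a::complex_alg \<Rightarrow> 'a multiplier) \<Rightarrow> 'a \<Rightarrow> bool"
  where "right_cointegral epsB r \<longleftrightarrow> (\<forall>a. r * a = r \<leftharpoonup> epsB a)"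

end

theory Submission
  imports Defs
begin

text \<open>Write \<open>\<phi>\<close> and \<open>\<psi>\<close> for the two total integrals (functionals on \<open>A\<close>), \<open>\<Phi>\<close> and \<open>\<Psi>\<close> for the underlying
  \<open>C\<close>-valued and \<open>B\<close>-valued maps, \<open>a\<cdot>\<phi>\<close> and \<open>\<phi>\<cdot>a\<close> for \<open>x \<mapsto> \<phi>(xa)\<close> and \<open>x \<mapsto> \<phi>(ax)\<close>, and
  \<open>\<epsilon> = \<mu>\<^sub>B \<circ> \<epsilon>\<^sub>B = \<mu>\<^sub>C \<circ> \<epsilon>\<^sub>C\<close>.  All three conditions say that \<open>\<epsilon>\<close> belongs to the dual space.

  If \<open>\<epsilon> = l\<cdot>\<phi>\<close>, then \<open>\<epsilon> \<triangleright> x = x\<close> and \<open>\<epsilon>(\<omega> \<triangleright> x) = \<omega>(x)\<close>, so \<open>\<epsilon>\<close> is the unit of the dual algebra;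
  conversely a unit \<open>l\<cdot>\<phi>\<close> satisfies \<open>(l\<cdot>\<phi>) \<triangleright> x = x\<close>, because the functionals \<open>b\<cdot>\<phi>\<close> separate points,
  and applying \<open>\<epsilon>\<close> gives \<open>\<phi>(xl) = \<epsilon>(x)\<close> (\<open>dual_unit_iff\<close>).  The equation \<open>\<phi>(xl) = \<epsilon>(x)\<close> means
  \<open>\<Phi>(xl) = \<epsilon>\<^sub>C(x)\<close>; together with \<open>\<epsilon>\<^sub>C(ba) = \<epsilon>\<^sub>C(b \<epsilon>\<^sub>C(a))\<close> and the faithfulness of \<open>\<phi>\<close> it says exactly
  that \<open>l\<close> is a left cointegral with \<open>\<Phi>(l) = 1\<close> (\<open>counit_left_cointegral_iff\<close>).  In the same way
  \<open>\<epsilon> = \<psi>\<cdot>r\<close> means that \<open>r\<close> is a right cointegral with \<open>\<Psi>(r) = 1\<close>.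

  The two sides are linked by \<open>A\<cdot>\<phi> = \<psi>\<cdot>A\<close> (\<open>phi_dual_subset\<close> and its mirror image).  For
  \<open>F(x) = \<psi>(a ((b\<cdot>\<phi>) \<triangleright> x)) = \<phi>((x \<triangleleft> (\<psi>\<cdot>a)) b)\<close> (\<open>convolution_associative\<close>), strong invariance turns
  \<open>(b\<cdot>\<phi>) \<triangleright> x\<close> into a slice of \<open>(1 \<otimes> x)\<Delta>\<^sub>B(b)\<close>, and mixed coassociativity then gives \<open>F = c\<cdot>\<phi>\<close> for a slice \<open>c\<close>
  of \<open>\<Delta>\<^sub>C(b)(S(a) \<otimes> 1)\<close> (\<open>modular_property\<close>).  By symmetry \<open>F = \<psi>\<cdot>c'\<close>.  Since the elements
  \<open>\<Delta>\<^sub>C(b)(a \<otimes> 1)\<close> span \<open>A\<^sup>C \<otimes> \<^sub>CA\<close>, the slices \<open>c\<close> span \<open>A\<close>, and similarly the slices \<open>c'\<close>.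

  Finally let \<open>\<epsilon> = l\<cdot>\<phi>\<close>.  The same computation with \<open>\<phi>\<close> in place of \<open>\<psi>\<close> and \<open>b = l\<close> shows
  \<open>\<phi>\<cdot>c = d\<cdot>\<phi>\<close> for a suitable \<open>d\<close>, and then \<open>(d\<cdot>\<phi>) \<triangleright> l = S(c)\<close> by strong invariance
  (\<open>cointegral_generates\<close>).  As \<open>S\<close> is onto, \<open>l\<close> generates \<open>A\<close>; the statement for \<open>r\<close> is symmetric.

  The structure is symmetric under passing to the opposite algebra and flipping the legs of the
  comultiplications, which exchanges \<open>B\<close> and \<open>C\<close>, \<open>\<Phi>\<close> and \<open>\<Psi>\<close>, left and right.  To prove everything only once,
  the argument is carried out for abstract data that are closed under this symmetry; elements of
  balanced tensor products appear there as lists of pairs, and are compared by means of scalar-valued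
  balanced forms.\<close>

section \<open>Linear algebra on free spaces\<close>

lemma complex_vector_space_pair:
  "vector_space_pair (scaleC :: complex \<Rightarrow> 'a \<Rightarrow> 'a::complex_space) (scaleC :: complex \<Rightarrow> 'b \<Rightarrow> 'b::complex_space)"
  by (simp add: vector_space_pair_def complex_space.vector_space_axioms)

lemma clinear_add: "clinear f \<Longrightarrow> f (u + v) = f u + f v"
  and clinear_scale: "clinear f \<Longrightarrow> f (c *\<^sub>C u) = c *\<^sub>C f u"
  by (simp_all add: clinear_iff)

lemma clinear_zero: "clinear f \<Longrightarrow> f 0 = 0"
  using clinear_add[of f 0 0] by simp

lemma clinear_uminus: "clinear f \<Longrightarrow> f (- u) = - f u"
  using clinear_add[of f u "- u"] clinear_zero[of f] by (simp add: eq_neg_iff_add_eq_0 add.commute)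

lemma clinear_diff: "clinear f \<Longrightarrow> f (u - v) = f u - f v"
  using clinear_add[of f u "- v"] clinear_uminus[of f v] by simp

lemma clinear_sum: "clinear f \<Longrightarrow> f (\<Sum>x\<in>X. g x) = (\<Sum>x\<in>X. f (g x))"
  by (induction X rule: infinite_finite_induct) (simp_all add: clinear_zero clinear_add)

lemma linext_superset:
  assumes "finite K" "Poly_Mapping.keys u \<subseteq> K"
  shows "linext f u = (\<Sum>x\<in>K. Poly_Mapping.lookup u x *\<^sub>C f x)"
  unfolding linext_def
  by (rule sum.mono_neutral_left)
    (use assms in \<open>auto simp: in_keys_iff complex_space.scale_zero_left\<close>)

lemma linext_clinear: "clinear (linext f)"
proof -
  have "linext f (u + v) = linext f u + linext f v" for u v
  proof -
    let ?K = "Poly_Mapping.keys u \<union> Poly_Mapping.keys v"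
    have "linext f (u + v) = (\<Sum>x\<in>?K. Poly_Mapping.lookup (u + v) x *\<^sub>C f x)"
      by (rule linext_superset) (use Poly_Mapping.keys_add[of u v] in auto)
    also have "\<dots> = (\<Sum>x\<in>?K. Poly_Mapping.lookup u x *\<^sub>C f x) + (\<Sum>x\<in>?K. Poly_Mapping.lookup v x *\<^sub>C f x)"
      by (simp add: lookup_add scaleC_add_left sum.distrib)
    also have "\<dots> = linext f u + linext f v"
      by (simp add: linext_superset[of ?K])
    finally show ?thesis .
  qed
  moreover have "linext f (c *\<^sub>C u) = c *\<^sub>C linext f u" for c u
  proof -
    have look: "Poly_Mapping.lookup (c *\<^sub>C u) x = c * Poly_Mapping.lookup u x" for x
      by transfer (simp add: scaleC_complex_def)
    have "linext f (c *\<^sub>C u) = (\<Sum>x\<in>Poly_Mapping.keys u. Poly_Mapping.lookup (c *\<^sub>C u) x *\<^sub>C f x)"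
      by (rule linext_superset) (auto simp: in_keys_iff look)
    then show ?thesis
      by (simp add: linext_def look complex_space.scale_sum_right scaleC_scaleC)
  qed
  ultimately show ?thesis by (simp add: clinear_iff)
qed

lemma linext_tens: "linext f (tens x) = f x"
  by (simp add: linext_def scaleC_one)

lemma linext_tens_eq: "linext tens u = u"
proof (rule poly_mapping_eqI)
  fix y
  have "Poly_Mapping.lookup (linext tens u) y =
      (\<Sum>x\<in>Poly_Mapping.keys u. Poly_Mapping.lookup (Poly_Mapping.lookup u x *\<^sub>C tens x) y)"
    by (simp add: linext_def lookup_sum)
  also have "\<dots> = (\<Sum>x\<in>Poly_Mapping.keys u. if x = y then Poly_Mapping.lookup u x else 0)"
    by (intro sum.cong refl) (transfer, simp add: scaleC_complex_def when_def)
  also have "\<dots> = Poly_Mapping.lookup u y"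
    by (simp add: in_keys_iff)
  finally show "Poly_Mapping.lookup (linext tens u) y = Poly_Mapping.lookup u y" .
qed

lemma clinear_linext: "clinear g \<Longrightarrow> g u = linext (\<lambda>x. g (tens x)) u"
proof -
  assume g: "clinear g"
  have "g u = g (linext tens u)" by (simp add: linext_tens_eq)
  also have "\<dots> = linext (\<lambda>x. g (tens x)) u"
    by (simp add: linext_def clinear_sum[OF g] clinear_scale[OF g])
  finally show ?thesis .
qed

lemma separating_functional:
  fixes N :: "'v::complex_space set"
  assumes "csubspace N" "u \<notin> N"
  obtains g :: "'v \<Rightarrow> complex" where "clinear g" "\<And>v. v \<in> N \<Longrightarrow> g v = 0" "g u = 1"
proof -
  interpret vector_space_pair "scaleC :: complex \<Rightarrow> 'v \<Rightarrow> 'v" "scaleC :: complex \<Rightarrow> complex \<Rightarrow> complex"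
    by (rule complex_vector_space_pair)
  obtain B where B: "B \<subseteq> N" "complex_space.independent B" "N \<subseteq> cspan B"
    using complex_space.maximal_independent_subset[of N] by metis
  have sp: "cspan B \<subseteq> N" by (rule complex_space.span_minimal) (use B assms in auto)
  then have ind: "complex_space.independent (insert u B)"
    using B assms by (intro complex_space.independent_insertI) auto
  obtain g where g: "clinear g" "\<And>x. x \<in> insert u B \<Longrightarrow> g x = (if x = u then 1 else 0 :: complex)"
    using linear_independent_extend[OF ind, of "\<lambda>x. if x = u then 1 else 0"] by blast
  have "cspan B \<subseteq> {v. g v = 0}"
  proof (rule complex_space.span_minimal)
    show "B \<subseteq> {v. g v = 0}" using g(2) B assms by auto
    show "csubspace {v. g v = 0}"
      by (rule complex_space.subspaceI) (simp_all add: clinear_zero clinear_add clinear_scale g(1))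
  qed
  with B g show ?thesis by (intro that[of g]) auto
qed

lemma separating_functional_eq:
  fixes u v :: "'v::complex_space"
  assumes "\<And>g :: 'v \<Rightarrow> complex. clinear g \<Longrightarrow> g u = g v"
  shows "u = v"
proof (rule ccontr)
  assume "u \<noteq> v"
  then obtain g :: "'v \<Rightarrow> complex" where "clinear g" "g (u - v) = 1"
    using separating_functional[of "{0}" "u - v"] complex_space.subspace_0 by auto
  then show False using assms[of g] by (simp add: clinear_diff)
qed

section \<open>Balanced tensor products in terms of lists\<close>

text \<open>A list of pairs \<open>(p, q)\<close> stands for the tensor \<open>\<Sum> p \<otimes> q\<close>, with scalars absorbed into the pairs;
  \<open>tsum f\<close> is then the evaluation of the linear map \<open>p \<otimes> q \<mapsto> f p q\<close>.\<close>

definition tsum :: "('m \<Rightarrow> 'n \<Rightarrow> 'v::comm_monoid_add) \<Rightarrow> ('m \<times> 'n) list \<Rightarrow> 'v"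
  where "tsum f xs = (\<Sum>(p, q)\<leftarrow>xs. f p q)"

lemma tsum_Nil [simp]: "tsum f [] = 0"
  and tsum_Cons [simp]: "tsum f ((p, q) # xs) = f p q + tsum f xs"
  and tsum_append [simp]: "tsum f (xs @ ys) = tsum f xs + tsum f ys"
  by (simp_all add: tsum_def)

lemma tsum_swap [simp]: "tsum f (map prod.swap xs) = tsum (\<lambda>p q. f q p) xs"
  by (induction xs) auto

lemma tsum_map: "tsum f (map (map_prod g h) xs) = tsum (\<lambda>p q. f (g p) (h q)) xs"
  by (induction xs) auto

lemma tsum_concat: "tsum f (concat (map (case_prod g) xs)) = tsum (\<lambda>p q. tsum f (g p q)) xs"
  by (induction xs) auto

lemma tsum_add: "tsum (\<lambda>p q. f p q + g p q) xs = tsum f xs + tsum g xs"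
  by (induction xs) (auto simp: algebra_simps)

lemma clinear_tsum: "clinear L \<Longrightarrow> L (tsum f xs) = tsum (\<lambda>p q. L (f p q)) xs"
  by (induction xs) (auto simp: clinear_zero clinear_add)

lemma clinear_scaleC: "clinear (\<lambda>x. c *\<^sub>C x)"
  by (simp add: clinear_iff scaleC_add_right scaleC_scaleC mult.commute)

lemma tsum_scale: "tsum (\<lambda>p q. c *\<^sub>C f p q) xs = c *\<^sub>C tsum f xs"
  by (simp add: clinear_tsum[OF clinear_scaleC])

lemma tsum_in_subspace:
  "csubspace V \<Longrightarrow> (\<And>p q. f p q \<in> V) \<Longrightarrow> tsum f xs \<in> V"
  by (induction xs) (auto simp: complex_space.subspace_0 complex_space.subspace_add)

definition bilin :: "('m::complex_space \<Rightarrow> 'n::complex_space \<Rightarrow> 'v::complex_space) \<Rightarrow> bool"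
  where "bilin f \<longleftrightarrow> (\<forall>a a' b. f (a + a') b = f a b + f a' b) \<and> (\<forall>a b b'. f a (b + b') = f a b + f a b')
    \<and> (\<forall>c a b. f (c *\<^sub>C a) b = c *\<^sub>C f a b) \<and> (\<forall>c a b. f a (c *\<^sub>C b) = c *\<^sub>C f a b)"

definition balanced ::
    "'d set \<Rightarrow> ('d \<Rightarrow> 'm \<Rightarrow> 'm) \<Rightarrow> ('d \<Rightarrow> 'n \<Rightarrow> 'n) \<Rightarrow> ('m::complex_space \<Rightarrow> 'n::complex_space \<Rightarrow> 'v::complex_space) \<Rightarrow> bool"
  where "balanced D r l f \<longleftrightarrow> bilin f \<and> (\<forall>d\<in>D. \<forall>a b. f (r d a) b = f a (l d b))"

lemma balancedD:
  assumes "balanced D r l f"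
  shows "f (a + a') b = f a b + f a' b" "f a (b + b') = f a b + f a b'"
    "f (c *\<^sub>C a) b = c *\<^sub>C f a b" "f a (c *\<^sub>C b) = c *\<^sub>C f a b"
    "d \<in> D \<Longrightarrow> f (r d a) b = f a (l d b)"
  using assms unfolding balanced_def bilin_def by blast+

definition tlist :: "('m \<times> 'n) list \<Rightarrow> ('m \<times> 'n \<Rightarrow>\<^sub>0 complex)"
  where "tlist xs = tsum (\<lambda>p q. tens (p, q)) xs"

definition tclass ::
    "('m::complex_space \<times> 'n::complex_space \<Rightarrow>\<^sub>0 complex) set \<Rightarrow> ('m \<times> 'n) list \<Rightarrow> ('m \<times> 'n \<Rightarrow>\<^sub>0 complex) set"
  where "tclass N xs = coset N (tlist xs)"

definition trep ::
    "('m::complex_space \<times> 'n::complex_space \<Rightarrow>\<^sub>0 complex) set \<Rightarrow> ('m \<times> 'n \<Rightarrow>\<^sub>0 complex) set \<Rightarrow> ('m \<times> 'n) list"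
  where "trep N X = (SOME xs. X = tclass N xs)"

lemma coset_eq_iff:
  assumes "csubspace N"
  shows "coset N u = coset N v \<longleftrightarrow> u - v \<in> N"
proof
  assume "coset N u = coset N v"
  then have "u \<in> coset N v"
    by (metis (mono_tags, lifting) assms coset_def complex_space.subspace_0 diff_self mem_Collect_eq)
  then show "u - v \<in> N" by (simp add: coset_def)
next
  assume uv: "u - v \<in> N"
  have "w - v \<in> N \<longleftrightarrow> w - u \<in> N" for w
    using complex_space.subspace_add[OF assms uv, of "w - u"]
      complex_space.subspace_diff[OF assms _ uv, of "w - v"] by auto
  then show "coset N u = coset N v" by (auto simp: coset_def)
qed

lemma rep_coset: "csubspace N \<Longrightarrow> rep (coset N u) - u \<in> N"
proof -
  assume "csubspace N"
  then have "u \<in> coset N u" by (simp add: coset_def complex_space.subspace_0)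
  then have "rep (coset N u) \<in> coset N u" unfolding rep_def by (rule someI)
  then show ?thesis by (simp add: coset_def)
qed

lemma functional_rep:
  assumes "csubspace N" "clinear g" "\<And>v. v \<in> N \<Longrightarrow> g v = 0"
  shows "g (rep (coset N u)) = g u"
  using rep_coset[OF assms(1), of u] assms(3)[of "rep (coset N u) - u"] by (simp add: clinear_diff[OF assms(2)])

context
  fixes D :: "'d set" and r :: "'d \<Rightarrow> 'm \<Rightarrow> 'm::complex_space" and l :: "'d \<Rightarrow> 'n \<Rightarrow> 'n::complex_space"
    and N :: "('m \<times> 'n \<Rightarrow>\<^sub>0 complex) set"
  assumes N: "N = tensor_rel UNIV UNIV D r l"
begin

lemma tensor_rel_subspace: "csubspace N"
  unfolding N tensor_rel_def by (rule complex_space.subspace_span)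

lemma tensor_rel_gens:
  shows "tens (a + a', b) - tens (a, b) - tens (a', b) \<in> N"
    and "tens (a, b + b') - tens (a, b) - tens (a, b') \<in> N"
    and "tens (c *\<^sub>C a, b) - c *\<^sub>C tens (a, b) \<in> N"
    and "tens (a, c *\<^sub>C b) - c *\<^sub>C tens (a, b) \<in> N"
    and "d \<in> D \<Longrightarrow> tens (r d a, b) - tens (a, l d b) \<in> N"
  unfolding N tensor_rel_def
      apply (rule complex_space.span_base, rule UnI1, rule UnI1, rule UnI1, rule UnI1, blast)
     apply (rule complex_space.span_base, rule UnI1, rule UnI1, rule UnI1, rule UnI2, blast)
    apply (rule complex_space.span_base, rule UnI1, rule UnI1, rule UnI2, blast)
   apply (rule complex_space.span_base, rule UnI1, rule UnI2, blast)
  apply (rule complex_space.span_base, rule UnI2, blast)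
  done

lemma balanced_vanishes:
  assumes f: "balanced D r l f" and u: "u \<in> N"
  shows "linext (case_prod f) u = 0"
proof -
  let ?g = "linext (case_prod f)"
  have lin: "clinear ?g" by (rule linext_clinear)
  have "N \<subseteq> {v. ?g v = 0}"
    unfolding N tensor_rel_def
  proof (rule complex_space.span_minimal)
    show "csubspace {v. ?g v = 0}"
      by (rule complex_space.subspaceI) (simp_all add: clinear_zero clinear_add clinear_scale lin)
  qed (auto simp: clinear_diff[OF lin] clinear_scale[OF lin] linext_tens balancedD[OF f])
  with u show ?thesis by blast
qed

lemma slice_coset:
  assumes f: "balanced D r l f"
  shows "slice f (coset N u) = linext (case_prod f) u"
  unfolding slice_def
  by (rule functional_rep[OF tensor_rel_subspace linext_clinear balanced_vanishes[OF f]])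

lemma slice_tclass:
  assumes f: "balanced D r l f"
  shows "slice f (tclass N xs) = tsum f xs"
  by (simp add: tclass_def slice_coset[OF f] tlist_def clinear_tsum[OF linext_clinear] linext_tens)

lemma functional_balanced:
  fixes g :: "('m \<times> 'n \<Rightarrow>\<^sub>0 complex) \<Rightarrow> 'v::complex_space"
  assumes g: "clinear g" "\<And>v. v \<in> N \<Longrightarrow> g v = 0"
  shows "balanced D r l (\<lambda>a b. g (tens (a, b)))"
proof -
  note eq = clinear_diff[OF g(1)] clinear_scale[OF g(1)]
  have "g (tens (a + a', b)) = g (tens (a, b)) + g (tens (a', b))" for a a' b
    using g(2)[OF tensor_rel_gens(1), of a a' b] by (simp only: eq diff_eq_eq add_0_left add.commute)
  moreover have "g (tens (a, b + b')) = g (tens (a, b)) + g (tens (a, b'))" for a b b'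
    using g(2)[OF tensor_rel_gens(2), of a b b'] by (simp only: eq diff_eq_eq add_0_left add.commute)
  moreover have "g (tens (c *\<^sub>C a, b)) = c *\<^sub>C g (tens (a, b))" for c a b
    using g(2)[OF tensor_rel_gens(3), of c a b] by (simp add: eq)
  moreover have "g (tens (a, c *\<^sub>C b)) = c *\<^sub>C g (tens (a, b))" for c a b
    using g(2)[OF tensor_rel_gens(4), of a c b] by (simp add: eq)
  moreover have "g (tens (r d a, b)) = g (tens (a, l d b))" if "d \<in> D" for d a b
    using g(2)[OF tensor_rel_gens(5)[OF that], of a b] by (simp add: eq)
  ultimately show ?thesis by (simp add: balanced_def bilin_def)
qed

text \<open>Scalar balanced forms are the functionals on the quotient, and functionals separate points.
  This is what allows all identities between tensors below to be tested on scalar forms.\<close>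

lemma coset_eqI:
  assumes "\<And>f :: 'm \<Rightarrow> 'n \<Rightarrow> complex. balanced D r l f \<Longrightarrow> linext (case_prod f) u = linext (case_prod f) v"
  shows "coset N u = coset N v"
proof (rule ccontr)
  assume "coset N u \<noteq> coset N v"
  then have "u - v \<notin> N" using coset_eq_iff[OF tensor_rel_subspace] by blast
  then obtain g :: "_ \<Rightarrow> complex" where g: "clinear g" "\<And>w. w \<in> N \<Longrightarrow> g w = 0" "g (u - v) = 1"
    by (rule separating_functional[OF tensor_rel_subspace]) (rule that)
  have "case_prod (\<lambda>a b. g (tens (a, b))) = (\<lambda>x. g (tens x))"
    by (rule ext) (simp only: split_paired_all prod.case)
  then have "g w = linext (case_prod (\<lambda>a b. g (tens (a, b)))) w" for w
    by (simp only: clinear_linext[OF g(1), symmetric])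
  then have "g u = g v" using assms[OF functional_balanced[OF g(1,2)]] by metis
  then show False using g(3) by (simp add: clinear_diff[OF g(1)])
qed

text \<open>A coefficient \<open>c\<close> of \<open>a \<otimes> b\<close> can be absorbed, as \<open>ca \<otimes> b\<close>, so that lists without coefficients suffice.\<close>

lemma ex_tclass: "\<exists>xs. coset N u = tclass N xs"
proof -
  have scale: "\<exists>ys. coset N (c *\<^sub>C tens x) = tclass N ys" for c x
  proof (cases x)
    case (Pair a b)
    have "coset N (c *\<^sub>C tens x) = tclass N [(c *\<^sub>C a, b)]"
      unfolding tclass_def
      by (rule coset_eqI) (simp add: Pair tlist_def linext_tens clinear_scale[OF linext_clinear] balancedD)
    then show ?thesis by blast
  qed
  have "\<exists>xs. coset N (\<Sum>x\<in>K. c x *\<^sub>C tens x) = tclass N xs" if "finite K" for K c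
    using that
  proof (induction K rule: finite_induct)
    case empty
    show ?case by (rule exI[of _ "[]"]) (simp add: tclass_def tlist_def)
  next
    case (insert x K)
    from insert.IH obtain xs where xs: "coset N (\<Sum>x\<in>K. c x *\<^sub>C tens x) = tclass N xs" by blast
    obtain ys where ys: "coset N (c x *\<^sub>C tens x) = tclass N ys" using scale by blast
    have eq: "linext (case_prod f) (\<Sum>x\<in>K. c x *\<^sub>C tens x) = tsum f xs"
      "linext (case_prod f) (c x *\<^sub>C tens x) = tsum f ys"
      if "balanced D r l f" for f :: "'m \<Rightarrow> 'n \<Rightarrow> complex"
      using slice_coset[OF that] slice_tclass[OF that] xs ys by metis+
    have "coset N (\<Sum>x\<in>insert x K. c x *\<^sub>C tens x) = tclass N (ys @ xs)"
      unfolding tclass_def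
    proof (rule coset_eqI)
      fix f :: "'m \<Rightarrow> 'n \<Rightarrow> complex"
      assume f: "balanced D r l f"
      have "linext (case_prod f) (\<Sum>x\<in>insert x K. c x *\<^sub>C tens x) = tsum f ys + tsum f xs"
        using insert.hyps by (simp add: clinear_add[OF linext_clinear] eq[OF f])
      also have "\<dots> = linext (case_prod f) (tlist (ys @ xs))"
        by (simp add: tlist_def clinear_add[OF linext_clinear] clinear_tsum[OF linext_clinear] linext_tens)
      finally show "linext (case_prod f) (\<Sum>x\<in>insert x K. c x *\<^sub>C tens x) = linext (case_prod f) (tlist (ys @ xs))" .
    qed
    then show ?case by blast
  qed
  then have "\<exists>xs. coset N (linext tens u) = tclass N xs"
    unfolding linext_def by (metis finite_keys)
  then show ?thesis by (simp add: linext_tens_eq)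
qed

lemma tclass_trep: "X \<in> qspace N \<Longrightarrow> tclass N (trep N X) = X"
  using ex_tclass unfolding trep_def qspace_def by (metis (mono_tags) image_iff someI_ex)

lemma tclass_in_qspace [simp]: "tclass N xs \<in> qspace N" "coset N u \<in> qspace N"
  by (simp_all add: tclass_def qspace_def)

lemma tsum_trep: "X \<in> qspace N \<Longrightarrow> balanced D r l f \<Longrightarrow> tsum f (trep N X) = slice f X"
  using slice_tclass[of f "trep N X"] tclass_trep[of X] by simp

lemma qspace_eqI:
  assumes "X \<in> qspace N" "Y \<in> qspace N"
    and "\<And>f :: 'm \<Rightarrow> 'n \<Rightarrow> complex. balanced D r l f \<Longrightarrow> slice f X = slice f Y"
  shows "X = Y"
proof -
  obtain u v where uv: "X = coset N u" "Y = coset N v" using assms(1,2) by (auto simp: qspace_def)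
  show ?thesis unfolding uv
    by (rule coset_eqI) (use assms(3) in \<open>simp add: uv slice_coset\<close>)
qed

lemma slice_qadd:
  assumes "balanced D r l f" "X \<in> qspace N" "Y \<in> qspace N"
  shows "slice f (qadd N X Y) = slice f X + slice f Y"
  unfolding qadd_def slice_coset[OF assms(1)] by (simp add: slice_def clinear_add[OF linext_clinear] case_prod_unfold)

lemma slice_qscale:
  assumes "balanced D r l f" "X \<in> qspace N"
  shows "slice f (qscale N c X) = c *\<^sub>C slice f X"
  unfolding qscale_def slice_coset[OF assms(1)] by (simp add: slice_def clinear_scale[OF linext_clinear] case_prod_unfold)

lemma qadd_in_qspace [simp]: "qadd N X Y \<in> qspace N" "qscale N c X \<in> qspace N" "qzero N \<in> qspace N"
  by (simp_all add: qadd_def qscale_def qzero_def)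

lemma slice_qzero:
  assumes "balanced D r l f" shows "slice f (qzero N) = 0"
  by (simp add: qzero_def slice_coset[OF assms] clinear_zero[OF linext_clinear])

end

section \<open>Self-dual axioms for regular multiplier Hopf algebroids\<close>

definition flipped :: "('a \<Rightarrow> 'b \<Rightarrow> ('m \<times> 'n) list) \<Rightarrow> 'a \<Rightarrow> 'b \<Rightarrow> ('n \<times> 'm) list"
  where "flipped D = (\<lambda>a b. map prod.swap (D a b))"

lemma tsum_flipped [simp]: "tsum f (flipped D a b) = tsum (\<lambda>p q. f q p) (D a b)"
  by (simp add: flipped_def)

lemma flipped_flipped [simp]: "flipped (flipped D) = D"
  by (simp add: flipped_def comp_def)

definition balanced3 where
  "balanced3 D r l E r' l' f \<longleftrightarrow> (\<forall>q. balanced D r l (\<lambda>u p. f u p q)) \<and> (\<forall>u. balanced E r' l' (f u))"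

lemma balanced_flip: "balanced D r l (\<lambda>a b. f b a) \<longleftrightarrow> balanced D l r f"
  by (auto simp: balanced_def bilin_def)

text \<open>The left-hand half of the structure of a regular multiplier Hopf algebroid.  The product of \<open>A\<close>,
  that of its multipliers and the two actions \<open>la m a = ma\<close>, \<open>ra m a = am\<close> are parameters, so that the
  opposite algebra is an instance over the same types.  The lists \<open>DC1 b a\<close>, \<open>DC2 b a\<close>, \<open>DB1 b a\<close>
  and \<open>DB2 b a\<close> represent \<open>\<Delta>\<^sub>C(b)(a \<otimes> 1)\<close>, \<open>\<Delta>\<^sub>C(b)(1 \<otimes> a)\<close>, \<open>(a \<otimes> 1)\<Delta>\<^sub>B(b)\<close> and \<open>(1 \<otimes> a)\<Delta>\<^sub>B(b)\<close>.
  Identities in tensor products are stated for all scalar balanced forms; by \<open>DC_nondegenerate1\<close> and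
  \<open>DC_nondegenerate2\<close> such an identity may be tested after multiplying one leg by arbitrary elements.\<close>

locale Hopf_half =
  fixes mul :: "'a::complex_space \<Rightarrow> 'a \<Rightarrow> 'a" (infixl \<open>\<odot>\<close> 70)
    and mulM :: "'d::complex_space \<Rightarrow> 'd \<Rightarrow> 'd" (infixl \<open>\<star>\<close> 70)
    and la ra :: "'d \<Rightarrow> 'a \<Rightarrow> 'a"
    and B C :: "'d set" and tB tC :: "'d \<Rightarrow> 'd"
    and DB1 DB2 DC1 DC2 :: "'a \<Rightarrow> 'a \<Rightarrow> ('a \<times> 'a) list"
    and epsC :: "'a \<Rightarrow> 'd" and S :: "'a \<Rightarrow> 'a"
  assumes bilin_mul: "bilin mul"
    and mul_assoc: "(a \<odot> b) \<odot> c = a \<odot> (b \<odot> c)"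
    and mul_nondegenerate: "(\<And>b. a \<odot> b = 0) \<Longrightarrow> a = 0"
    and bilin_la: "bilin la"
    and la_mulM: "la (m \<star> n) a = la m (la n a)"
    and la_mul: "la m (a \<odot> b) = la m a \<odot> b"
    and ra_mul_la: "ra m a \<odot> b = a \<odot> la m b"
    and la_ra: "la m (ra n a) = ra n (la m a)"
    and la_faithful: "(\<And>a. la m a = 0) \<Longrightarrow> m = 0"
    and mulM_assoc: "(m \<star> n) \<star> k = m \<star> (n \<star> k)"
    and C_subspace: "csubspace C"
    and C_mult: "y \<in> C \<Longrightarrow> y' \<in> C \<Longrightarrow> y \<star> y' \<in> C"
    and tC_in: "y \<in> C \<Longrightarrow> tC y \<in> B"
    and tC_linear: "clinear_on C tC"
    and tC_mult: "y \<in> C \<Longrightarrow> y' \<in> C \<Longrightarrow> tC (y \<star> y') = tC y' \<star> tC y"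
    and tC_bij: "bij_betw tC C B"
    and C_idempotent: "csubspace V \<Longrightarrow> (\<And>y a. y \<in> C \<Longrightarrow> la y a \<in> V) \<Longrightarrow> a \<in> V"
    and DC_rel: "balanced C (\<lambda>y. la (tC y)) la (f :: 'a \<Rightarrow> 'a \<Rightarrow> complex) \<Longrightarrow>
      tsum (\<lambda>p q. f p (q \<odot> b)) (DC1 d a) = tsum (\<lambda>p q. f (p \<odot> a) q) (DC2 d b)"
    and DC_nondegenerate1: "(\<And>(f :: 'a \<Rightarrow> 'a \<Rightarrow> complex) c. balanced C (\<lambda>y. la (tC y)) la f \<Longrightarrow>
        tsum (\<lambda>p q. f p (q \<odot> c)) xs = tsum (\<lambda>p q. f p (q \<odot> c)) ys) \<Longrightarrow>
      balanced C (\<lambda>y. la (tC y)) la (f :: 'a \<Rightarrow> 'a \<Rightarrow> complex) \<Longrightarrow> tsum f xs = tsum f ys"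
    and DC_nondegenerate2: "(\<And>(f :: 'a \<Rightarrow> 'a \<Rightarrow> complex) c. balanced C (\<lambda>y. la (tC y)) la f \<Longrightarrow>
        tsum (\<lambda>p q. f (p \<odot> c) q) xs = tsum (\<lambda>p q. f (p \<odot> c) q) ys) \<Longrightarrow>
      balanced C (\<lambda>y. la (tC y)) la (f :: 'a \<Rightarrow> 'a \<Rightarrow> complex) \<Longrightarrow> tsum f xs = tsum f ys"
    and DC1_bilin: "balanced C (\<lambda>y. la (tC y)) la (f :: 'a \<Rightarrow> 'a \<Rightarrow> complex) \<Longrightarrow>
      bilin (\<lambda>x a. tsum f (DC1 x a))"
    and DC2_bilin: "balanced C (\<lambda>y. la (tC y)) la (f :: 'a \<Rightarrow> 'a \<Rightarrow> complex) \<Longrightarrow>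
      bilin (\<lambda>x a. tsum f (DC2 x a))"
    and DC1_mult: "balanced C (\<lambda>y. la (tC y)) la (f :: 'a \<Rightarrow> 'a \<Rightarrow> complex) \<Longrightarrow>
      tsum f (DC1 (a \<odot> b) c) = tsum (\<lambda>p q. tsum (\<lambda>r s. f r (s \<odot> q)) (DC1 a p)) (DC1 b c)"
    and DC1_ra: "balanced C (\<lambda>y. la (tC y)) la (f :: 'a \<Rightarrow> 'a \<Rightarrow> complex) \<Longrightarrow> x \<in> B \<Longrightarrow>
      tsum f (DC1 (ra x a) b) = tsum (\<lambda>p q. f p (ra x q)) (DC1 a b)"
    and DC2_ra: "balanced C (\<lambda>y. la (tC y)) la (f :: 'a \<Rightarrow> 'a \<Rightarrow> complex) \<Longrightarrow> y \<in> C \<Longrightarrow>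
      tsum f (DC2 (ra y a) b) = tsum (\<lambda>p q. f (ra y p) q) (DC2 a b)"
    and DC1_la: "balanced C (\<lambda>y. la (tC y)) la (f :: 'a \<Rightarrow> 'a \<Rightarrow> complex) \<Longrightarrow> y \<in> C \<Longrightarrow>
      tsum f (DC1 d (la (tC y) a)) = tsum (\<lambda>p q. f p (ra y q)) (DC1 d a)"
    and DC2_la: "balanced C (\<lambda>y. la (tC y)) la (f :: 'a \<Rightarrow> 'a \<Rightarrow> complex) \<Longrightarrow> y \<in> C \<Longrightarrow>
      tsum f (DC2 d (la y b)) = tsum (\<lambda>p q. f (ra (tC y) p) q) (DC2 d b)"
    and coassoc_BC: "balanced3 B ra (\<lambda>x. ra (tB x)) C (\<lambda>y. la (tC y)) la (g :: 'a \<Rightarrow> 'a \<Rightarrow> 'a \<Rightarrow> complex) \<Longrightarrow>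
      tsum (\<lambda>d q. tsum (\<lambda>u v. g u v q) (DB1 d a)) (DC2 b c) =
      tsum (\<lambda>u d. tsum (\<lambda>p q. g u p q) (DC2 d c)) (DB1 b a)"
    and coassoc_CB: "balanced3 C (\<lambda>y. la (tC y)) la B ra (\<lambda>x. ra (tB x)) (g :: 'a \<Rightarrow> 'a \<Rightarrow> 'a \<Rightarrow> complex) \<Longrightarrow>
      tsum (\<lambda>d r. tsum (\<lambda>p q. g p q r) (DC1 d a)) (DB2 b c) =
      tsum (\<lambda>p d. tsum (\<lambda>q r. g p q r) (DB2 d c)) (DC1 b a)"
    and epsC_linear: "clinear epsC"
    and epsC_in: "epsC a \<in> C"
    and epsC_la: "y \<in> C \<Longrightarrow> epsC (la y a) = y \<star> epsC a"
    and epsC_tC: "y \<in> C \<Longrightarrow> epsC (la (tC y) a) = epsC a \<star> y"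
    and counit_DC2: "tsum (\<lambda>p q. la (epsC p) q) (DC2 a b) = a \<odot> b"
    and counit_DC1: "tsum (\<lambda>p q. la (tC (epsC q)) p) (DC1 a b) = a \<odot> b"
    and S_linear: "clinear S" and S_bij: "bij S"
    and S_mult: "S (a \<odot> b) = S b \<odot> S a"
    and S_la: "y \<in> C \<Longrightarrow> S (la (tC y) a) = ra y (S a)"
    and S_ra: "y \<in> C \<Longrightarrow> S (ra (tC y) a) = la y (S a)"
    and antipode_DB1: "tsum (\<lambda>p q. p \<odot> S q) (DB1 b a) = ra (epsC b) a"

text \<open>The other half consists of the same axioms for the opposite algebra with flipped legs.  There
  \<open>\<Delta>\<^sub>C(b)(a \<otimes> 1)\<close> and \<open>(1 \<otimes> a)\<Delta>\<^sub>B(b)\<close> change places, as do \<open>\<Delta>\<^sub>C(b)(1 \<otimes> a)\<close> and \<open>(a \<otimes> 1)\<Delta>\<^sub>B(b)\<close>.\<close>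

locale Hopf =
  Hopf_half mul mulM la ra B C tB tC DB1 DB2 DC1 DC2 epsC S +
  mirror: Hopf_half "\<lambda>a b. mul b a" "\<lambda>m n. mulM n m" ra la C B tC tB
    "flipped DC2" "flipped DC1" "flipped DB2" "flipped DB1" epsB S
  for mul :: "'a::complex_space \<Rightarrow> 'a \<Rightarrow> 'a" (infixl \<open>\<odot>\<close> 70)
    and mulM :: "'d::complex_space \<Rightarrow> 'd \<Rightarrow> 'd" (infixl \<open>\<star>\<close> 70)
    and la ra :: "'d \<Rightarrow> 'a \<Rightarrow> 'a"
    and B C :: "'d set" and tB tC :: "'d \<Rightarrow> 'd"
    and DB1 DB2 DC1 DC2 :: "'a \<Rightarrow> 'a \<Rightarrow> ('a \<times> 'a) list"
    and epsB epsC :: "'a \<Rightarrow> 'd" and S :: "'a \<Rightarrow> 'a"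

context Hopf
begin

abbreviation balC :: "('a \<Rightarrow> 'a \<Rightarrow> complex) \<Rightarrow> bool"
  where "balC \<equiv> balanced C (\<lambda>y. la (tC y)) la"

abbreviation balB :: "('a \<Rightarrow> 'a \<Rightarrow> complex) \<Rightarrow> bool"
  where "balB \<equiv> balanced B ra (\<lambda>x. ra (tB x))"

lemma balB_flip: "balB f \<Longrightarrow> balanced B (\<lambda>x. ra (tB x)) ra (\<lambda>a b. f b a)"
  using balanced_flip[of B "\<lambda>x. ra (tB x)" ra f] by blast

lemmas tC_add = tC_linear[unfolded clinear_on_def, THEN conjunct1, rule_format]
  and tC_scale = tC_linear[unfolded clinear_on_def, THEN conjunct2, rule_format]
  and tB_add = mirror.tC_linear[unfolded clinear_on_def, THEN conjunct1, rule_format]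
  and tB_scale = mirror.tC_linear[unfolded clinear_on_def, THEN conjunct2, rule_format]

lemmas lin = bilin_mul[unfolded bilin_def, THEN conjunct1, rule_format]
  bilin_mul[unfolded bilin_def, THEN conjunct2, THEN conjunct1, rule_format]
  bilin_mul[unfolded bilin_def, THEN conjunct2, THEN conjunct2, THEN conjunct1, rule_format]
  bilin_mul[unfolded bilin_def, THEN conjunct2, THEN conjunct2, THEN conjunct2, rule_format]
  bilin_la[unfolded bilin_def, THEN conjunct1, rule_format]
  bilin_la[unfolded bilin_def, THEN conjunct2, THEN conjunct1, rule_format]
  bilin_la[unfolded bilin_def, THEN conjunct2, THEN conjunct2, THEN conjunct1, rule_format]
  bilin_la[unfolded bilin_def, THEN conjunct2, THEN conjunct2, THEN conjunct2, rule_format]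
  mirror.bilin_la[unfolded bilin_def, THEN conjunct1, rule_format]
  mirror.bilin_la[unfolded bilin_def, THEN conjunct2, THEN conjunct1, rule_format]
  mirror.bilin_la[unfolded bilin_def, THEN conjunct2, THEN conjunct2, THEN conjunct1, rule_format]
  mirror.bilin_la[unfolded bilin_def, THEN conjunct2, THEN conjunct2, THEN conjunct2, rule_format]
  clinear_add[OF S_linear] clinear_scale[OF S_linear]
  clinear_add[OF epsC_linear] clinear_scale[OF epsC_linear]
  clinear_add[OF mirror.epsC_linear] clinear_scale[OF mirror.epsC_linear]
  tC_add tC_scale tB_add tB_scale

lemma clinear_mul_left: "clinear (\<lambda>a. a \<odot> b)" and clinear_mul_right: "clinear (\<lambda>a. b \<odot> a)"
  and clinear_la: "clinear (la m)" and clinear_ra: "clinear (ra m)"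
  by (simp_all add: clinear_iff lin)

lemmas base_in [simp] = C_mult tC_in mirror.C_mult mirror.tC_in epsC_in mirror.epsC_in
  complex_space.subspace_add[OF C_subspace] complex_space.subspace_add[OF mirror.C_subspace]
  complex_space.subspace_scale[OF C_subspace] complex_space.subspace_scale[OF mirror.C_subspace]

lemma mul_cancel_right: "(\<And>c. a \<odot> c = b \<odot> c) \<Longrightarrow> a = b"
  using mul_nondegenerate[of "a - b"] by (simp add: clinear_diff[OF clinear_mul_left])

lemma mul_cancel_left: "(\<And>c. c \<odot> a = c \<odot> b) \<Longrightarrow> a = b"
  using mirror.mul_nondegenerate[of "a - b"] by (simp add: clinear_diff[OF clinear_mul_right])

definition Si :: "'a \<Rightarrow> 'a" where "Si = inv S"

lemma S_Si [simp]: "S (Si a) = a" and Si_S [simp]: "Si (S a) = a"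
  using S_bij by (simp_all add: Si_def bij_is_surj surj_f_inv_f bij_is_inj)

lemma S_inj: "S a = S b \<longleftrightarrow> a = b"
  using Si_S by metis

lemma Si_linear: "clinear Si"
  unfolding clinear_iff by (metis S_Si S_inj lin(13) lin(14))

lemma Si_mult: "Si (a \<odot> b) = Si b \<odot> Si a"
  by (metis S_Si S_inj S_mult)

lemma Si_ra_C: "y \<in> C \<Longrightarrow> Si (ra y a) = la (tC y) (Si a)"
  and Si_la_C: "y \<in> C \<Longrightarrow> Si (la y a) = ra (tC y) (Si a)"
  and Si_la_B: "x \<in> B \<Longrightarrow> Si (la x a) = ra (tB x) (Si a)"
  and Si_ra_B: "x \<in> B \<Longrightarrow> Si (ra x a) = la (tB x) (Si a)"
  using S_la[of y "Si a"] S_ra[of y "Si a"] mirror.S_la[of x "Si a"] mirror.S_ra[of x "Si a"]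
  by (metis S_Si Si_S)+

definition tCi :: "'d \<Rightarrow> 'd" where "tCi = inv_into C tC"
definition tBi :: "'d \<Rightarrow> 'd" where "tBi = inv_into B tB"

lemma tBi_in [simp]: "y \<in> C \<Longrightarrow> tBi y \<in> B"
  and tB_tBi [simp]: "y \<in> C \<Longrightarrow> tB (tBi y) = y"
  and tBi_tB [simp]: "x \<in> B \<Longrightarrow> tBi (tB x) = x"
  using mirror.tC_bij unfolding tBi_def
  by (auto simp: bij_betw_def inv_into_into f_inv_into_f inv_into_f_f)

lemma tCi_in [simp]: "x \<in> B \<Longrightarrow> tCi x \<in> C"
  and tC_tCi [simp]: "x \<in> B \<Longrightarrow> tC (tCi x) = x"
  and tCi_tC [simp]: "y \<in> C \<Longrightarrow> tCi (tC y) = y"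
  using tC_bij unfolding tCi_def
  by (auto simp: bij_betw_def inv_into_into f_inv_into_f inv_into_f_f)

lemma tBi_add: "y \<in> C \<Longrightarrow> y' \<in> C \<Longrightarrow> tBi (y + y') = tBi y + tBi y'"
  and tBi_scale: "y \<in> C \<Longrightarrow> tBi (c *\<^sub>C y) = c *\<^sub>C tBi y"
  and tBi_mult: "y \<in> C \<Longrightarrow> y' \<in> C \<Longrightarrow> tBi (y \<star> y') = tBi y' \<star> tBi y"
  using tBi_tB[of "tBi y + tBi y'"] tBi_tB[of "c *\<^sub>C tBi y"] tBi_tB[of "tBi y' \<star> tBi y"]
  by (simp_all add: lin mirror.tC_mult)

lemma tCi_add: "x \<in> B \<Longrightarrow> x' \<in> B \<Longrightarrow> tCi (x + x') = tCi x + tCi x'"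
  and tCi_scale: "x \<in> B \<Longrightarrow> tCi (c *\<^sub>C x) = c *\<^sub>C tCi x"
  and tCi_mult: "x \<in> B \<Longrightarrow> x' \<in> B \<Longrightarrow> tCi (x \<star> x') = tCi x' \<star> tCi x"
  using tCi_tC[of "tCi x + tCi x'"] tCi_tC[of "c *\<^sub>C tCi x"] tCi_tC[of "tCi x' \<star> tCi x"]
  by (simp_all add: lin tC_mult)

lemmas lin_inv = lin clinear_add[OF Si_linear] clinear_scale[OF Si_linear] tBi_add tBi_scale tCi_add tCi_scale

lemma ra_mulM: "ra (m \<star> n) a = ra n (ra m a)"
  by (rule mirror.la_mulM)

lemma ra_mul: "ra m (a \<odot> b) = a \<odot> ra m b"
  by (rule mirror.la_mul)

lemma DB_rel: "balB f \<Longrightarrow> tsum (\<lambda>p q. f p (a \<odot> q)) (DB1 x b) = tsum (\<lambda>p q. f (b \<odot> p) q) (DB2 x a)"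
  using mirror.DC_rel[OF balB_flip[of f], of b x a] by simp

lemma DB1_la: "balB f \<Longrightarrow> x \<in> B \<Longrightarrow> tsum f (DB1 (la x a) b) = tsum (\<lambda>p q. f p (la x q)) (DB1 a b)"
  using mirror.DC2_ra[OF balB_flip[of f]] by simp

lemma DB2_la: "balB f \<Longrightarrow> y \<in> C \<Longrightarrow> tsum f (DB2 (la y a) b) = tsum (\<lambda>p q. f (la y p) q) (DB2 a b)"
  using mirror.DC1_ra[OF balB_flip[of f]] by simp

lemma counit_DB1: "tsum (\<lambda>p q. ra (epsB q) p) (DB1 a b) = b \<odot> a"
  using mirror.counit_DC2 by simp

lemma counit_DB2: "tsum (\<lambda>p q. ra (tB (epsB p)) q) (DB2 a b) = b \<odot> a"
  using mirror.counit_DC1 by simp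

section \<open>Canonical maps and the counit\<close>

text \<open>The map \<open>b \<otimes> a \<mapsto> \<Delta>\<^sub>C(b)(a \<otimes> 1)\<close> has the inverse suggested by Hopf algebras,
  \<open>a \<otimes> b \<mapsto> b\<^sub>2 \<otimes> S\<^sup>-\<^sup>1(b\<^sub>1)a\<close> with \<open>b\<^sub>1 \<otimes> b\<^sub>2\<close> taken from \<open>\<Delta>\<^sub>B\<close>.  Multiplying the second leg by \<open>c\<close>, mixed
  coassociativity moves \<open>\<Delta>\<^sub>B\<close> to the first leg of \<open>\<Delta>\<^sub>C(b)(1 \<otimes> c)\<close>, where the antipode axiom applies.\<close>

lemma canonical_inverse_first:
  assumes f: "balC f"
  shows "tsum (\<lambda>u v. tsum f (DC1 v (Si u))) (DB1 b e) = f (Si e) b"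
proof -
  let ?xs = "concat (map (\<lambda>(u, v). DC1 v (Si u)) (DB1 b e))"
  have "tsum f ?xs = tsum f [(Si e, b)]"
  proof (rule DC_nondegenerate1[OF _ f])
    fix f :: "'a \<Rightarrow> 'a \<Rightarrow> complex" and c
    assume f: "balC f"
    note f' = balancedD[OF f]
    have "tsum (\<lambda>p q. f p (q \<odot> c)) ?xs = tsum (\<lambda>u v. tsum (\<lambda>p q. f (p \<odot> Si u) q) (DC2 v c)) (DB1 b e)"
      by (simp add: tsum_concat DC_rel[OF f])
    also have "\<dots> = tsum (\<lambda>d q. tsum (\<lambda>u v. f (v \<odot> Si u) q) (DB1 d e)) (DC2 b c)"
      by (rule coassoc_BC[symmetric])
        (auto simp: balanced3_def balanced_def bilin_def lin_inv f' Si_ra_B ra_mul_la la_mul[symmetric])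
    also have "(\<lambda>d q. tsum (\<lambda>u v. f (v \<odot> Si u) q) (DB1 d e)) = (\<lambda>d q. f (Si e) (la (epsC d) q))"
    proof (intro ext)
      fix d q
      have "tsum (\<lambda>u v. f (v \<odot> Si u) q) (DB1 d e) = tsum (\<lambda>u v. f (Si (u \<odot> S v)) q) (DB1 d e)"
        by (simp add: Si_mult)
      also have "\<dots> = f (Si (tsum (\<lambda>u v. u \<odot> S v) (DB1 d e))) q"
        by (rule clinear_tsum[symmetric]) (simp add: clinear_iff lin_inv f')
      also have "\<dots> = f (Si e) (la (epsC d) q)"
        by (simp add: antipode_DB1 Si_ra_C f')
      finally show "tsum (\<lambda>u v. f (v \<odot> Si u) q) (DB1 d e) = f (Si e) (la (epsC d) q)" .
    qed
    also have "tsum (\<lambda>d q. f (Si e) (la (epsC d) q)) (DC2 b c) = f (Si e) (b \<odot> c)"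
      unfolding counit_DC2[symmetric]
      by (rule clinear_tsum[symmetric]) (simp add: clinear_iff f')
    finally show "tsum (\<lambda>p q. f p (q \<odot> c)) ?xs = tsum (\<lambda>p q. f p (q \<odot> c)) [(Si e, b)]"
      by simp
  qed
  then show ?thesis by (simp add: tsum_concat)
qed

text \<open>In Hopf algebra notation \<open>\<Sum> \<Delta>(b\<^sub>1)(1 \<otimes> S(c b\<^sub>2)) = b \<otimes> S(c)\<close>: the corresponding statement for
  \<open>b \<otimes> a \<mapsto> \<Delta>\<^sub>C(b)(1 \<otimes> a)\<close>.\<close>

lemma canonical_inverse_second:
  assumes f: "balC f"
  shows "tsum (\<lambda>u v. tsum f (DC2 u (S v))) (DB2 b c) = f b (S c)"
proof -
  let ?xs = "concat (map (\<lambda>(u, v). DC2 u (S v)) (DB2 b c))"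
  have "tsum f ?xs = tsum f [(b, S c)]"
  proof (rule DC_nondegenerate2[OF _ f])
    fix f :: "'a \<Rightarrow> 'a \<Rightarrow> complex" and a
    assume f: "balC f"
    note f' = balancedD[OF f]
    have "tsum (\<lambda>p q. f (p \<odot> a) q) ?xs = tsum (\<lambda>u v. tsum (\<lambda>p q. f p (q \<odot> S v)) (DC1 u a)) (DB2 b c)"
      by (simp add: tsum_concat DC_rel[OF f])
    also have "\<dots> = tsum (\<lambda>p d. tsum (\<lambda>q r. f p (q \<odot> S r)) (DB2 d c)) (DC1 b a)"
      by (rule coassoc_CB)
        (auto simp: balanced3_def balanced_def bilin_def lin_inv f' mirror.S_ra mirror.S_la ra_mul_la la_mul[symmetric])
    also have "(\<lambda>p d. tsum (\<lambda>q r. f p (q \<odot> S r)) (DB2 d c)) = (\<lambda>p d. f (la (tC (epsC d)) p) (S c))"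
    proof (intro ext)
      fix p d
      have "tsum (\<lambda>q r. q \<odot> S r) (DB2 d c) = la (epsC d) (S c)"
      proof (rule mul_cancel_left)
        fix e
        have "g (e \<odot> tsum (\<lambda>q r. q \<odot> S r) (DB2 d c)) = g (e \<odot> la (epsC d) (S c))"
          if g: "clinear g" for g :: "'a \<Rightarrow> complex"
        proof -
          note g' = clinear_add[OF g] clinear_scale[OF g]
          have "g (e \<odot> tsum (\<lambda>q r. q \<odot> S r) (DB2 d c)) = tsum (\<lambda>q r. g ((e \<odot> q) \<odot> S r)) (DB2 d c)"
            by (subst clinear_tsum) (simp_all add: clinear_iff g' lin mul_assoc clinear_tsum[of "\<lambda>x. g (e \<odot> x)"])
          also have "\<dots> = tsum (\<lambda>q r. g (q \<odot> S (c \<odot> r))) (DB1 d e)"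
            by (rule DB_rel[symmetric]) (auto simp: balanced_def bilin_def lin_inv g' mirror.S_ra mirror.S_la ra_mul_la)
          also have "\<dots> = g (tsum (\<lambda>q r. q \<odot> S r) (DB1 d e) \<odot> S c)"
            by (subst clinear_tsum[of "\<lambda>x. g (x \<odot> S c)"]) (simp_all add: clinear_iff g' lin mul_assoc S_mult)
          also have "\<dots> = g (e \<odot> la (epsC d) (S c))"
            by (simp add: antipode_DB1 ra_mul_la)
          finally show ?thesis .
        qed
        then show "e \<odot> tsum (\<lambda>q r. q \<odot> S r) (DB2 d c) = e \<odot> la (epsC d) (S c)"
          by (rule separating_functional_eq)
      qed
      moreover have "tsum (\<lambda>q r. f p (q \<odot> S r)) (DB2 d c) = f p (tsum (\<lambda>q r. q \<odot> S r) (DB2 d c))"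
        by (rule clinear_tsum[symmetric]) (simp add: clinear_iff f')
      ultimately show "tsum (\<lambda>q r. f p (q \<odot> S r)) (DB2 d c) = f (la (tC (epsC d)) p) (S c)"
        by (simp add: f')
    qed
    also have "tsum (\<lambda>p d. f (la (tC (epsC d)) p) (S c)) (DC1 b a) = f (b \<odot> a) (S c)"
      unfolding counit_DC1[symmetric]
      by (rule clinear_tsum[symmetric]) (simp add: clinear_iff f')
    finally show "tsum (\<lambda>p q. f (p \<odot> a) q) ?xs = tsum (\<lambda>p q. f (p \<odot> a) q) [(b, S c)]"
      by simp
  qed
  then show ?thesis by (simp add: tsum_concat)
qed

text \<open>The elements \<open>\<Delta>\<^sub>C(v)(a \<otimes> 1)\<close> span the balanced tensor product, by \<open>canonical_inverse_first\<close>.\<close>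

lemma balanced_forms_eqI:
  assumes f: "balC f" and g: "balC g"
    and eq: "\<And>v a. tsum f (DC1 v a) = tsum g (DC1 v a)"
  shows "f = g"
proof (intro ext)
  fix a b
  show "f a b = g a b"
    using canonical_inverse_first[OF f, of b "S a"] canonical_inverse_first[OF g, of b "S a"] eq by simp
qed

lemma tC_inj: "y \<in> C \<Longrightarrow> y' \<in> C \<Longrightarrow> tC y = tC y' \<Longrightarrow> y = y'"
  by (metis tCi_tC)

lemma la_eqI: "(\<And>a. la m a = la n a) \<Longrightarrow> m = n"
  using la_faithful[of "m - n"] clinear_diff[of "\<lambda>m. la m _"] by (simp add: clinear_iff lin)

text \<open>Slicing \<open>\<Delta>\<^sub>C(ab)(c \<otimes> 1) = \<Delta>\<^sub>C(a)\<Delta>\<^sub>C(b)(c \<otimes> 1)\<close> by \<open>\<iota> \<otimes> \<epsilon>\<^sub>C\<close>, and replacing \<open>\<Delta>\<^sub>C(b)(c \<otimes> 1)\<close> by an arbitrary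
  tensor \<open>p \<otimes> q\<close>, shows that right multiplication of the second leg of \<open>\<Delta>\<^sub>C(a)(p \<otimes> 1)\<close> by \<open>q\<close> or by \<open>\<epsilon>\<^sub>C(q)\<close>
  gives the same slice.  As \<open>\<Delta>\<^sub>C(a)(p \<otimes> 1)\<close> is again an arbitrary tensor, the claim follows.\<close>

lemma epsC_mult: "epsC (s \<odot> q) = epsC (ra (epsC q) s)"
proof (rule tC_inj)
  show "tC (epsC (s \<odot> q)) = tC (epsC (ra (epsC q) s))"
  proof (rule la_eqI, rule separating_functional_eq)
    fix r and g :: "'a \<Rightarrow> complex"
    assume g: "clinear g"
    note g' = clinear_add[OF g] clinear_scale[OF g]
    define f where "f r s = g (la (tC (epsC s)) r)" for r s
    have f: "balC f"
      by (auto simp: balanced_def bilin_def lin_inv g' f_def epsC_la tC_mult la_mulM)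
    have f1: "balC (\<lambda>r s. f r (s \<odot> q))" for q
      using balancedD[OF f] by (auto simp: balanced_def bilin_def lin_inv la_mul)
    have f2: "balC (\<lambda>r s. f r (ra y s))" for y
      using balancedD[OF f] by (auto simp: balanced_def bilin_def lin_inv la_ra[symmetric])
    have key: "tsum (\<lambda>r s. f r (s \<odot> q)) (DC1 a p) = g (a \<odot> la (tC (epsC q)) p)" for a p q
    proof -
      have "(\<lambda>p q. tsum (\<lambda>r s. f r (s \<odot> q)) (DC1 a p)) = (\<lambda>p q. g (a \<odot> la (tC (epsC q)) p))"
      proof (rule balanced_forms_eqI)
        have "tsum (\<lambda>r s. f r (s \<odot> q)) (DC1 a (la (tC y) p)) = tsum (\<lambda>r s. f r (s \<odot> la y q)) (DC1 a p)"
          if "y \<in> C" for y p q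
          by (simp add: DC1_la[OF f1 that] ra_mul_la)
        moreover have "tsum (\<lambda>r s. f r (s \<odot> (q + q'))) xs = tsum (\<lambda>r s. f r (s \<odot> q)) xs + tsum (\<lambda>r s. f r (s \<odot> q')) xs"
          for q q' xs by (simp add: lin balancedD[OF f] tsum_add)
        moreover have "tsum (\<lambda>r s. f r (s \<odot> c *\<^sub>C q)) xs = c *\<^sub>C tsum (\<lambda>r s. f r (s \<odot> q)) xs"
          for c q xs by (simp add: lin balancedD[OF f] tsum_scale)
        ultimately show "balC (\<lambda>p q. tsum (\<lambda>r s. f r (s \<odot> q)) (DC1 a p))"
          using DC1_bilin[OF f1] by (simp add: balanced_def bilin_def)
        show "balC (\<lambda>p q. g (a \<odot> la (tC (epsC q)) p))"
          by (auto simp: balanced_def bilin_def lin_inv g' epsC_la tC_mult la_mulM)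
        fix b c
        have lhs: "tsum (\<lambda>p q. tsum (\<lambda>r s. f r (s \<odot> q)) (DC1 a p)) (DC1 b c) = tsum f (DC1 (a \<odot> b) c)"
          by (rule DC1_mult[OF f, symmetric])
        also have "\<dots> = g (a \<odot> (b \<odot> c))"
          unfolding f_def clinear_tsum[OF g, symmetric] counit_DC1 mul_assoc ..
        also have "\<dots> = tsum (\<lambda>p q. g (a \<odot> la (tC (epsC q)) p)) (DC1 b c)"
          using clinear_tsum[of "\<lambda>x. g (a \<odot> x)" "\<lambda>p q. la (tC (epsC q)) p" "DC1 b c"]
          by (simp add: clinear_iff lin g' counit_DC1)
        finally show "tsum (\<lambda>p q. tsum (\<lambda>r s. f r (s \<odot> q)) (DC1 a p)) (DC1 b c) =
            tsum (\<lambda>p q. g (a \<odot> la (tC (epsC q)) p)) (DC1 b c)" .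
      qed
      then show ?thesis by metis
    qed
    have "(\<lambda>r s. f r (s \<odot> q)) = (\<lambda>r s. f r (ra (epsC q) s))"
    proof (rule balanced_forms_eqI[OF f1 f2])
      fix a p
      have "tsum (\<lambda>r s. f r (s \<odot> q)) (DC1 a p) = tsum f (DC1 a (la (tC (epsC q)) p))"
        unfolding key unfolding f_def clinear_tsum[OF g, symmetric] counit_DC1 ..
      also have "\<dots> = tsum (\<lambda>r s. f r (ra (epsC q) s)) (DC1 a p)"
        by (rule DC1_la[OF f]) simp
      finally show "tsum (\<lambda>r s. f r (s \<odot> q)) (DC1 a p) = tsum (\<lambda>r s. f r (ra (epsC q) s)) (DC1 a p)" .
    qed
    then have "f r (s \<odot> q) = f r (ra (epsC q) s)" by metis
    then show "g (la (tC (epsC (s \<odot> q))) r) = g (la (tC (epsC (ra (epsC q) s))) r)"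
      by (simp add: f_def)
  qed
qed simp_all

text \<open>Right invariance with respect to \<open>\<Delta>\<^sub>C\<close> implies right invariance with respect to \<open>\<Delta>\<^sub>B\<close>: apply the slice
  map of the integral to \<open>canonical_inverse_second\<close>, and cancel \<open>S\<close>.\<close>

lemma right_integral_DB2:
  assumes \<Psi>: "clinear \<Psi>" "\<And>a. \<Psi> a \<in> B" "\<And>x a. x \<in> B \<Longrightarrow> \<Psi> (la x a) = x \<star> \<Psi> a"
    and int: "\<And>a b. tsum (\<lambda>p q. la (tCi (\<Psi> p)) q) (DC2 a b) = la (\<Psi> a) b"
  shows "tsum (\<lambda>p q. ra (tB (\<Psi> p)) q) (DB2 a b) = ra (\<Psi> a) b"
proof -
  note \<Psi>' = clinear_add[OF \<Psi>(1)] clinear_scale[OF \<Psi>(1)] \<Psi>(2,3)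
  have "g (tsum (\<lambda>p q. ra (tB (\<Psi> p)) q) (DB2 a b)) = g (ra (\<Psi> a) b)"
    if g: "clinear g" for g :: "'a \<Rightarrow> complex"
  proof -
    note g' = clinear_add[OF g] clinear_scale[OF g]
    let ?f = "\<lambda>p q. g (Si (la (tCi (\<Psi> p)) q))"
    have f: "balC ?f"
      by (auto simp: balanced_def bilin_def lin_inv g' \<Psi>' tCi_mult la_mulM)
    have gSi: "clinear (\<lambda>x. g (Si x))" by (simp add: clinear_iff lin_inv g')
    have "g (tsum (\<lambda>u v. ra (tB (\<Psi> u)) v) (DB2 a b)) = tsum (\<lambda>u v. g (Si (la (\<Psi> u) (S v)))) (DB2 a b)"
      unfolding clinear_tsum[OF g] by (simp add: mirror.S_la[symmetric] \<Psi>')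
    also have "\<dots> = tsum (\<lambda>u v. tsum ?f (DC2 u (S v))) (DB2 a b)"
      unfolding clinear_tsum[OF gSi, symmetric] int ..
    also have "\<dots> = g (Si (la (tCi (\<Psi> a)) (S b)))"
      by (rule canonical_inverse_second[OF f])
    also have "\<dots> = g (ra (\<Psi> a) b)"
      by (simp add: S_ra[symmetric] \<Psi>')
    finally show ?thesis .
  qed
  then show ?thesis by (rule separating_functional_eq)
qed

end

section \<open>Integrals and strong invariance\<close>

text \<open>The assumptions \<open>psi_factor\<close> and \<open>phi_factor\<close> are the quasi-invariance conditions on this
  side: \<open>\<psi>\<close> factors through a right \<open>C\<close>-linear map onto \<open>C\<close>, and \<open>\<phi>\<close> through a right \<open>B\<close>-linear map into \<open>B\<close>.\<close>

locale measured_half =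
  Hopf_half mul mulM la ra B C tB tC DB1 DB2 DC1 DC2 epsC S
  for mul :: "'a::complex_space \<Rightarrow> 'a \<Rightarrow> 'a" (infixl \<open>\<odot>\<close> 70)
    and mulM :: "'d::complex_space \<Rightarrow> 'd \<Rightarrow> 'd" (infixl \<open>\<star>\<close> 70)
    and la ra :: "'d \<Rightarrow> 'a \<Rightarrow> 'a"
    and B C :: "'d set" and tB tC :: "'d \<Rightarrow> 'd"
    and DB1 DB2 DC1 DC2 :: "'a \<Rightarrow> 'a \<Rightarrow> ('a \<times> 'a) list"
    and epsC :: "'a \<Rightarrow> 'd" and S :: "'a \<Rightarrow> 'a" +
  fixes epsB :: "'a \<Rightarrow> 'd" and \<mu>B \<mu>C :: "'d \<Rightarrow> complex" and \<Psi> \<Phi> :: "'a \<Rightarrow> 'd"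
  assumes mu_tB: "z \<in> B \<Longrightarrow> \<mu>C (tB z) = \<mu>B z"
    and mu_eps: "\<mu>B (epsB a) = \<mu>C (epsC a)"
    and muC_linear: "clinear_on C \<mu>C"
    and muC_faithful: "y \<in> C \<Longrightarrow> y' \<in> C \<Longrightarrow> (\<And>y''. y'' \<in> C \<Longrightarrow> \<mu>C (y'' \<star> y) = \<mu>C (y'' \<star> y')) \<Longrightarrow> y = y'"
    and Phi_linear: "clinear \<Phi>"
    and Phi_in: "\<Phi> a \<in> C"
    and Phi_la: "y \<in> C \<Longrightarrow> \<Phi> (la y a) = y \<star> \<Phi> a"
    and Phi_ra: "y \<in> C \<Longrightarrow> \<Phi> (ra y a) = \<Phi> a \<star> y"
    and left_integral_DC1: "tsum (\<lambda>p q. la (tC (\<Phi> q)) p) (DC1 b a) = la (\<Phi> b) a"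
    and phi_faithful: "(\<And>x. \<mu>C (\<Phi> (x \<odot> a)) = 0) \<Longrightarrow> a = 0"
      "(\<And>x. \<mu>C (\<Phi> (a \<odot> x)) = 0) \<Longrightarrow> a = 0"
    and psi_factor: "\<exists>g. clinear g \<and> range g = C \<and> (\<forall>y\<in>C. \<forall>a. g (ra y a) = g a \<star> y) \<and> (\<forall>a. \<mu>C (g a) = \<mu>B (\<Psi> a))"
    and phi_factor: "\<exists>g. clinear g \<and> range g \<subseteq> B \<and> (\<forall>x\<in>B. \<forall>a. g (ra x a) = g a \<star> x) \<and> (\<forall>a. \<mu>B (g a) = \<mu>C (\<Phi> a))"

locale measured_Hopf =
  measured_half mul mulM la ra B C tB tC DB1 DB2 DC1 DC2 epsC S epsB \<mu>B \<mu>C \<Psi> \<Phi> +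
  mirror: measured_half "\<lambda>a b. mul b a" "\<lambda>m n. mulM n m" ra la C B tC tB
    "flipped DC2" "flipped DC1" "flipped DB2" "flipped DB1" epsB S epsC \<mu>C \<mu>B \<Phi> \<Psi>
  for mul :: "'a::complex_space \<Rightarrow> 'a \<Rightarrow> 'a" (infixl \<open>\<odot>\<close> 70)
    and mulM :: "'d::complex_space \<Rightarrow> 'd \<Rightarrow> 'd" (infixl \<open>\<star>\<close> 70)
    and la ra :: "'d \<Rightarrow> 'a \<Rightarrow> 'a"
    and B C :: "'d set" and tB tC :: "'d \<Rightarrow> 'd"
    and DB1 DB2 DC1 DC2 :: "'a \<Rightarrow> 'a \<Rightarrow> ('a \<times> 'a) list"
    and epsB epsC :: "'a \<Rightarrow> 'd" and S :: "'a \<Rightarrow> 'a"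
    and \<mu>B \<mu>C :: "'d \<Rightarrow> complex" and \<Psi> \<Phi> :: "'a \<Rightarrow> 'd"

lemma measured_Hopf_mirror:
  assumes "measured_Hopf m mM la ra B C s t DB1 DB2 DC1 DC2 eB eC S mB mC \<Psi> \<Phi>"
  shows "measured_Hopf (\<lambda>a b. m b a) (\<lambda>x y. mM y x) ra la C B t s
    (flipped DC2) (flipped DC1) (flipped DB2) (flipped DB1) eC eB S mC mB \<Phi> \<Psi>"
  using assms by (simp add: measured_Hopf_def)

sublocale measured_Hopf \<subseteq> Hopf
  by unfold_locales

context measured_Hopf
begin

lemmas mu_linear = muC_linear[unfolded clinear_on_def, THEN conjunct1, rule_format]
  muC_linear[unfolded clinear_on_def, THEN conjunct2, rule_format]
  mirror.muC_linear[unfolded clinear_on_def, THEN conjunct1, rule_format]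
  mirror.muC_linear[unfolded clinear_on_def, THEN conjunct2, rule_format]

lemmas lin_all = lin_inv mu_linear clinear_add[OF Phi_linear] clinear_scale[OF Phi_linear]
  clinear_add[OF mirror.Phi_linear] clinear_scale[OF mirror.Phi_linear]

lemmas integral_in [simp] = Phi_in mirror.Phi_in

definition \<phi> :: "'a \<Rightarrow> complex" where "\<phi> a = \<mu>C (\<Phi> a)"
definition \<psi> :: "'a \<Rightarrow> complex" where "\<psi> a = \<mu>B (\<Psi> a)"
definition \<epsilon> :: "'a \<Rightarrow> complex" where "\<epsilon> a = \<mu>C (epsC a)"

lemma eps_B: "\<epsilon> a = \<mu>B (epsB a)"
  by (simp add: \<epsilon>_def mu_eps)

lemma mu_tBi: "y \<in> C \<Longrightarrow> \<mu>B (tBi y) = \<mu>C y"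
  using mu_tB[of "tBi y"] by simp

lemma mu_tCi: "x \<in> B \<Longrightarrow> \<mu>C (tCi x) = \<mu>B x"
  using mirror.mu_tB[of "tCi x"] by simp

lemma phi_linear: "clinear \<phi>"
  by (simp add: clinear_iff \<phi>_def lin_all)

lemma phi_eqI: "(\<And>x. \<phi> (x \<odot> a) = \<phi> (x \<odot> b)) \<Longrightarrow> a = b"
  using phi_faithful(1)[of "a - b"]
  by (simp add: \<phi>_def[symmetric] clinear_diff[OF clinear_mul_right] clinear_diff[OF phi_linear])

text \<open>For \<open>\<omega> = \<mu>\<^sub>C(w(-b))\<close> with \<open>w\<close> left \<open>C\<close>-linear, \<open>convC w b x\<close> is \<open>\<omega> \<triangleright> x\<close>; for \<open>\<upsilon> = \<mu>\<^sub>B(u(a-))\<close> with \<open>u\<close> right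
  \<open>B\<close>-linear, \<open>convB u a x\<close> is \<open>x \<triangleleft> \<upsilon>\<close>.  Absorbing \<open>b\<close> and \<open>a\<close> into the comultiplication makes both
  honest elements of \<open>A\<close>.\<close>

definition convC :: "('a \<Rightarrow> 'd) \<Rightarrow> 'a \<Rightarrow> 'a \<Rightarrow> 'a"
  where "convC w b x = tsum (\<lambda>p q. la (tC (w q)) p) (DC2 x b)"

definition convB :: "('a \<Rightarrow> 'd) \<Rightarrow> 'a \<Rightarrow> 'a \<Rightarrow> 'a"
  where "convB u a x = tsum (\<lambda>p q. ra (tB (u p)) q) (DB1 x a)"

text \<open>In Hopf algebra notation \<open>S(v\<^sub>1) S(x\<^sub>1) \<phi>(x\<^sub>2v\<^sub>2) = \<phi>(xv)\<close>, which is left invariance at the product \<open>xv\<close>.\<close>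

lemma strong_invariance_aux:
  assumes g: "clinear g"
  shows "tsum (\<lambda>p q. g (S p \<odot> S (convC \<Phi> q x))) (DC1 v a) = (g (ra (tBi (\<Phi> (x \<odot> v))) (S a)) :: complex)"
proof -
  note g' = clinear_add[OF g] clinear_scale[OF g]
  let ?f = "\<lambda>r s. g (S (la (tC (\<Phi> s)) r))"
  have f: "balC ?f"
    by (auto simp: balanced_def bilin_def lin_all g' Phi_la tC_mult la_mulM)
  have gS: "clinear (\<lambda>x. g (S x))" by (simp add: clinear_iff lin g')
  have "g (ra (tBi (\<Phi> (x \<odot> v))) (S a)) = g (S (la (\<Phi> (x \<odot> v)) a))"
    using mirror.S_ra[of "tBi (\<Phi> (x \<odot> v))" a] by simp
  also have "\<dots> = tsum ?f (DC1 (x \<odot> v) a)"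
    unfolding clinear_tsum[OF gS, symmetric] left_integral_DC1 ..
  also have "\<dots> = tsum (\<lambda>p q. tsum (\<lambda>r s. ?f r (s \<odot> q)) (DC1 x p)) (DC1 v a)"
    by (rule DC1_mult[OF f])
  also have "\<dots> = tsum (\<lambda>p q. tsum (\<lambda>r s. ?f (r \<odot> p) s) (DC2 x q)) (DC1 v a)"
    by (simp add: DC_rel[OF f])
  also have "\<dots> = tsum (\<lambda>p q. g (S p \<odot> S (convC \<Phi> q x))) (DC1 v a)"
  proof -
    have "tsum (\<lambda>r s. ?f (r \<odot> p) s) (DC2 x q) = g (S p \<odot> S (convC \<Phi> q x))" for p q
      unfolding convC_def
      by (subst clinear_tsum[of "\<lambda>z. g (S p \<odot> S z)"]) (simp_all add: clinear_iff lin g' la_mul S_mult)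
    then show ?thesis by simp
  qed
  finally show ?thesis ..
qed

lemma convC_Phi_bilin: "clinear g \<Longrightarrow> bilin (\<lambda>x b. g (convC \<Phi> b x) :: complex)"
  and convC_Phi_la: "y \<in> C \<Longrightarrow> convC \<Phi> (la y b) x = ra (tC y) (convC \<Phi> b x)"
proof -
  have f: "balC (\<lambda>p q. g (la (tC (\<Phi> q)) p))" if g: "clinear g" for g
    by (auto simp: balanced_def bilin_def lin_all clinear_add[OF g] clinear_scale[OF g] Phi_la tC_mult la_mulM)
  show "clinear g \<Longrightarrow> bilin (\<lambda>x b. g (convC \<Phi> b x) :: complex)" for g
    using DC2_bilin[OF f] by (simp add: convC_def clinear_tsum)
  show "y \<in> C \<Longrightarrow> convC \<Phi> (la y b) x = ra (tC y) (convC \<Phi> b x)"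
  proof (rule separating_functional_eq)
    fix g :: "'a \<Rightarrow> complex" assume y: "y \<in> C" and g: "clinear g"
    have "g (convC \<Phi> (la y b) x) = tsum (\<lambda>p q. g (la (tC (\<Phi> q)) (ra (tC y) p))) (DC2 x b)"
      using DC2_la[OF f[OF g] y] by (simp add: convC_def clinear_tsum[OF g])
    also have "\<dots> = g (ra (tC y) (convC \<Phi> b x))"
      unfolding convC_def
      by (subst clinear_tsum[of "\<lambda>z. g (ra (tC y) z)"])
        (simp_all add: clinear_iff lin clinear_add[OF g] clinear_scale[OF g] la_ra)
    finally show "g (convC \<Phi> (la y b) x) = g (ra (tC y) (convC \<Phi> b x))" .
  qed
qed

text \<open>This is \<open>S(x\<^sub>1) \<phi>(x\<^sub>2b) = b\<^sub>1 \<phi>(xb\<^sub>2)\<close>, where \<open>x\<^sub>1 \<otimes> x\<^sub>2\<close> comes from \<open>\<Delta>\<^sub>C\<close> and \<open>b\<^sub>1 \<otimes> b\<^sub>2\<close> from \<open>\<Delta>\<^sub>B\<close>.  The previous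
  lemma determines \<open>S(p) S((q\<cdot>\<phi>) \<triangleright> x)\<close> on all tensors of the form \<open>p \<otimes> q = \<Delta>\<^sub>C(v)(a \<otimes> 1)\<close>, and inverting the
  canonical map expresses \<open>S\<^sup>-\<^sup>1(e) \<otimes> b\<close> by such tensors.\<close>

lemma strong_invariance:
  "S (convC \<Phi> b x) = tsum (\<lambda>r s. ra (tBi (\<Phi> s)) r) (DB2 b x)"
proof (rule mul_cancel_left)
  fix e
  show "e \<odot> S (convC \<Phi> b x) = e \<odot> tsum (\<lambda>r s. ra (tBi (\<Phi> s)) r) (DB2 b x)"
  proof (rule separating_functional_eq)
    fix g :: "'a \<Rightarrow> complex" assume g: "clinear g"
    note g' = clinear_add[OF g] clinear_scale[OF g]
    let ?f = "\<lambda>p q. g (S p \<odot> S (convC \<Phi> q x))"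
    have "clinear (\<lambda>z. g (S p \<odot> S z))" for p by (simp add: clinear_iff lin g')
    then have bil: "bilin (\<lambda>x b. g (S p \<odot> S (convC \<Phi> b x)))" for p
      by (rule convC_Phi_bilin)
    have f: "balC ?f"
      using bil by (auto simp: balanced_def bilin_def lin g' convC_Phi_la S_la S_ra ra_mul_la)
    let ?h = "\<lambda>u v. g (ra (tBi (\<Phi> v)) u)"
    have h: "balB ?h"
      by (auto simp: balanced_def bilin_def lin_all g' Phi_ra tBi_mult ra_mulM)
    have "g (e \<odot> S (convC \<Phi> b x)) = ?f (Si e) b" by simp
    also have "\<dots> = tsum (\<lambda>u v. tsum ?f (DC1 v (Si u))) (DB1 b e)"
      by (rule canonical_inverse_first[OF f, symmetric])
    also have "\<dots> = tsum (\<lambda>u v. ?h u (x \<odot> v)) (DB1 b e)"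
      by (simp add: strong_invariance_aux[OF g])
    also have "\<dots> = tsum (\<lambda>r s. ?h (e \<odot> r) s) (DB2 b x)"
      by (rule DB_rel[OF h])
    also have "\<dots> = g (e \<odot> tsum (\<lambda>r s. ra (tBi (\<Phi> s)) r) (DB2 b x))"
      by (subst clinear_tsum[of "\<lambda>z. g (e \<odot> z)"]) (simp_all add: clinear_iff lin g' ra_mul)
    finally show "g (e \<odot> S (convC \<Phi> b x)) = g (e \<odot> tsum (\<lambda>r s. ra (tBi (\<Phi> s)) r) (DB2 b x))" .
  qed
qed

section \<open>The left and the right dual space coincide\<close>

text \<open>This is \<open>S\<^sup>2\<close> on \<open>C\<close>.\<close>

definition twist :: "'d \<Rightarrow> 'd" where "twist y = tCi (tBi y)"

lemma twist_in [simp]: "y \<in> C \<Longrightarrow> twist y \<in> C"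
  by (simp add: twist_def)

lemma twist_linear: "y \<in> C \<Longrightarrow> y' \<in> C \<Longrightarrow> twist (y + y') = twist y + twist y'"
    "y \<in> C \<Longrightarrow> twist (c *\<^sub>C y) = c *\<^sub>C twist y"
  by (simp_all add: twist_def lin_inv)

lemma mu_twist: "y \<in> C \<Longrightarrow> \<mu>C (twist y) = \<mu>C y"
  by (simp add: twist_def mu_tCi mu_tBi)

text \<open>For \<open>\<theta> = \<mu>\<^sub>C \<circ> w\<close> this is, in Hopf algebra notation, \<open>\<theta>(S\<^sup>-\<^sup>1(b\<^sub>1e)) b\<^sub>2\<close>.  The twist makes the slice map
  balanced over \<open>C\<close> and leaves \<open>\<mu>\<^sub>C\<close> invariant.\<close>

definition modular :: "('a \<Rightarrow> 'd) \<Rightarrow> 'a \<Rightarrow> 'a \<Rightarrow> 'a"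
  where "modular w b e = tsum (\<lambda>p q. la (twist (w (Si p))) q) (DC1 b e)"

definition rightC :: "('a \<Rightarrow> 'd) \<Rightarrow> bool"
  where "rightC w \<longleftrightarrow> clinear w \<and> range w \<subseteq> C \<and> (\<forall>y\<in>C. \<forall>a. w (ra y a) = w a \<star> y)"

definition leftC :: "('a \<Rightarrow> 'd) \<Rightarrow> bool"
  where "leftC w \<longleftrightarrow> clinear w \<and> range w \<subseteq> C \<and> (\<forall>y\<in>C. \<forall>a. w (la y a) = y \<star> w a)"

definition rightB :: "('a \<Rightarrow> 'd) \<Rightarrow> bool"
  where "rightB w \<longleftrightarrow> clinear w \<and> range w \<subseteq> B \<and> (\<forall>x\<in>B. \<forall>a. w (ra x a) = w a \<star> x)"

lemma Phi_rightC: "rightC \<Phi>" and Phi_leftC: "leftC \<Phi>"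
  by (auto simp: rightC_def leftC_def Phi_linear Phi_ra Phi_la)

lemma Psi_rightB: "rightB \<Psi>"
  by (auto simp: rightB_def mirror.Phi_linear mirror.Phi_la)

text \<open>The functional \<open>x \<mapsto> \<theta>(a ((b\<cdot>\<phi>) \<triangleright> x))\<close> has the form \<open>c\<cdot>\<phi>\<close>.  After strong invariance the left-hand side
  is \<open>\<theta>(a S\<^sup>-\<^sup>1(b\<^sub>1)) \<phi>(xb\<^sub>2)\<close> with \<open>\<Delta>\<^sub>B(b)\<close>, whereas \<open>c = \<theta>(S\<^sup>-\<^sup>1(b\<^sub>1S(a))) b\<^sub>2\<close> involves \<open>\<Delta>\<^sub>C(b)\<close>.  The two are joined by
  evaluating \<open>\<theta> \<circ> S\<^sup>-\<^sup>1\<close>, \<open>\<epsilon>\<close> and \<open>\<phi>\<close> on the three legs of the coassociativity relation between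
  \<open>\<Delta>\<^sub>C\<close> and \<open>\<Delta>\<^sub>B\<close>: the counit removes \<open>\<Delta>\<^sub>C\<close> on one side and \<open>\<Delta>\<^sub>B\<close> on the other.\<close>

lemma modular_property:
  assumes w: "rightC w"
  shows "\<mu>C (w (a \<odot> convC \<Phi> b x)) = \<phi> (x \<odot> modular w b (S a))"
proof -
  have w': "w a \<in> C" "w (u + v) = w u + w v" "w (c *\<^sub>C u) = c *\<^sub>C w u" "y \<in> C \<Longrightarrow> w (ra y a) = w a \<star> y"
    for a u v c y using w by (auto simp: rightC_def clinear_iff)
  let ?w = "\<lambda>p. twist (w (Si p))"
  note tw = w' twist_linear
  have tw_la: "?w (la (tC y) p) = ?w p \<star> y" if "y \<in> C" for y p
    using that w' by (simp add: twist_def Si_la_B tBi_mult tCi_mult)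
  let ?h = "\<lambda>p q. \<epsilon> (la (?w p) q)"
  have eps': "\<epsilon> (u + v) = \<epsilon> u + \<epsilon> v" "\<epsilon> (c *\<^sub>C u) = c *\<^sub>C \<epsilon> u" for u v c
    by (simp_all add: \<epsilon>_def lin_all)
  have h: "balC ?h"
    by (auto simp: balanced_def bilin_def lin_all tw eps' tw_la la_mulM)
  let ?k = "\<lambda>q r. \<epsilon> (ra (tBi (\<Phi> r)) q)"
  have k: "balB ?k"
    by (auto simp: balanced_def bilin_def lin_all eps' Phi_ra tBi_mult ra_mulM)
  let ?g = "\<lambda>p q r. \<epsilon> (ra (tBi (\<Phi> r)) (la (?w p) q))"
  have g: "balanced3 C (\<lambda>y. la (tC y)) la B ra (\<lambda>x. ra (tB x)) ?g"
    by (auto simp: balanced3_def balanced_def bilin_def lin_all tw eps' tw_la la_mulM Phi_ra tBi_mult ra_mulM la_ra)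
  have hsum: "tsum ?h (DC1 d (S a)) = \<mu>C (w (a \<odot> Si d))" for d
  proof -
    have "tsum ?h (DC1 d (S a)) = tsum (\<lambda>p q. \<mu>C (?w (la (tC (epsC q)) p))) (DC1 d (S a))"
      by (simp add: \<epsilon>_def epsC_la w' tw_la)
    also have "\<dots> = \<mu>C (?w (d \<odot> S a))"
      unfolding counit_DC1[symmetric]
      by (rule clinear_tsum[symmetric]) (simp add: clinear_iff tw lin_all)
    finally show ?thesis by (simp add: mu_twist w' Si_mult)
  qed
  have ksum: "tsum ?k (DB2 d x) = \<phi> (x \<odot> d)" for d
  proof -
    have "?k q r = \<phi> (ra (tB (epsB q)) r)" for q r
    proof -
      have "?k q r = \<mu>B (epsB q \<star> tBi (\<Phi> r))"
        by (simp add: eps_B mirror.epsC_la)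
      also have "\<dots> = \<mu>C (tB (epsB q \<star> tBi (\<Phi> r)))" by (simp add: mu_tB)
      also have "\<dots> = \<phi> (ra (tB (epsB q)) r)"
        by (simp add: mirror.tC_mult \<phi>_def Phi_ra)
      finally show ?thesis .
    qed
    then have "tsum ?k (DB2 d x) = tsum (\<lambda>q r. \<phi> (ra (tB (epsB q)) r)) (DB2 d x)" by simp
    also have "\<dots> = \<phi> (x \<odot> d)"
      unfolding clinear_tsum[OF phi_linear, symmetric] counit_DB2 ..
    finally show ?thesis .
  qed
  have wSi: "clinear (\<lambda>z. \<mu>C (w (a \<odot> Si z)))"
    by (simp add: clinear_iff lin_all w')
  have "\<mu>C (w (a \<odot> convC \<Phi> b x)) = \<mu>C (w (a \<odot> Si (tsum (\<lambda>r s. ra (tBi (\<Phi> s)) r) (DB2 b x))))"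
    by (simp add: strong_invariance[symmetric])
  also have "\<dots> = tsum (\<lambda>d r. tsum ?h (DC1 (ra (tBi (\<Phi> r)) d) (S a))) (DB2 b x)"
    by (subst clinear_tsum[OF wSi]) (simp add: hsum)
  also have "\<dots> = tsum (\<lambda>d r. tsum (\<lambda>p q. ?g p q r) (DC1 d (S a))) (DB2 b x)"
    by (simp add: DC1_ra[OF h] la_ra)
  also have "\<dots> = tsum (\<lambda>p d. tsum (\<lambda>q r. ?g p q r) (DB2 d x)) (DC1 b (S a))"
    by (rule coassoc_CB[OF g])
  also have "\<dots> = tsum (\<lambda>p d. tsum ?k (DB2 (la (?w p) d) x)) (DC1 b (S a))"
    by (simp add: DB2_la[OF k] tw)
  also have "\<dots> = \<phi> (x \<odot> modular w b (S a))"
    unfolding ksum modular_def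
    by (rule clinear_tsum[symmetric]) (simp add: clinear_iff lin clinear_add[OF phi_linear] clinear_scale[OF phi_linear])
  finally show ?thesis .
qed

text \<open>This is \<open>\<upsilon>(\<omega> \<triangleright> x) = \<omega>(x \<triangleleft> \<upsilon>)\<close>: both sides arise by evaluating \<open>\<upsilon>\<close>, \<open>\<epsilon>\<close> and \<open>\<omega>\<close> on the three legs of the
  coassociativity relation between \<open>\<Delta>\<^sub>B\<close> and \<open>\<Delta>\<^sub>C\<close>.\<close>

lemma convolution_associative:
  assumes u: "rightB u" and w: "leftC w"
  shows "\<mu>B (u (a \<odot> convC w b x)) = \<mu>C (w (convB u a x \<odot> b))"
proof -
  have u': "u a \<in> B" "u (p + q) = u p + u q" "u (c *\<^sub>C p) = c *\<^sub>C u p" "x \<in> B \<Longrightarrow> u (ra x a) = u a \<star> x"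
    for a p q c x using u by (auto simp: rightB_def clinear_iff)
  have w': "w a \<in> C" "w (p + q) = w p + w q" "w (c *\<^sub>C p) = c *\<^sub>C w p" "y \<in> C \<Longrightarrow> w (la y a) = y \<star> w a"
    for a p q c y using w by (auto simp: leftC_def clinear_iff)
  have eps': "\<epsilon> (u + v) = \<epsilon> u + \<epsilon> v" "\<epsilon> (c *\<^sub>C u) = c *\<^sub>C \<epsilon> u" for u v c
    by (simp_all add: \<epsilon>_def lin_all)
  let ?g = "\<lambda>p q r. \<epsilon> (la (tC (w r)) (ra (tB (u p)) q))"
  have g: "balanced3 B ra (\<lambda>x. ra (tB x)) C (\<lambda>y. la (tC y)) la ?g"
    by (auto simp: balanced3_def balanced_def bilin_def lin_all u' w' eps' mirror.tC_mult tC_mult ra_mulM la_mulM la_ra)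
  let ?h = "\<lambda>p q. \<epsilon> (ra (tB (u p)) q)"
  have h: "balB ?h"
    by (auto simp: balanced_def bilin_def lin_all u' eps' mirror.tC_mult ra_mulM)
  let ?k = "\<lambda>q r. \<epsilon> (la (tC (w r)) q)"
  have k: "balC ?k"
    by (auto simp: balanced_def bilin_def lin_all w' eps' tC_mult la_mulM)
  have hsum: "tsum ?h (DB1 d a) = \<mu>B (u (a \<odot> d))" for d
  proof -
    have "tsum ?h (DB1 d a) = tsum (\<lambda>p q. \<mu>B (u (ra (epsB q) p))) (DB1 d a)"
      by (simp add: eps_B mirror.epsC_tC u')
    also have "\<dots> = \<mu>B (u (a \<odot> d))"
      unfolding counit_DB1[symmetric]
      by (rule clinear_tsum[symmetric]) (simp add: clinear_iff lin_all u')
    finally show ?thesis .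
  qed
  have ksum: "tsum ?k (DC2 d b) = \<mu>C (w (d \<odot> b))" for d
  proof -
    have "tsum ?k (DC2 d b) = tsum (\<lambda>p q. \<mu>C (w (la (epsC p) q))) (DC2 d b)"
      by (simp add: \<epsilon>_def epsC_tC w')
    also have "\<dots> = \<mu>C (w (d \<odot> b))"
      unfolding counit_DC2[symmetric]
      by (rule clinear_tsum[symmetric]) (simp add: clinear_iff lin_all w')
    finally show ?thesis .
  qed
  have "\<mu>B (u (a \<odot> convC w b x)) = tsum (\<lambda>d r. tsum ?h (DB1 (la (tC (w r)) d) a)) (DC2 x b)"
    unfolding hsum convC_def
    by (rule clinear_tsum) (simp add: clinear_iff lin_all u')
  also have "\<dots> = tsum (\<lambda>d r. tsum (\<lambda>p q. ?g p q r) (DB1 d a)) (DC2 x b)"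
    by (simp add: DB1_la[OF h] w' la_ra)
  also have "\<dots> = tsum (\<lambda>p d. tsum (\<lambda>q r. ?g p q r) (DC2 d b)) (DB1 x a)"
    by (rule coassoc_BC[OF g])
  also have "\<dots> = tsum (\<lambda>p d. tsum ?k (DC2 (ra (tB (u p)) d) b)) (DB1 x a)"
    by (simp add: DC2_ra[OF k] u')
  also have "\<dots> = \<mu>C (w (convB u a x \<odot> b))"
    unfolding ksum convB_def
    by (rule clinear_tsum[symmetric]) (simp add: clinear_iff lin_all w')
  finally show ?thesis .
qed


lemma counit_convC:
  assumes w: "leftC w"
  shows "\<epsilon> (convC w b x) = \<mu>C (w (x \<odot> b))"
proof -
  have w': "w a \<in> C" "w (p + q) = w p + w q" "w (c *\<^sub>C p) = c *\<^sub>C w p" "y \<in> C \<Longrightarrow> w (la y a) = y \<star> w a"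
    for a p q c y using w by (auto simp: leftC_def clinear_iff)
  have "\<epsilon> (convC w b x) = tsum (\<lambda>p q. \<mu>C (w (la (epsC p) q))) (DC2 x b)"
    unfolding convC_def by (subst clinear_tsum) (simp_all add: clinear_iff \<epsilon>_def lin_all epsC_tC w')
  also have "\<dots> = \<mu>C (w (x \<odot> b))"
    unfolding counit_DC2[symmetric]
    by (rule clinear_tsum[symmetric]) (simp add: clinear_iff lin_all w')
  finally show ?thesis .
qed

lemma convC_mul:
  assumes w: "leftC w"
  shows "convC w b x \<odot> c = tsum (\<lambda>p q. la (tC (w (q \<odot> b))) p) (DC1 x c)"
proof (rule separating_functional_eq)
  fix g :: "'a \<Rightarrow> complex" assume g: "clinear g"
  note g' = clinear_add[OF g] clinear_scale[OF g]
  have w': "w a \<in> C" "w (p + q) = w p + w q" "w (c *\<^sub>C p) = c *\<^sub>C w p" "y \<in> C \<Longrightarrow> w (la y a) = y \<star> w a"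
    for a p q c y using w by (auto simp: leftC_def clinear_iff)
  let ?f = "\<lambda>p q. g (la (tC (w q)) p)"
  have f: "balC ?f"
    by (auto simp: balanced_def bilin_def lin_all w' g' tC_mult la_mulM)
  have "g (convC w b x \<odot> c) = tsum (\<lambda>p q. ?f (p \<odot> c) q) (DC2 x b)"
    unfolding convC_def
    by (subst clinear_tsum[of "\<lambda>z. g (z \<odot> c)"]) (simp_all add: clinear_iff lin g' la_mul)
  also have "\<dots> = tsum (\<lambda>p q. ?f p (q \<odot> b)) (DC1 x c)"
    by (rule DC_rel[OF f, symmetric])
  finally show "g (convC w b x \<odot> c) = g (tsum (\<lambda>p q. la (tC (w (q \<odot> b))) p) (DC1 x c))"
    by (simp add: clinear_tsum[OF g])
qed

lemma mirror_measured: "measured_Hopf (\<lambda>a b. mul b a) (\<lambda>m n. mulM n m) ra la C B tC tB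
    (flipped DC2) (flipped DC1) (flipped DB2) (flipped DB1) epsC epsB S \<mu>C \<mu>B \<Phi> \<Psi>"
  by (rule measured_Hopf_mirror) unfold_locales

text \<open>The elements \<open>modular w v a\<close> span \<open>w(A) A\<close>, because the elements \<open>\<Delta>\<^sub>C(v)(a \<otimes> 1)\<close> span the tensor product.\<close>

lemma canonical_modular:
  assumes w: "rightC w"
  shows "la (twist (w (Si s))) b = tsum (\<lambda>u v. modular w v (Si u)) (DB1 b (S s))"
proof (rule separating_functional_eq)
  fix g :: "'a \<Rightarrow> complex" assume g: "clinear g"
  note g' = clinear_add[OF g] clinear_scale[OF g]
  have w': "w a \<in> C" "w (u + v) = w u + w v" "w (c *\<^sub>C u) = c *\<^sub>C w u" "y \<in> C \<Longrightarrow> w (ra y a) = w a \<star> y"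
    for a u v c y using w by (auto simp: rightC_def clinear_iff)
  let ?f = "\<lambda>p q. g (la (twist (w (Si p))) q)"
  have tw_la: "twist (w (Si (la (tC y) p))) = twist (w (Si p)) \<star> y" if "y \<in> C" for y p
    using that w' by (simp add: twist_def Si_la_B tBi_mult tCi_mult)
  have f: "balC ?f"
    by (auto simp: balanced_def bilin_def lin_all g' w' twist_linear tw_la la_mulM)
  show "g (la (twist (w (Si s))) b) = g (tsum (\<lambda>u v. modular w v (Si u)) (DB1 b (S s)))"
    using canonical_inverse_first[OF f, of b "S s"] by (simp add: modular_def clinear_tsum[OF g])
qed

text \<open>The inclusion \<open>A\<cdot>\<phi> \<subseteq> \<psi>\<cdot>A\<close>.  The functional \<open>\<psi>(a ((b\<cdot>\<phi>) \<triangleright> x)) = \<phi>((x \<triangleleft> (\<psi>\<cdot>a)) b)\<close> lies in \<open>A\<cdot>\<phi>\<close> by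
  \<open>modular_property\<close> and in \<open>\<psi>\<cdot>A\<close> by its mirror image.  The elements \<open>c\<close> obtained in \<open>c\<cdot>\<phi>\<close> span \<open>CA = A\<close>, since
  the map through which \<open>\<psi>\<close> factors is onto \<open>C\<close>.\<close>

lemma phi_dual_subset: "\<exists>d. \<forall>x. \<phi> (x \<odot> c) = \<psi> (d \<odot> x)"
proof -
  interpret M: measured_Hopf "\<lambda>a b. mul b a" "\<lambda>m n. mulM n m" ra la C B tC tB
    "flipped DC2" "flipped DC1" "flipped DB2" "flipped DB1" epsC epsB S \<mu>C \<mu>B \<Phi> \<Psi>
    by (rule mirror_measured)
  have M_psi: "M.\<phi> = \<psi>" by (simp add: M.\<phi>_def \<psi>_def fun_eq_iff)
  have M_conv: "M.convC = convB" by (simp add: M.convC_def convB_def fun_eq_iff)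
  obtain g where g: "rightC g" "range g = C" "\<And>a. \<mu>C (g a) = \<psi> a"
    using psi_factor by (auto simp: rightC_def \<psi>_def)
  obtain g' where g': "M.rightC g'" "\<And>a. \<mu>B (g' a) = \<phi> a"
    using mirror.psi_factor by (auto simp: M.rightC_def \<phi>_def)
  define V where "V = {c. \<exists>d. \<forall>x. \<phi> (x \<odot> c) = \<psi> (d \<odot> x)}"
  have psi_linear: "clinear \<psi>" using M.phi_linear by (simp add: M_psi)
  have V: "csubspace V"
  proof (rule complex_space.subspaceI)
    show "0 \<in> V"
      unfolding V_def using clinear_zero[OF phi_linear] clinear_zero[OF psi_linear]
        clinear_zero[OF clinear_mul_left] clinear_zero[OF clinear_mul_right] by (auto intro!: exI[of _ 0])
  next
    fix c c' assume "c \<in> V" "c' \<in> V"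
    then obtain d d' where "\<And>x. \<phi> (x \<odot> c) = \<psi> (d \<odot> x)" "\<And>x. \<phi> (x \<odot> c') = \<psi> (d' \<odot> x)"
      by (auto simp: V_def)
    then have "\<phi> (x \<odot> (c + c')) = \<psi> ((d + d') \<odot> x)" for x
      by (simp add: lin clinear_add[OF phi_linear] clinear_add[OF psi_linear])
    then show "c + c' \<in> V" by (auto simp: V_def)
  next
    fix c z assume "c \<in> V"
    then obtain d where "\<And>x. \<phi> (x \<odot> c) = \<psi> (d \<odot> x)" by (auto simp: V_def)
    then have "\<phi> (x \<odot> z *\<^sub>C c) = \<psi> ((z *\<^sub>C d) \<odot> x)" for x
      by (simp add: lin clinear_scale[OF phi_linear] clinear_scale[OF psi_linear])
    then show "z *\<^sub>C c \<in> V" by (auto simp: V_def)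
  qed
  have mod: "modular g b (S a) \<in> V" for a b
    \<comment> \<open>the same functional computed in two ways\<close>
  proof -
    have "\<phi> (x \<odot> modular g b (S a)) = \<psi> (M.modular g' a (S b) \<odot> x)" for x
    proof -
      have "\<phi> (x \<odot> modular g b (S a)) = \<psi> (a \<odot> convC \<Phi> b x)"
        using modular_property[OF g(1), of a b x] g(3) by simp
      also have "\<dots> = \<phi> (convB \<Psi> a x \<odot> b)"
        using convolution_associative[OF Psi_rightB Phi_leftC, of a b x] by (simp add: \<phi>_def \<psi>_def)
      also have "\<dots> = \<psi> (M.modular g' a (S b) \<odot> x)"
        using M.modular_property[OF g'(1), of a x b] g'(2) by (simp add: M_psi M_conv)
      finally show ?thesis .
    qed
    then show ?thesis by (auto simp: V_def)
  qed
  have "c \<in> V"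
  proof (rule C_idempotent[OF V])
    fix y b assume y: "y \<in> C"
    \<comment> \<open>the twist of \<open>tB (tC y)\<close> is \<open>y\<close>\<close>
    then obtain s where s: "g s = tB (tC y)" using g(2) by (metis rangeE mirror.tC_in tC_in)
    have "la y b = tsum (\<lambda>u v. modular g v (Si u)) (DB1 b (S (S s)))"
      using canonical_modular[OF g(1), of "S s" b] s y by (simp add: twist_def)
    moreover have "modular g v (Si u) \<in> V" for u v using mod[of v "Si (Si u)"] by simp
    ultimately show "la y b \<in> V" by (simp add: tsum_in_subspace[OF V])
  qed
  then show ?thesis by (simp add: V_def)
qed

section \<open>Cointegrals and the unit of the dual algebra\<close>

text \<open>By the counit axiom every product \<open>ab\<close> is a sum of elements \<open>t\<^sub>C(\<epsilon>\<^sub>C(q))p\<close>, so \<open>t\<^sub>C(z)\<close>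
  is determined by the elements \<open>t\<^sub>C(\<epsilon>\<^sub>C(q)z)\<close>.\<close>

lemma eps_cancel:
  assumes "z \<in> C" "z' \<in> C" "\<And>a. epsC a \<star> z = epsC a \<star> z'"
  shows "z = z'"
proof (rule tC_inj[OF assms(1,2)], rule la_eqI, rule mul_cancel_right)
  fix a b
  have "la (tC z) a \<odot> b = tsum (\<lambda>p q. la (tC (epsC q \<star> z)) p) (DC1 a b)" if "z \<in> C" for z
  proof -
    have "la (tC z) a \<odot> b = la (tC z) (tsum (\<lambda>p q. la (tC (epsC q)) p) (DC1 a b))"
      by (simp add: counit_DC1 la_mul)
    also have "\<dots> = tsum (\<lambda>p q. la (tC (epsC q \<star> z)) p) (DC1 a b)"
      unfolding clinear_tsum[OF clinear_la] using that by (simp add: tC_mult la_mulM)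
    finally show ?thesis .
  qed
  then show "la (tC z) a \<odot> b = la (tC z') a \<odot> b" using assms by simp
qed

lemma Phi_eq_epsC:
  assumes l: "\<And>x. \<phi> (x \<odot> l) = \<epsilon> x"
  shows "\<Phi> (x \<odot> l) = epsC x"
proof (rule muC_faithful)
  fix z assume z: "z \<in> C"
  show "\<mu>C (z \<star> \<Phi> (x \<odot> l)) = \<mu>C (z \<star> epsC x)"
    using l[of "la z x"] z by (simp add: \<phi>_def \<epsilon>_def Phi_la epsC_la la_mul[symmetric])
qed simp_all

text \<open>If \<open>\<epsilon> = l\<cdot>\<phi>\<close>, then \<open>\<phi>(xal) = \<epsilon>(xa) = \<epsilon>(x \<epsilon>\<^sub>C(a)) = \<phi>(x \<epsilon>\<^sub>C(a)l)\<close>, and \<open>\<phi>\<close> is faithful.  Moreover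
  \<open>\<epsilon>\<^sub>C(a)\<Phi>(l) = \<Phi>(al) = \<epsilon>\<^sub>C(a)\<close>.  By \<open>eps_cancel\<close> this gives \<open>\<Phi>(l)y = y\<close>, and, with \<open>t\<^sub>C(y)a\<close> in place of \<open>a\<close>,
  also \<open>y\<Phi>(l) = y\<close>.\<close>

lemma counit_left_cointegral_iff:
  "(\<forall>x. \<phi> (x \<odot> l) = \<epsilon> x) \<longleftrightarrow>
    (\<forall>a. a \<odot> l = la (epsC a) l) \<and> \<Phi> l \<in> C \<and> (\<forall>y\<in>C. \<Phi> l \<star> y = y \<and> y \<star> \<Phi> l = y)"
proof (intro iffI conjI allI ballI)
  assume l: "\<forall>x. \<phi> (x \<odot> l) = \<epsilon> x"
  show coint: "a \<odot> l = la (epsC a) l" for a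
  proof (rule phi_eqI)
    fix x
    have "\<phi> (x \<odot> (a \<odot> l)) = \<epsilon> (x \<odot> a)" using l by (simp add: mul_assoc[symmetric])
    also have "\<dots> = \<epsilon> (ra (epsC a) x)" by (simp add: \<epsilon>_def epsC_mult[of x a])
    also have "\<dots> = \<phi> (x \<odot> la (epsC a) l)" using l by (simp add: ra_mul_la[symmetric])
    finally show "\<phi> (x \<odot> (a \<odot> l)) = \<phi> (x \<odot> la (epsC a) l)" .
  qed
  have unit: "epsC a \<star> \<Phi> l = epsC a" for a
    using Phi_eq_epsC[of l a] l coint[of a] by (simp add: Phi_la)
  show "\<Phi> l \<in> C" by simp
  fix y assume y: "y \<in> C"
  show "\<Phi> l \<star> y = y"
    by (rule eps_cancel) (simp_all add: y mulM_assoc[symmetric] unit)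
  show "y \<star> \<Phi> l = y"
  proof (rule eps_cancel)
    fix a
    show "epsC a \<star> (y \<star> \<Phi> l) = epsC a \<star> y"
      using unit[of "la (tC y) a"] y by (simp add: epsC_tC mulM_assoc)
  qed (simp_all add: y)
next
  fix x
  assume "(\<forall>a. a \<odot> l = la (epsC a) l) \<and> \<Phi> l \<in> C \<and> (\<forall>y\<in>C. \<Phi> l \<star> y = y \<and> y \<star> \<Phi> l = y)"
  then show "\<phi> (x \<odot> l) = \<epsilon> x"
    by (simp add: \<phi>_def \<epsilon>_def Phi_la)
qed

lemma convC_counit:
  assumes l: "\<And>x. \<phi> (x \<odot> l) = \<epsilon> x"
  shows "convC \<Phi> l x = x"
  by (rule mul_cancel_right) (simp add: convC_mul[OF Phi_leftC] Phi_eq_epsC[OF l] counit_DC1)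

text \<open>The left-hand side says that \<open>l\<cdot>\<phi>\<close> is a unit of \<open>A\<cdot>\<phi>\<close> for the product \<open>\<upsilon>\<omega> = \<upsilon>(\<omega> \<triangleright> -)\<close>.\<close>

lemma dual_unit_iff:
  "(\<forall>b x. \<phi> (convC \<Phi> b x \<odot> l) = \<phi> (x \<odot> b) \<and> \<phi> (convC \<Phi> l x \<odot> b) = \<phi> (x \<odot> b)) \<longleftrightarrow>
    (\<forall>x. \<phi> (x \<odot> l) = \<epsilon> x)"
proof
  assume *: "\<forall>b x. \<phi> (convC \<Phi> b x \<odot> l) = \<phi> (x \<odot> b) \<and> \<phi> (convC \<Phi> l x \<odot> b) = \<phi> (x \<odot> b)"
  have "convC \<Phi> l x = x" for x
  proof -
    have "convC \<Phi> l x - x = 0"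
      by (rule phi_faithful(2))
        (use * in \<open>simp add: \<phi>_def[symmetric] clinear_diff[OF clinear_mul_left] clinear_diff[OF phi_linear]\<close>)
    then show ?thesis by simp
  qed
  then show "\<forall>x. \<phi> (x \<odot> l) = \<epsilon> x"
    using counit_convC[OF Phi_leftC, of l] by (simp add: \<phi>_def)
next
  assume l: "\<forall>x. \<phi> (x \<odot> l) = \<epsilon> x"
  then show "\<forall>b x. \<phi> (convC \<Phi> b x \<odot> l) = \<phi> (x \<odot> b) \<and> \<phi> (convC \<Phi> l x \<odot> b) = \<phi> (x \<odot> b)"
    using counit_convC[OF Phi_leftC] convC_counit[of l] by (simp add: \<phi>_def)
qed

text \<open>Since \<open>(l\<cdot>\<phi>) \<triangleright> x = x\<close>, the modular property rewrites \<open>\<phi>\<cdot>c\<close> as \<open>d\<cdot>\<phi>\<close>.  Hence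
  \<open>\<phi>(a ((d\<cdot>\<phi>) \<triangleright> l)) = \<phi>(c (l \<triangleleft> (\<phi>\<cdot>a)))\<close>, which is \<open>\<phi>(a l\<^sub>1) \<phi>(c l\<^sub>2)\<close> for \<open>\<Delta>\<^sub>B(l)\<close>.  Strong invariance turns this into
  \<open>\<phi>(a S((l\<cdot>\<phi>) \<triangleright> c)) = \<phi>(a S(c))\<close>.\<close>

lemma cointegral_generates:
  assumes l: "\<And>x. \<phi> (x \<odot> l) = \<epsilon> x"
  shows "\<exists>d. convC \<Phi> d l = S c"
proof
  define d where "d = modular \<Phi> l (S c)"
  have d: "\<phi> (c \<odot> x) = \<phi> (x \<odot> d)" for x
    using modular_property[OF Phi_rightC, of c l x] by (simp add: d_def \<phi>_def convC_counit[OF l])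
  obtain g where g: "rightB g" "\<And>a. \<mu>B (g a) = \<phi> a"
    using phi_factor by (auto simp: rightB_def \<phi>_def)
  have g': "g a \<in> B" "g (p + q) = g p + g q" "g (c *\<^sub>C p) = c *\<^sub>C g p" "x \<in> B \<Longrightarrow> g (ra x a) = g a \<star> x"
    for a p q c x using g(1) by (auto simp: rightB_def clinear_iff)
  note phi' = clinear_add[OF phi_linear] clinear_scale[OF phi_linear]
  let ?h = "\<lambda>u v. \<phi> (ra (tBi (\<Phi> v)) u)"
  have h: "balB ?h"
    by (auto simp: balanced_def bilin_def lin_all phi' Phi_ra tBi_mult ra_mulM)
  show "convC \<Phi> d l = S c"
  proof (rule phi_eqI)
    fix a
    have swap: "\<phi> (c \<odot> ra (tB (g u)) v) = ?h u (c \<odot> v)" for u v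
    proof -
      have "\<phi> (c \<odot> ra (tB (g u)) v) = \<mu>C (\<Phi> (c \<odot> v) \<star> tB (g u))"
        by (simp add: \<phi>_def ra_mul[symmetric] Phi_ra g')
      also have "\<dots> = \<mu>B (g u \<star> tBi (\<Phi> (c \<odot> v)))"
        using mu_tBi[of "\<Phi> (c \<odot> v) \<star> tB (g u)"] by (simp add: tBi_mult g')
      also have "\<dots> = ?h u (c \<odot> v)" by (simp add: g(2)[symmetric] g')
      finally show ?thesis .
    qed
    have "\<phi> (a \<odot> convC \<Phi> d l) = \<phi> (convB g a l \<odot> d)"
      using convolution_associative[OF g(1) Phi_leftC, of a d l] g(2) by (simp add: \<phi>_def)
    also have "\<dots> = \<phi> (c \<odot> convB g a l)" by (rule d[symmetric])
    also have "\<dots> = tsum (\<lambda>u v. ?h u (c \<odot> v)) (DB1 l a)"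
      unfolding swap[symmetric] convB_def
      by (rule clinear_tsum) (simp add: clinear_iff lin phi')
    also have "\<dots> = tsum (\<lambda>r s. ?h (a \<odot> r) s) (DB2 l c)"
      by (rule DB_rel[OF h])
    also have "\<dots> = \<phi> (a \<odot> S (convC \<Phi> l c))"
      unfolding strong_invariance
      by (subst clinear_tsum[of "\<lambda>z. \<phi> (a \<odot> z)"]) (simp_all add: clinear_iff lin phi' ra_mul)
    finally show "\<phi> (a \<odot> convC \<Phi> d l) = \<phi> (a \<odot> S c)"
      by (simp add: convC_counit[OF l])
  qed
qed

lemma mirror_phi: "measured_Hopf.\<phi> \<mu>B \<Psi> = \<psi>"
  and mirror_psi: "measured_Hopf.\<psi> \<mu>C \<Phi> = \<phi>"
  and mirror_epsilon: "measured_Hopf.\<epsilon> epsB \<mu>B = \<epsilon>"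
  and mirror_convC: "measured_Hopf.convC ra tB (flipped DB1) = convB"
proof -
  interpret M: measured_Hopf "\<lambda>a b. mul b a" "\<lambda>m n. mulM n m" ra la C B tC tB
    "flipped DC2" "flipped DC1" "flipped DB2" "flipped DB1" epsC epsB S \<mu>C \<mu>B \<Phi> \<Psi>
    by (rule mirror_measured)
  show "M.\<phi> = \<psi>" by (simp add: M.\<phi>_def \<psi>_def fun_eq_iff)
  show "M.\<psi> = \<phi>" by (simp add: M.\<psi>_def \<phi>_def fun_eq_iff)
  show "M.\<epsilon> = \<epsilon>" by (simp add: M.\<epsilon>_def \<epsilon>_def mu_eps fun_eq_iff)
  show "M.convC = convB" by (simp add: M.convC_def convB_def fun_eq_iff)
qed

lemmas psi_dual_subset = measured_Hopf.phi_dual_subset[OF mirror_measured, unfolded mirror_phi mirror_psi]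

lemmas convB_Psi_mul = measured_Hopf.convC_mul[OF mirror_measured measured_Hopf.Phi_leftC[OF mirror_measured],
    unfolded mirror_convC tsum_flipped]

lemmas counit_right_cointegral_iff =
  measured_Hopf.counit_left_cointegral_iff[OF mirror_measured, unfolded mirror_phi mirror_epsilon]

lemmas right_cointegral_generates =
  measured_Hopf.cointegral_generates[OF mirror_measured, unfolded mirror_phi mirror_epsilon mirror_convC]

end

section \<open>Comultiplications in coordinates\<close>

lemma slice_clinear: "clinear h \<Longrightarrow> h (slice F X) = slice (\<lambda>a b. h (F a b)) X"
  unfolding slice_def linext_def
  by (simp add: clinear_sum clinear_scale case_prod_unfold)

lemma coset_plus: "csubspace N \<Longrightarrow> qadd N (coset N u) (coset N v) = coset N (u + v)"
proof -
  assume N: "csubspace N"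
  have "(rep (coset N u) - u) + (rep (coset N v) - v) \<in> N"
    by (intro complex_space.subspace_add[OF N] rep_coset[OF N])
  then show ?thesis unfolding qadd_def coset_eq_iff[OF N] by (simp add: algebra_simps)
qed

lemma coset_scale: "csubspace N \<Longrightarrow> qscale N c (coset N u) = coset N (c *\<^sub>C u)"
proof -
  assume N: "csubspace N"
  have "c *\<^sub>C (rep (coset N u) - u) \<in> N"
    by (intro complex_space.subspace_scale[OF N] rep_coset[OF N])
  then show ?thesis unfolding qscale_def coset_eq_iff[OF N]
    by (simp add: complex_space.scale_right_diff_distrib)
qed

text \<open>The axioms shared by \<open>\<Delta>\<^sub>C\<close> and \<open>\<Delta>\<^sub>B\<close>, with \<open>m p a\<close> the action of \<open>a\<close> on a tensor factor \<open>p\<close>; thus \<open>m\<close> is the product of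
  \<open>A\<close> for \<open>\<Delta>\<^sub>C\<close> and the opposite product for \<open>\<Delta>\<^sub>B\<close>.  The maps \<open>r'\<close> and \<open>l'\<close> transport the actions \<open>r\<close> and \<open>l\<close>
  across \<open>m\<close>.\<close>

locale comultiplication =
  fixes D :: "'d set" and r l r' l' :: "'d \<Rightarrow> 'a \<Rightarrow> 'a::complex_space" and m :: "'a \<Rightarrow> 'a \<Rightarrow> 'a"
    and N :: "('a \<times> 'a \<Rightarrow>\<^sub>0 complex) set"
    and \<Delta> :: "'a \<Rightarrow> ('a \<times> 'a \<Rightarrow>\<^sub>0 complex) set \<Rightarrow> ('a \<times> 'a \<Rightarrow>\<^sub>0 complex) set"
  assumes N: "N = tensor_rel UNIV UNIV D r l"
    and m_bilin: "bilin m"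
    and m_assoc: "m p (m q b) = m (m p q) b"
    and m_r: "d \<in> D \<Longrightarrow> m (r d p) a = r d (m p a)"
    and m_l: "d \<in> D \<Longrightarrow> m (l d p) a = l d (m p a)"
    and m_r': "d \<in> D \<Longrightarrow> m p (r d a) = m (r' d p) a"
    and m_l': "d \<in> D \<Longrightarrow> m p (l d a) = m (l' d p) a"
    and nondegenerate1: "X \<in> qspace N \<Longrightarrow> (\<And>a. tmap N id (\<lambda>q. m q a) X = qzero N) \<Longrightarrow> X = qzero N"
    and nondegenerate2: "X \<in> qspace N \<Longrightarrow> (\<And>a. tmap N (\<lambda>p. m p a) id X = qzero N) \<Longrightarrow> X = qzero N"
    and takeuchi: "\<Delta> a \<in> takeuchi N m"
    and add: "X \<in> qspace N \<Longrightarrow> \<Delta> (a + b) X = qadd N (\<Delta> a X) (\<Delta> b X)"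
    and scale: "X \<in> qspace N \<Longrightarrow> \<Delta> (z *\<^sub>C a) X = qscale N z (\<Delta> a X)"
    and mult: "X \<in> qspace N \<Longrightarrow> \<Delta> (m a b) X = \<Delta> a (\<Delta> b X)"
begin

abbreviation bal :: "('a \<Rightarrow> 'a \<Rightarrow> complex) \<Rightarrow> bool"
  where "bal \<equiv> balanced D r l"

text \<open>The matrix coefficients of the endomorphism \<open>\<Delta>(x)\<close>.  Working with them replaces cosets by complex numbers.\<close>

definition value_form :: "('a \<Rightarrow> 'a \<Rightarrow> complex) \<Rightarrow> 'a \<Rightarrow> 'a \<Rightarrow> 'a \<Rightarrow> complex"
  where "value_form f x p q = slice f (\<Delta> x (coset N (tens (p, q))))"

definition leg1 :: "'a \<Rightarrow> 'a \<Rightarrow> ('a \<times> 'a) list"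
  where "leg1 x a = trep N (first_leg N m (\<Delta> x) a)"

definition leg2 :: "'a \<Rightarrow> 'a \<Rightarrow> ('a \<times> 'a) list"
  where "leg2 x a = trep N (second_leg N m (\<Delta> x) a)"

lemma subspace_N: "csubspace N"
  by (rule tensor_rel_subspace[OF N])

lemma Delta_qspace: "X \<in> qspace N \<Longrightarrow> \<Delta> x X \<in> qspace N"
  using takeuchi by (auto simp: takeuchi_def qend_def)

lemma value_form_balanced_slice:
  assumes f: "bal f"
  shows "bal (value_form f x)" and "X \<in> qspace N \<Longrightarrow> slice f (\<Delta> x X) = slice (value_form f x) X"
proof -
  let ?g = "\<lambda>u. slice f (\<Delta> x (coset N u))"
  have T: "\<Delta> x \<in> qend N" using takeuchi by (simp add: takeuchi_def)
  have g: "clinear ?g"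
  proof (unfold clinear_iff, intro conjI allI)
    fix u v
    have "?g (u + v) = slice f (\<Delta> x (qadd N (coset N u) (coset N v)))"
      by (simp add: coset_plus[OF subspace_N])
    also have "\<dots> = ?g u + ?g v"
      using T f by (simp add: qend_def slice_qadd[OF N] tclass_in_qspace[OF N])
    finally show "?g (u + v) = ?g u + ?g v" .
    fix c
    have "?g (c *\<^sub>C u) = slice f (\<Delta> x (qscale N c (coset N u)))"
      by (simp add: coset_scale[OF subspace_N])
    also have "\<dots> = c *\<^sub>C ?g u"
      using T f by (simp add: qend_def slice_qscale[OF N] tclass_in_qspace[OF N])
    finally show "?g (c *\<^sub>C u) = c *\<^sub>C ?g u" .
  qed
  have g0: "?g v = 0" if "v \<in> N" for v
  proof -
    have "coset N v = coset N 0" using that by (simp add: coset_eq_iff[OF subspace_N])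
    then have "?g v = ?g 0" by simp
    then show ?thesis by (simp add: clinear_zero[OF g])
  qed
  show bal: "bal (value_form f x)"
    using functional_balanced[OF N g g0] by (simp add: value_form_def[abs_def])
  have tens: "case_prod (value_form f x) = (\<lambda>z. ?g (tens z))"
    by (rule ext) (simp add: value_form_def split_paired_all)
  have "?g u = slice (value_form f x) (coset N u)" for u
    unfolding slice_coset[OF N bal] tens by (rule clinear_linext[OF g])
  then show "X \<in> qspace N \<Longrightarrow> slice f (\<Delta> x X) = slice (value_form f x) X"
    by (auto simp: qspace_def)
qed

lemma bal_maps:
  assumes f: "bal f"
  shows "bal (\<lambda>p q. f p (m q b))" "bal (\<lambda>p q. f (m p b) q)"
  using balancedD[OF f] m_bilin by (auto simp: balanced_def bilin_def m_l m_r)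

lemma slice_tmap:
  assumes f: "bal f" and fgh: "bal (\<lambda>p q. f (g p) (h q))"
    and X: "X \<in> qspace N"
  shows "slice f (tmap N g h X) = slice (\<lambda>p q. f (g p) (h q)) X"
proof -
  have "slice f (tmap N g h X) = linext (case_prod f) (slice (\<lambda>a b. tens (g a, h b)) X)"
    by (simp add: tmap_def slice_coset[OF N f])
  also have "\<dots> = slice (\<lambda>p q. f (g p) (h q)) X"
    by (simp add: slice_clinear[OF linext_clinear] linext_tens)
  finally show ?thesis .
qed

lemma tmap_in: "tmap N g h X \<in> qspace N"
  by (simp add: tmap_def tclass_in_qspace[OF N])

lemma difference_qspace:
  assumes "X \<in> qspace N" "Y \<in> qspace N" "bal f"
  shows "slice f (qadd N X (qscale N (-1) Y)) = slice f X - slice f Y"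
  using assms by (simp add: slice_qadd[OF N] slice_qscale[OF N] qadd_in_qspace[OF N] scaleC_complex_def)

text \<open>Nondegeneracy of the tensor product, applied to the difference \<open>X - Y\<close>.\<close>

lemma separate1:
  assumes X: "X \<in> qspace N" and Y: "Y \<in> qspace N"
    and eq: "\<And>f c. bal f \<Longrightarrow> slice (\<lambda>p q. f p (m q c)) X = slice (\<lambda>p q. f p (m q c)) Y"
  shows "X = Y"
proof -
  let ?Z = "qadd N X (qscale N (-1) Y)"
  have Z: "?Z \<in> qspace N" by (rule qadd_in_qspace[OF N])
  have "?Z = qzero N"
  proof (rule nondegenerate1[OF Z], rule qspace_eqI[OF N tmap_in qadd_in_qspace(3)[OF N]])
    fix f :: "'a \<Rightarrow> 'a \<Rightarrow> complex" and a assume f: "bal f"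
    have "slice f (tmap N id (\<lambda>q. m q a) ?Z) = slice (\<lambda>p q. f p (m q a)) ?Z"
      using slice_tmap[OF f _ Z, of id "\<lambda>q. m q a"] bal_maps(1)[OF f] by simp
    also have "\<dots> = 0" by (simp add: difference_qspace[OF X Y bal_maps(1)[OF f]] eq[OF f])
    finally show "slice f (tmap N id (\<lambda>q. m q a) ?Z) = slice f (qzero N)"
      by (simp add: slice_qzero[OF N f])
  qed
  then have "slice f X = slice f Y" if "bal f" for f
    using difference_qspace[OF X Y that] slice_qzero[OF N that] by simp
  then show ?thesis by (rule qspace_eqI[OF N X Y])
qed

lemma separate2:
  assumes X: "X \<in> qspace N" and Y: "Y \<in> qspace N"
    and eq: "\<And>f c. bal f \<Longrightarrow> slice (\<lambda>p q. f (m p c) q) X = slice (\<lambda>p q. f (m p c) q) Y"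
  shows "X = Y"
proof -
  let ?Z = "qadd N X (qscale N (-1) Y)"
  have Z: "?Z \<in> qspace N" by (rule qadd_in_qspace[OF N])
  have "?Z = qzero N"
  proof (rule nondegenerate2[OF Z], rule qspace_eqI[OF N tmap_in qadd_in_qspace(3)[OF N]])
    fix f :: "'a \<Rightarrow> 'a \<Rightarrow> complex" and a assume f: "bal f"
    have "slice f (tmap N (\<lambda>p. m p a) id ?Z) = slice (\<lambda>p q. f (m p a) q) ?Z"
      using slice_tmap[OF f _ Z, of "\<lambda>p. m p a" id] bal_maps(2)[OF f] by simp
    also have "\<dots> = 0" by (simp add: difference_qspace[OF X Y bal_maps(2)[OF f]] eq[OF f])
    finally show "slice f (tmap N (\<lambda>p. m p a) id ?Z) = slice f (qzero N)"
      by (simp add: slice_qzero[OF N f])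
  qed
  then have "slice f X = slice f Y" if "bal f" for f
    using difference_qspace[OF X Y that] slice_qzero[OF N that] by simp
  then show ?thesis by (rule qspace_eqI[OF N X Y])
qed

lemma separate_lists1:
  assumes "\<And>f c. bal f \<Longrightarrow> tsum (\<lambda>p q. f p (m q c)) xs = tsum (\<lambda>p q. f p (m q c)) ys" "bal f"
  shows "tsum f xs = tsum f ys"
proof -
  have "tclass N xs = tclass N ys"
    by (rule separate1) (simp_all add: tclass_in_qspace[OF N] slice_tclass[OF N bal_maps(1)] assms(1))
  then show ?thesis using slice_tclass[OF N assms(2)] by metis
qed

lemma separate_lists2:
  assumes "\<And>f c. bal f \<Longrightarrow> tsum (\<lambda>p q. f (m p c) q) xs = tsum (\<lambda>p q. f (m p c) q) ys" "bal f"
  shows "tsum f xs = tsum f ys"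
proof -
  have "tclass N xs = tclass N ys"
    by (rule separate2) (simp_all add: tclass_in_qspace[OF N] slice_tclass[OF N bal_maps(2)] assms(1))
  then show ?thesis using slice_tclass[OF N assms(2)] by metis
qed

lemma first_leg_props:
  "first_leg N m (\<Delta> x) a \<in> qspace N"
  "\<Delta> x (coset N (tens (a, b))) = tmap N id (\<lambda>q. m q b) (first_leg N m (\<Delta> x) a)"
proof -
  let ?P = "\<lambda>X. X \<in> qspace N \<and> (\<forall>b. \<Delta> x (coset N (tens (a, b))) = tmap N id (\<lambda>q. m q b) X)"
  have "\<exists>X. ?P X" using takeuchi[of x] unfolding takeuchi_def by blast
  moreover have "X = Y" if "?P X" "?P Y" for X Y
  proof (rule separate1)
    show XY: "X \<in> qspace N" "Y \<in> qspace N" using that by auto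
    fix f :: "'a \<Rightarrow> 'a \<Rightarrow> complex" and c assume f: "bal f"
    have "tmap N id (\<lambda>q. m q c) X = tmap N id (\<lambda>q. m q c) Y" using that by metis
    then show "slice (\<lambda>p q. f p (m q c)) X = slice (\<lambda>p q. f p (m q c)) Y"
      using slice_tmap[OF f _ XY(1), of id "\<lambda>q. m q c"] slice_tmap[OF f _ XY(2), of id "\<lambda>q. m q c"]
        bal_maps(1)[OF f] by simp
  qed
  ultimately have "\<exists>!X. ?P X" by blast
  from theI'[OF this] show "first_leg N m (\<Delta> x) a \<in> qspace N"
    "\<Delta> x (coset N (tens (a, b))) = tmap N id (\<lambda>q. m q b) (first_leg N m (\<Delta> x) a)"
    unfolding first_leg_def by blast+
qed

lemma second_leg_props:
  "second_leg N m (\<Delta> x) b \<in> qspace N"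
  "\<Delta> x (coset N (tens (a, b))) = tmap N (\<lambda>p. m p a) id (second_leg N m (\<Delta> x) b)"
proof -
  let ?P = "\<lambda>X. X \<in> qspace N \<and> (\<forall>a. \<Delta> x (coset N (tens (a, b))) = tmap N (\<lambda>p. m p a) id X)"
  have "\<exists>X. ?P X" using takeuchi[of x] unfolding takeuchi_def by blast
  moreover have "X = Y" if "?P X" "?P Y" for X Y
  proof (rule separate2)
    show XY: "X \<in> qspace N" "Y \<in> qspace N" using that by auto
    fix f :: "'a \<Rightarrow> 'a \<Rightarrow> complex" and c assume f: "bal f"
    have "tmap N (\<lambda>p. m p c) id X = tmap N (\<lambda>p. m p c) id Y" using that by metis
    then show "slice (\<lambda>p q. f (m p c) q) X = slice (\<lambda>p q. f (m p c) q) Y"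
      using slice_tmap[OF f _ XY(1), of "\<lambda>q. m q c" id] slice_tmap[OF f _ XY(2), of "\<lambda>q. m q c" id]
        bal_maps(2)[OF f] by simp
  qed
  ultimately have "\<exists>!X. ?P X" by blast
  from theI'[OF this] show "second_leg N m (\<Delta> x) b \<in> qspace N"
    "\<Delta> x (coset N (tens (a, b))) = tmap N (\<lambda>p. m p a) id (second_leg N m (\<Delta> x) b)"
    unfolding second_leg_def by blast+
qed

lemma slice_first_leg: "balanced D r l f \<Longrightarrow> slice f (first_leg N m (\<Delta> x) a) = tsum f (leg1 x a)"
  by (simp add: leg1_def tsum_trep[OF N first_leg_props(1)])

lemma slice_second_leg: "balanced D r l f \<Longrightarrow> slice f (second_leg N m (\<Delta> x) a) = tsum f (leg2 x a)"
  by (simp add: leg2_def tsum_trep[OF N second_leg_props(1)])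

lemma value_form_leg1: "bal f \<Longrightarrow> value_form f x a b = tsum (\<lambda>p q. f p (m q b)) (leg1 x a)"
  using slice_tmap[of f id "\<lambda>q. m q b", OF _ _ first_leg_props(1)] bal_maps(1)[of f b]
  by (simp add: value_form_def first_leg_props(2) slice_first_leg[symmetric])

lemma value_form_leg2: "bal f \<Longrightarrow> value_form f x a b = tsum (\<lambda>p q. f (m p a) q) (leg2 x b)"
  using slice_tmap[of f "\<lambda>p. m p a" id, OF _ _ second_leg_props(1)] bal_maps(2)[of f a]
  by (simp add: value_form_def second_leg_props(2) slice_second_leg[symmetric])

lemma legs_rel:
  "bal f \<Longrightarrow> tsum (\<lambda>p q. f p (m q b)) (leg1 x a) = tsum (\<lambda>p q. f (m p a) q) (leg2 x b)"
  using value_form_leg1 value_form_leg2 by metis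

text \<open>The leg \<open>\<Delta>(x)(a \<otimes> 1)\<close> is the only tensor that gives \<open>\<Delta>(x)(a \<otimes> b)\<close> after multiplication by \<open>1 \<otimes> b\<close>.  All rules for
  legs below are obtained by exhibiting such a tensor as a list.\<close>

lemma leg1_eqI:
  assumes "\<And>f b. bal f \<Longrightarrow> value_form f x a b = tsum (\<lambda>p q. f p (m q b)) xs" "bal f"
  shows "tsum f (leg1 x a) = tsum f xs"
  by (rule separate_lists1[OF _ assms(2)]) (simp add: value_form_leg1[symmetric] assms(1))

lemma leg2_eqI:
  assumes "\<And>f a. bal f \<Longrightarrow> value_form f x a b = tsum (\<lambda>p q. f (m p a) q) xs" "bal f"
  shows "tsum f (leg2 x b) = tsum f xs"
  by (rule separate_lists2[OF _ assms(2)]) (simp add: value_form_leg2[symmetric] assms(1))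

lemma value_form_add: "bal f \<Longrightarrow> value_form f (x + y) p q = value_form f x p q + value_form f y p q"
  and value_form_scale: "bal f \<Longrightarrow> value_form f (c *\<^sub>C x) p q = c *\<^sub>C value_form f x p q"
  by (simp_all add: value_form_def add scale slice_qadd[OF N] slice_qscale[OF N] Delta_qspace tclass_in_qspace[OF N])

lemma scaled_list:
  "bal f \<Longrightarrow> tsum (\<lambda>p q. f (c *\<^sub>C p) q) xs = c *\<^sub>C tsum f xs"
  "bal f \<Longrightarrow> tsum (\<lambda>p q. f p (c *\<^sub>C q)) xs = c *\<^sub>C tsum f xs"
  by (simp_all add: balancedD tsum_scale)

lemma leg1_bilin: assumes f: "bal f" shows "bilin (\<lambda>x a. tsum f (leg1 x a))"
proof -
  note V = balancedD[OF value_form_balanced_slice(1)]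
  have "tsum f (leg1 (x + y) a) = tsum f (leg1 x a @ leg1 y a)" for x y a
    by (rule leg1_eqI[OF _ f]) (simp add: value_form_leg1[symmetric] value_form_add)
  moreover have "tsum f (leg1 x (a + b)) = tsum f (leg1 x a @ leg1 x b)" for x a b
    by (rule leg1_eqI[OF _ f]) (simp add: value_form_leg1[symmetric] V)
  moreover have "tsum f (leg1 (c *\<^sub>C x) a) = tsum f (map (map_prod (scaleC c) id) (leg1 x a))" for c x a
    by (rule leg1_eqI[OF _ f])
      (simp add: tsum_map scaled_list[OF bal_maps(1)] value_form_leg1[symmetric] value_form_scale)
  moreover have "tsum f (leg1 x (c *\<^sub>C a)) = tsum f (map (map_prod (scaleC c) id) (leg1 x a))" for c x a
    by (rule leg1_eqI[OF _ f])
      (simp add: tsum_map scaled_list[OF bal_maps(1)] value_form_leg1[symmetric] V)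
  ultimately show ?thesis using f by (simp add: bilin_def tsum_map scaled_list)
qed

lemma leg2_bilin: assumes f: "bal f" shows "bilin (\<lambda>x a. tsum f (leg2 x a))"
proof -
  note V = balancedD[OF value_form_balanced_slice(1)]
  have "tsum f (leg2 (x + y) a) = tsum f (leg2 x a @ leg2 y a)" for x y a
    by (rule leg2_eqI[OF _ f]) (simp add: value_form_leg2[symmetric] value_form_add)
  moreover have "tsum f (leg2 x (a + b)) = tsum f (leg2 x a @ leg2 x b)" for x a b
    by (rule leg2_eqI[OF _ f]) (simp add: value_form_leg2[symmetric] V)
  moreover have "tsum f (leg2 (c *\<^sub>C x) a) = tsum f (map (map_prod id (scaleC c)) (leg2 x a))" for c x a
    by (rule leg2_eqI[OF _ f])
      (simp add: tsum_map scaled_list[OF bal_maps(2)] value_form_leg2[symmetric] value_form_scale)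
  moreover have "tsum f (leg2 x (c *\<^sub>C a)) = tsum f (map (map_prod id (scaleC c)) (leg2 x a))" for c x a
    by (rule leg2_eqI[OF _ f])
      (simp add: tsum_map scaled_list[OF bal_maps(2)] value_form_leg2[symmetric] V)
  ultimately show ?thesis using f by (simp add: bilin_def tsum_map scaled_list)
qed

lemma value_form_mult: "bal f \<Longrightarrow> value_form f (m x y) p q = value_form (value_form f x) y p q"
  by (simp add: value_form_def[of f "m x y"] value_form_def[of _ y] mult tclass_in_qspace[OF N]
      value_form_balanced_slice(2) Delta_qspace)

lemma leg1_mult: assumes f: "bal f"
  shows "tsum f (leg1 (m x y) a) = tsum (\<lambda>p q. tsum (\<lambda>r s. f r (m s q)) (leg1 x p)) (leg1 y a)"
proof -
  have "tsum f (leg1 (m x y) a) =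
      tsum f (concat (map (\<lambda>(p, q). map (map_prod id (\<lambda>s. m s q)) (leg1 x p)) (leg1 y a)))"
    by (rule leg1_eqI[OF _ f], subst value_form_mult, assumption)
      (simp add: value_form_leg1 value_form_balanced_slice(1) tsum_concat tsum_map m_assoc)
  then show ?thesis by (simp add: tsum_concat tsum_map)
qed

lemma leg2_mult: assumes f: "bal f"
  shows "tsum f (leg2 (m x y) b) = tsum (\<lambda>p q. tsum (\<lambda>r s. f (m r p) s) (leg2 x q)) (leg2 y b)"
proof -
  have "tsum f (leg2 (m x y) b) =
      tsum f (concat (map (\<lambda>(p, q). map (map_prod (\<lambda>r. m r p) id) (leg2 x q)) (leg2 y b)))"
    by (rule leg2_eqI[OF _ f], subst value_form_mult, assumption)
      (simp add: value_form_leg2 value_form_balanced_slice(1) tsum_concat tsum_map m_assoc)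
  then show ?thesis by (simp add: tsum_concat tsum_map)
qed

lemma leg1_r: assumes f: "bal f" and d: "d \<in> D"
  shows "tsum f (leg1 x (r d a)) = tsum (\<lambda>p q. f p (l' d q)) (leg1 x a)"
proof -
  have "tsum f (leg1 x (r d a)) = tsum f (map (map_prod id (l' d)) (leg1 x a))"
    by (rule leg1_eqI[OF _ f], subst balancedD(5)[OF value_form_balanced_slice(1) d], assumption)
      (simp add: d value_form_leg1 tsum_map m_l')
  then show ?thesis by (simp add: tsum_map)
qed

lemma leg2_l: assumes f: "bal f" and d: "d \<in> D"
  shows "tsum f (leg2 x (l d b)) = tsum (\<lambda>p q. f (r' d p) q) (leg2 x b)"
proof -
  have "tsum f (leg2 x (l d b)) = tsum f (map (map_prod (r' d) id) (leg2 x b))"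
    by (rule leg2_eqI[OF _ f], subst balancedD(5)[OF value_form_balanced_slice(1) d, symmetric], assumption)
      (simp add: d value_form_leg2 tsum_map m_r')
  then show ?thesis by (simp add: tsum_map)
qed

lemma leg1_module:
  assumes "\<And>f p q. bal f \<Longrightarrow> value_form f x' p q = value_form f x p (k q)"
    and "\<And>q b. m q (k b) = m (k' q) b" and f: "bal f"
  shows "tsum f (leg1 x' a) = tsum (\<lambda>p q. f p (k' q)) (leg1 x a)"
proof -
  have "tsum f (leg1 x' a) = tsum f (map (map_prod id k') (leg1 x a))"
    by (rule leg1_eqI[OF _ f], subst assms(1), assumption) (simp add: assms(2) value_form_leg1 tsum_map)
  then show ?thesis by (simp add: tsum_map)
qed

lemma leg2_module:
  assumes "\<And>f p q. bal f \<Longrightarrow> value_form f x' p q = value_form f x (k p) q"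
    and "\<And>q b. m q (k b) = m (k' q) b" and f: "bal f"
  shows "tsum f (leg2 x' a) = tsum (\<lambda>p q. f (k' p) q) (leg2 x a)"
proof -
  have "tsum f (leg2 x' a) = tsum f (map (map_prod k' id) (leg2 x a))"
    by (rule leg2_eqI[OF _ f], subst assms(1), assumption) (simp add: assms(2) value_form_leg2 tsum_map)
  then show ?thesis by (simp add: tsum_map)
qed

end

section \<open>Multiplier bialgebroids in terms of lists\<close>

lemma lact_mult: "(m * n) \<rightharpoonup> a = m \<rightharpoonup> (n \<rightharpoonup> a)" for a :: "'a::complex_alg"
  by transfer auto

lemma ract_mult: "a \<leftharpoonup> (m * n) = (a \<leftharpoonup> m) \<leftharpoonup> n" for a :: "'a::complex_alg"
  by transfer auto

lemma lact_times: "m \<rightharpoonup> (a * b) = (m \<rightharpoonup> a) * b" for a :: "'a::complex_alg"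
  by transfer auto

lemma ract_times: "(a * b) \<leftharpoonup> m = a * (b \<leftharpoonup> m)" for a :: "'a::complex_alg"
  by transfer auto

lemma ract_times_lact: "(a \<leftharpoonup> m) * b = a * (m \<rightharpoonup> b)" for a :: "'a::complex_alg"
  by transfer auto

lemma bilin_lact: "bilin (lact :: 'a::complex_alg multiplier \<Rightarrow> _)"
  unfolding bilin_def by (intro conjI allI; transfer) (auto simp: clinear_iff)

lemma bilin_ract: "bilin (\<lambda>m a. a \<leftharpoonup> (m :: 'a::complex_alg multiplier))"
  unfolding bilin_def by (intro conjI allI; transfer) (auto simp: clinear_iff)

lemma multiplier_eqI: "(\<And>a. m \<rightharpoonup> a = n \<rightharpoonup> a) \<Longrightarrow> (\<And>a. a \<leftharpoonup> m = a \<leftharpoonup> n) \<Longrightarrow> m = (n :: 'a::complex_alg multiplier)"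
  by transfer (auto simp: fun_eq_iff)

lemma bilin_times: "bilin ((*) :: 'a::complex_alg \<Rightarrow> _)" "bilin (\<lambda>p a :: 'a::complex_alg. a * p)"
  by (simp_all add: bilin_def algebra_simps scaleC_mult_left scaleC_mult_right)

lemmas act_linear = bilin_lact[unfolded bilin_def, THEN conjunct1, rule_format]
  bilin_lact[unfolded bilin_def, THEN conjunct2, THEN conjunct1, rule_format]
  bilin_lact[unfolded bilin_def, THEN conjunct2, THEN conjunct2, THEN conjunct1, rule_format]
  bilin_lact[unfolded bilin_def, THEN conjunct2, THEN conjunct2, THEN conjunct2, rule_format]
  bilin_ract[unfolded bilin_def, THEN conjunct1, rule_format]
  bilin_ract[unfolded bilin_def, THEN conjunct2, THEN conjunct1, rule_format]
  bilin_ract[unfolded bilin_def, THEN conjunct2, THEN conjunct2, THEN conjunct1, rule_format]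
  bilin_ract[unfolded bilin_def, THEN conjunct2, THEN conjunct2, THEN conjunct2, rule_format]

lemma idempotent_mod_induct:
  assumes "idempotent_mod D r" "csubspace V" "\<And>d a. d \<in> D \<Longrightarrow> r d a \<in> V"
  shows "a \<in> V"
proof -
  have "cspan {r d m |d m. d \<in> D} \<subseteq> V"
    by (rule complex_space.span_minimal) (use assms in auto)
  then show ?thesis using assms(1) by (auto simp: idempotent_mod_def)
qed

lemma subspace_preimage: "clinear f \<Longrightarrow> csubspace V \<Longrightarrow> csubspace {a. f a \<in> V}"
  by (rule complex_space.subspaceI)
    (auto simp: clinear_zero clinear_add clinear_scale complex_space.subspace_0 complex_space.subspace_add complex_space.subspace_scale)

lemma tensor3_vanishes:
  assumes g: "balanced3 D r l E r' l' g" and u: "u \<in> tensor3_rel D r l E r' l'"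
  shows "linext (\<lambda>(p, q, s). g p q s) u = 0"
proof -
  let ?g = "linext (\<lambda>(p, q, s). g p q s)"
  have lin: "clinear ?g" by (rule linext_clinear)
  have g': "balanced D r l (\<lambda>u p. g u p q)" "balanced E r' l' (g p)" for p q
    using g by (auto simp: balanced3_def)
  have "tensor3_rel D r l E r' l' \<subseteq> {v. ?g v = 0}"
    unfolding tensor3_rel_def
  proof (rule complex_space.span_minimal)
    show "csubspace {v. ?g v = 0}"
      by (rule complex_space.subspaceI) (simp_all add: clinear_zero clinear_add clinear_scale lin)
  qed (auto simp: clinear_diff[OF lin] clinear_scale[OF lin] linext_tens balancedD[OF g'(1)] balancedD[OF g'(2)])
  with u show ?thesis by blast
qed

text \<open>Evaluating a trilinear balanced form turns an equation between the threefold tensors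
  \<open>(T \<otimes> \<iota>)(X)\<close> and \<open>(\<iota> \<otimes> T')(X')\<close> into one between iterated slices.\<close>

lemma leg_values:
  fixes g :: "'a::complex_space \<Rightarrow> 'a \<Rightarrow> 'a \<Rightarrow> complex"
  assumes g: "balanced3 D r l E r' l' g" and N: "N = tensor3_rel D r l E r' l'"
    and eq: "leg12 N T X = leg23 N T' X'"
  shows "slice (\<lambda>d s. slice (\<lambda>p q. g p q s) (T d)) X = slice (\<lambda>p d. slice (\<lambda>q s. g p q s) (T' d)) X'"
proof -
  let ?h = "linext (\<lambda>(p, q, s). g p q s)"
  have h: "clinear ?h" by (rule linext_clinear)
  have N': "csubspace N" by (simp add: N tensor3_rel_def complex_space.subspace_span)
  let ?u = "slice (\<lambda>d c. slice (\<lambda>p q. tens (p, q, c)) (T d)) X"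
  let ?v = "slice (\<lambda>a d. slice (\<lambda>p q. tens (a, p, q)) (T' d)) X'"
  have "?u - ?v \<in> N"
    using eq by (simp add: leg12_def leg23_def coset_eq_iff[OF N'])
  then have "?h ?u = ?h ?v"
    using tensor3_vanishes[OF g] clinear_diff[OF h, of ?u ?v] by (simp add: N)
  then show ?thesis by (simp add: slice_clinear[OF h] linext_tens)
qed

context multiplier_bialgebroid
begin

lemma mult_cancel: "(\<And>b. a * b = a' * b) \<Longrightarrow> a = a'" "(\<And>b. b * a = b * a') \<Longrightarrow> a = a'" for a a' :: 'a
  using nondegenerate unfolding nondegenerate_alg_def
  by (metis left_diff_distrib right_minus_eq, metis right_diff_distrib right_minus_eq)

lemma lact_ract: "m \<rightharpoonup> (a \<leftharpoonup> n) = (m \<rightharpoonup> a) \<leftharpoonup> n" for a :: 'a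
  by (rule mult_cancel(1)) (simp add: ract_times_lact lact_times[symmetric])

lemma lact_faithful: "(\<And>a. m \<rightharpoonup> a = 0) \<Longrightarrow> m = (0 :: 'a multiplier)"
proof (rule multiplier_eqI)
  assume m: "\<And>a. m \<rightharpoonup> a = 0"
  have z: "0 \<rightharpoonup> a = 0" "a \<leftharpoonup> 0 = 0" for a :: 'a by (transfer, simp)+
  show "m \<rightharpoonup> a = 0 \<rightharpoonup> a" for a by (simp add: m z)
  have "(a \<leftharpoonup> m) * b = 0 * b" for a b by (simp add: ract_times_lact m)
  then show "a \<leftharpoonup> m = a \<leftharpoonup> 0" for a using mult_cancel(1) z by metis
qed

lemma ract_faithful: "(\<And>a. a \<leftharpoonup> m = 0) \<Longrightarrow> m = (0 :: 'a multiplier)"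
proof (rule multiplier_eqI)
  assume m: "\<And>a. a \<leftharpoonup> m = 0"
  have z: "0 \<rightharpoonup> a = 0" "a \<leftharpoonup> 0 = 0" for a :: 'a by (transfer, simp)+
  show "a \<leftharpoonup> m = a \<leftharpoonup> 0" for a by (simp add: m z)
  have "b * (m \<rightharpoonup> a) = b * 0" for a b by (simp add: ract_times_lact[symmetric] m)
  then show "m \<rightharpoonup> a = 0 \<rightharpoonup> a" for a using mult_cancel(2) z by metis
qed

lemma tC_props: "y \<in> baseC \<A> \<Longrightarrow> tC \<A> y \<in> baseB \<A>" "clinear_on (baseC \<A>) (tC \<A>)"
    "y \<in> baseC \<A> \<Longrightarrow> y' \<in> baseC \<A> \<Longrightarrow> tC \<A> (y * y') = tC \<A> y' * tC \<A> y"
    "bij_betw (tC \<A>) (baseC \<A>) (baseB \<A>)"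
  using anti_iso_tC by (auto simp: anti_iso_def bij_betw_def)

lemma tB_props: "x \<in> baseB \<A> \<Longrightarrow> tB \<A> x \<in> baseC \<A>" "clinear_on (baseB \<A>) (tB \<A>)"
    "x \<in> baseB \<A> \<Longrightarrow> x' \<in> baseB \<A> \<Longrightarrow> tB \<A> (x * x') = tB \<A> x' * tB \<A> x"
    "bij_betw (tB \<A>) (baseB \<A>) (baseC \<A>)"
  using anti_iso_tB by (auto simp: anti_iso_def bij_betw_def)

lemma base_props: "csubspace (baseB \<A>)" "csubspace (baseC \<A>)"
  "x \<in> baseB \<A> \<Longrightarrow> x' \<in> baseB \<A> \<Longrightarrow> x * x' \<in> baseB \<A>"
  "y \<in> baseC \<A> \<Longrightarrow> y' \<in> baseC \<A> \<Longrightarrow> y * y' \<in> baseC \<A>"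
  using subalgebra_B subalgebra_C by (auto simp: subalgebra_def)

lemma commute_acts:
  assumes "x \<in> baseB \<A>" "y \<in> baseC \<A>"
  shows "x \<rightharpoonup> (y \<rightharpoonup> a) = y \<rightharpoonup> (x \<rightharpoonup> a)" "(a \<leftharpoonup> x) \<leftharpoonup> y = (a \<leftharpoonup> y) \<leftharpoonup> x"
  by (simp_all add: lact_mult[symmetric] ract_mult[symmetric] commute[OF assms])

sublocale C: comultiplication "baseC \<A>" "\<lambda>y a. tC \<A> y \<rightharpoonup> a" "\<lambda>y b. y \<rightharpoonup> b"
  "\<lambda>y p. p \<leftharpoonup> tC \<A> y" "\<lambda>y q. q \<leftharpoonup> y" "(*)" "relC \<A>" "DeltaC \<A>"
  by unfold_locales
    (fact relC_def
      | (rule nondegenerate_tensorC DeltaC_takeuchi; assumption?)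
      | simp add: bilin_times mult.assoc lact_times ract_times_lact DeltaC_add DeltaC_scale DeltaC_mult)+

sublocale B: comultiplication "baseB \<A>" "\<lambda>x a. a \<leftharpoonup> x" "\<lambda>x b. b \<leftharpoonup> tB \<A> x"
  "\<lambda>x p. x \<rightharpoonup> p" "\<lambda>x q. tB \<A> x \<rightharpoonup> q" "\<lambda>p a. a * p" "relB \<A>" "DeltaB \<A>"
  by unfold_locales
    (fact relB_def
      | (rule nondegenerate_tensorB DeltaB_takeuchi; assumption?)
      | simp add: bilin_times mult.assoc ract_times ract_times_lact DeltaB_add DeltaB_scale DeltaB_mult)+

lemma legs:
  "DeltaC_first \<A> x a = first_leg (relC \<A>) (*) (DeltaC \<A> x) a"
  "DeltaC_second \<A> x a = second_leg (relC \<A>) (*) (DeltaC \<A> x) a"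
  "DeltaB_first \<A> x a = first_leg (relB \<A>) (\<lambda>p a. a * p) (DeltaB \<A> x) a"
  "DeltaB_second \<A> x a = second_leg (relB \<A>) (\<lambda>p a. a * p) (DeltaB \<A> x) a"
  by (simp_all add: DeltaC_first_def DeltaC_second_def DeltaB_first_def DeltaB_second_def)

text \<open>\<open>BCABC = A\<close>, as the four module structures are idempotent.  The axioms on \<open>\<Delta>(xyax'y')\<close> can therefore be
  specialised to one factor at a time, although \<open>B\<close> and \<open>C\<close> may lack units.\<close>

lemma bimodule_span:
  assumes V: "csubspace V"
    and gen: "\<And>x x' y y' a. x \<in> baseB \<A> \<Longrightarrow> x' \<in> baseB \<A> \<Longrightarrow> y \<in> baseC \<A> \<Longrightarrow> y' \<in> baseC \<A> \<Longrightarrow>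
      x \<rightharpoonup> (y \<rightharpoonup> ((a \<leftharpoonup> x') \<leftharpoonup> y')) \<in> V"
  shows "a \<in> V"
proof (rule idempotent_mod_induct[OF idempotent_B(1) V])
  fix x b assume x: "x \<in> baseB \<A>"
  let ?V1 = "{b. x \<rightharpoonup> b \<in> V}"
  have V1: "csubspace ?V1" by (rule subspace_preimage[OF _ V]) (simp add: clinear_iff act_linear)
  have "b \<in> ?V1"
  proof (rule idempotent_mod_induct[OF idempotent_C(1) V1])
    fix y c assume y: "y \<in> baseC \<A>"
    let ?V2 = "{b. y \<rightharpoonup> b \<in> ?V1}"
    have V2: "csubspace ?V2" by (rule subspace_preimage[OF _ V1]) (simp add: clinear_iff act_linear)
    have "c \<in> ?V2"
    proof (rule idempotent_mod_induct[OF idempotent_C(2) V2])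
      fix y' d assume y': "y' \<in> baseC \<A>"
      let ?V3 = "{b. b \<leftharpoonup> y' \<in> ?V2}"
      have V3: "csubspace ?V3" by (rule subspace_preimage[OF _ V2]) (simp add: clinear_iff act_linear)
      have "d \<in> ?V3"
        by (rule idempotent_mod_induct[OF idempotent_B(2) V3]) (use gen x y y' in simp)
      then show "d \<leftharpoonup> y' \<in> ?V2" by simp
    qed
    then show "y \<rightharpoonup> c \<in> ?V1" by simp
  qed
  then show "x \<rightharpoonup> b \<in> V" by simp
qed

lemma C_tmap_tens:
  assumes "\<And>f :: 'a \<Rightarrow> 'a \<Rightarrow> complex. C.bal f \<Longrightarrow> C.bal (\<lambda>p q. f (g p) (h q))"
  shows "tmap (relC \<A>) g h (coset (relC \<A>) (tens (p, q))) = coset (relC \<A>) (tens (g p, h q))"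
  by (rule qspace_eqI[OF C.N C.tmap_in tclass_in_qspace(2)[OF C.N]])
    (simp add: C.slice_tmap assms tclass_in_qspace[OF C.N] slice_coset[OF C.N] linext_tens)

lemma B_tmap_tens:
  assumes "\<And>f :: 'a \<Rightarrow> 'a \<Rightarrow> complex. B.bal f \<Longrightarrow> B.bal (\<lambda>p q. f (g p) (h q))"
  shows "tmap (relB \<A>) g h (coset (relB \<A>) (tens (p, q))) = coset (relB \<A>) (tens (g p, h q))"
  by (rule qspace_eqI[OF B.N B.tmap_in tclass_in_qspace(2)[OF B.N]])
    (simp add: B.slice_tmap assms tclass_in_qspace[OF B.N] slice_coset[OF B.N] linext_tens)

lemma C_bal_acts:
  assumes f: "C.bal f" and xy: "x \<in> baseB \<A>" "y \<in> baseC \<A>"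
  shows "C.bal (\<lambda>p q. f (y \<rightharpoonup> p) (x \<rightharpoonup> q))"
proof -
  have "y \<rightharpoonup> (tC \<A> z \<rightharpoonup> p) = tC \<A> z \<rightharpoonup> (y \<rightharpoonup> p)" "x \<rightharpoonup> (z \<rightharpoonup> p) = z \<rightharpoonup> (x \<rightharpoonup> p)"
    if "z \<in> baseC \<A>" for z p
    using that commute_acts xy tC_props(1) by metis+
  then show ?thesis using balancedD[OF f] by (simp add: balanced_def bilin_def act_linear)
qed

lemma B_bal_acts:
  assumes f: "B.bal f" and xy: "x \<in> baseB \<A>" "y \<in> baseC \<A>"
  shows "B.bal (\<lambda>p q. f (p \<leftharpoonup> y) (q \<leftharpoonup> x))"
proof -
  have "(p \<leftharpoonup> z) \<leftharpoonup> y = (p \<leftharpoonup> y) \<leftharpoonup> z" "(p \<leftharpoonup> tB \<A> z) \<leftharpoonup> x = (p \<leftharpoonup> x) \<leftharpoonup> tB \<A> z"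
    if "z \<in> baseB \<A>" for z p
    using that commute_acts xy tB_props(1) by metis+
  then show ?thesis using balancedD[OF f] by (simp add: balanced_def bilin_def act_linear)
qed

lemma C_value_bimodule:
  assumes f: "C.bal f" and xy: "x \<in> baseB \<A>" "x' \<in> baseB \<A>" "y \<in> baseC \<A>" "y' \<in> baseC \<A>"
  shows "C.value_form f (x \<rightharpoonup> (y \<rightharpoonup> ((a \<leftharpoonup> x') \<leftharpoonup> y'))) p q =
    C.value_form (\<lambda>p q. f (y \<rightharpoonup> p) (x \<rightharpoonup> q)) a (y' \<rightharpoonup> p) (x' \<rightharpoonup> q)"
  unfolding C.value_form_def
  by (simp add: DeltaC_bimodule xy tclass_in_qspace[OF C.N] C_tmap_tens C_bal_acts
      C.slice_tmap f C.Delta_qspace)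

lemma B_value_bimodule:
  assumes f: "B.bal f" and xy: "x \<in> baseB \<A>" "x' \<in> baseB \<A>" "y \<in> baseC \<A>" "y' \<in> baseC \<A>"
  shows "B.value_form f (x \<rightharpoonup> (y \<rightharpoonup> ((a \<leftharpoonup> x') \<leftharpoonup> y'))) p q =
    B.value_form (\<lambda>p q. f (p \<leftharpoonup> y') (q \<leftharpoonup> x')) a (p \<leftharpoonup> y) (q \<leftharpoonup> x)"
  unfolding B.value_form_def
  by (simp add: DeltaB_bimodule xy tclass_in_qspace[OF B.N] B_tmap_tens B_bal_acts
      B.slice_tmap f B.Delta_qspace)

lemma C_value_ract:
  assumes f: "C.bal f"
  shows "z \<in> baseB \<A> \<Longrightarrow> C.value_form f (a \<leftharpoonup> z) p q = C.value_form f a p (z \<rightharpoonup> q)"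
    and "w \<in> baseC \<A> \<Longrightarrow> C.value_form f (a \<leftharpoonup> w) p q = C.value_form f a (w \<rightharpoonup> p) q"
proof -
  note lin = C.value_form_add[OF f] C.value_form_scale[OF f] act_linear
  have sub: "csubspace {a. C.value_form f (a \<leftharpoonup> z) p q = C.value_form f a (k p) (h q)}" for z k h
    using clinear_zero[of "\<lambda>a. C.value_form f (a \<leftharpoonup> z) p q"] clinear_zero[of "\<lambda>a. C.value_form f a (k p) (h q)"]
    by (intro complex_space.subspaceI) (simp_all add: clinear_iff lin)
  show "C.value_form f (a \<leftharpoonup> z) p q = C.value_form f a p (z \<rightharpoonup> q)" if z: "z \<in> baseB \<A>"
  proof -
    have "a \<in> {a. C.value_form f (a \<leftharpoonup> z) p q = C.value_form f a p (z \<rightharpoonup> q)}"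
    proof (rule bimodule_span[OF sub[of z "\<lambda>p. p" "lact z"]])
      fix x x' y y' a assume xy: "x \<in> baseB \<A>" "x' \<in> baseB \<A>" "y \<in> baseC \<A>" "y' \<in> baseC \<A>"
      have "(x \<rightharpoonup> (y \<rightharpoonup> ((a \<leftharpoonup> x') \<leftharpoonup> y'))) \<leftharpoonup> z = x \<rightharpoonup> (y \<rightharpoonup> ((a \<leftharpoonup> (x' * z)) \<leftharpoonup> y'))"
        using z xy by (simp add: lact_ract[symmetric] ract_mult commute_acts(2)[of z y'])
      then show "x \<rightharpoonup> (y \<rightharpoonup> ((a \<leftharpoonup> x') \<leftharpoonup> y')) \<in> {a. C.value_form f (a \<leftharpoonup> z) p q = C.value_form f a p (z \<rightharpoonup> q)}"
        using xy z by (simp add: C_value_bimodule[OF f] base_props lact_mult)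
    qed
    then show ?thesis by simp
  qed
  show "C.value_form f (a \<leftharpoonup> w) p q = C.value_form f a (w \<rightharpoonup> p) q" if w: "w \<in> baseC \<A>"
  proof -
    have "a \<in> {a. C.value_form f (a \<leftharpoonup> w) p q = C.value_form f a (w \<rightharpoonup> p) q}"
    proof (rule bimodule_span[OF sub[of w "lact w" "\<lambda>p. p"]])
      fix x x' y y' a assume xy: "x \<in> baseB \<A>" "x' \<in> baseB \<A>" "y \<in> baseC \<A>" "y' \<in> baseC \<A>"
      have "(x \<rightharpoonup> (y \<rightharpoonup> ((a \<leftharpoonup> x') \<leftharpoonup> y'))) \<leftharpoonup> w = x \<rightharpoonup> (y \<rightharpoonup> ((a \<leftharpoonup> x') \<leftharpoonup> (y' * w)))"
        by (simp add: lact_ract[symmetric] ract_mult)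
      then show "x \<rightharpoonup> (y \<rightharpoonup> ((a \<leftharpoonup> x') \<leftharpoonup> y')) \<in> {a. C.value_form f (a \<leftharpoonup> w) p q = C.value_form f a (w \<rightharpoonup> p) q}"
        using xy w by (simp add: C_value_bimodule[OF f] base_props lact_mult)
    qed
    then show ?thesis by simp
  qed
qed

lemma B_value_lact:
  assumes f: "B.bal f"
  shows "z \<in> baseB \<A> \<Longrightarrow> B.value_form f (z \<rightharpoonup> a) p q = B.value_form f a p (q \<leftharpoonup> z)"
    and "w \<in> baseC \<A> \<Longrightarrow> B.value_form f (w \<rightharpoonup> a) p q = B.value_form f a (p \<leftharpoonup> w) q"
proof -
  note lin = B.value_form_add[OF f] B.value_form_scale[OF f] act_linear
  have sub: "csubspace {a. B.value_form f (z \<rightharpoonup> a) p q = B.value_form f a (k p) (h q)}" for z k h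
    using clinear_zero[of "\<lambda>a. B.value_form f (z \<rightharpoonup> a) p q"] clinear_zero[of "\<lambda>a. B.value_form f a (k p) (h q)"]
    by (intro complex_space.subspaceI) (simp_all add: clinear_iff lin)
  show "B.value_form f (z \<rightharpoonup> a) p q = B.value_form f a p (q \<leftharpoonup> z)" if z: "z \<in> baseB \<A>"
  proof -
    have "a \<in> {a. B.value_form f (z \<rightharpoonup> a) p q = B.value_form f a p (q \<leftharpoonup> z)}"
    proof (rule bimodule_span[OF sub[of z "\<lambda>p. p" "\<lambda>q. q \<leftharpoonup> z"]])
      fix x x' y y' a assume xy: "x \<in> baseB \<A>" "x' \<in> baseB \<A>" "y \<in> baseC \<A>" "y' \<in> baseC \<A>"
      have "z \<rightharpoonup> (x \<rightharpoonup> (y \<rightharpoonup> ((a \<leftharpoonup> x') \<leftharpoonup> y'))) = (z * x) \<rightharpoonup> (y \<rightharpoonup> ((a \<leftharpoonup> x') \<leftharpoonup> y'))"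
        by (simp add: lact_mult)
      then show "x \<rightharpoonup> (y \<rightharpoonup> ((a \<leftharpoonup> x') \<leftharpoonup> y')) \<in> {a. B.value_form f (z \<rightharpoonup> a) p q = B.value_form f a p (q \<leftharpoonup> z)}"
        using xy z by (simp add: B_value_bimodule[OF f] base_props ract_mult)
    qed
    then show ?thesis by simp
  qed
  show "B.value_form f (w \<rightharpoonup> a) p q = B.value_form f a (p \<leftharpoonup> w) q" if w: "w \<in> baseC \<A>"
  proof -
    have "a \<in> {a. B.value_form f (w \<rightharpoonup> a) p q = B.value_form f a (p \<leftharpoonup> w) q}"
    proof (rule bimodule_span[OF sub[of w "\<lambda>q. q \<leftharpoonup> w" "\<lambda>p. p"]])
      fix x x' y y' a assume xy: "x \<in> baseB \<A>" "x' \<in> baseB \<A>" "y \<in> baseC \<A>" "y' \<in> baseC \<A>"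
      have "w \<rightharpoonup> (x \<rightharpoonup> (y \<rightharpoonup> ((a \<leftharpoonup> x') \<leftharpoonup> y'))) = x \<rightharpoonup> ((w * y) \<rightharpoonup> ((a \<leftharpoonup> x') \<leftharpoonup> y'))"
        using w xy by (simp add: lact_mult commute_acts(1)[of x w])
      then show "x \<rightharpoonup> (y \<rightharpoonup> ((a \<leftharpoonup> x') \<leftharpoonup> y')) \<in> {a. B.value_form f (w \<rightharpoonup> a) p q = B.value_form f a (p \<leftharpoonup> w) q}"
        using xy w by (simp add: B_value_bimodule[OF f] base_props ract_mult)
    qed
    then show ?thesis by simp
  qed
qed

lemma C_legs_ract:
  assumes "C.bal f"
  shows "z \<in> baseB \<A> \<Longrightarrow> tsum f (C.leg1 (a \<leftharpoonup> z) b) = tsum (\<lambda>p q. f p (q \<leftharpoonup> z)) (C.leg1 a b)"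
    and "w \<in> baseC \<A> \<Longrightarrow> tsum f (C.leg2 (a \<leftharpoonup> w) b) = tsum (\<lambda>p q. f (p \<leftharpoonup> w) q) (C.leg2 a b)"
  by (rule C.leg1_module[OF C_value_ract(1) _ assms]; simp add: ract_times_lact)
    (rule C.leg2_module[OF C_value_ract(2) _ assms]; simp add: ract_times_lact)

lemma B_legs_lact:
  assumes "B.bal f"
  shows "z \<in> baseB \<A> \<Longrightarrow> tsum f (B.leg1 (z \<rightharpoonup> a) b) = tsum (\<lambda>p q. f p (z \<rightharpoonup> q)) (B.leg1 a b)"
    and "w \<in> baseC \<A> \<Longrightarrow> tsum f (B.leg2 (w \<rightharpoonup> a) b) = tsum (\<lambda>p q. f (w \<rightharpoonup> p) q) (B.leg2 a b)"
  by (rule B.leg1_module[OF B_value_lact(1) _ assms]; simp add: ract_times_lact)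
    (rule B.leg2_module[OF B_value_lact(2) _ assms]; simp add: ract_times_lact)

text \<open>The module properties of the legs make the inner sums balanced, so that the outer slices can be
  evaluated on representing lists.\<close>

lemma coassoc_BC_lists:
  assumes g: "balanced3 (baseB \<A>) (\<lambda>x a. a \<leftharpoonup> x) (\<lambda>x b. b \<leftharpoonup> tB \<A> x)
    (baseC \<A>) (\<lambda>y a. tC \<A> y \<rightharpoonup> a) (\<lambda>y b. y \<rightharpoonup> b) (g :: 'a \<Rightarrow> 'a \<Rightarrow> 'a \<Rightarrow> complex)"
  shows "tsum (\<lambda>d s. tsum (\<lambda>u v. g u v s) (B.leg1 d a)) (C.leg2 b c) =
    tsum (\<lambda>u d. tsum (\<lambda>p q. g u p q) (C.leg2 d c)) (B.leg1 b a)"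
proof -
  have g': "B.bal (\<lambda>u p. g u p q)" "C.bal (g p)" for p q
    using g by (auto simp: balanced3_def)
  have "C.bal (\<lambda>d s. tsum (\<lambda>u v. g u v s) (B.leg1 d a))"
    using B.leg1_bilin[OF g'(1)] B_legs_lact(1)[OF g'(1)] balancedD[OF g'(2)]
    by (simp add: balanced_def bilin_def tsum_add tsum_scale tC_props)
  moreover have "B.bal (\<lambda>u d. tsum (\<lambda>p q. g u p q) (C.leg2 d c))"
  proof -
    have "g (a + a') = (\<lambda>p q. g a p q + g a' p q)" "g (z *\<^sub>C a) = (\<lambda>p q. z *\<^sub>C g a p q)"
      "d \<in> baseB \<A> \<Longrightarrow> g (a \<leftharpoonup> d) = (\<lambda>p q. g a (p \<leftharpoonup> tB \<A> d) q)" for a a' z d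
      using balancedD[OF g'(1)] by (auto simp: fun_eq_iff)
    then show ?thesis
      using C.leg2_bilin[OF g'(2)] C_legs_ract(2)[OF g'(2)]
      by (simp add: balanced_def bilin_def tsum_add tsum_scale tB_props)
  qed
  ultimately show ?thesis
    using leg_values[OF g relBC_def coassoc_BC[of a b c]]
    by (simp add: legs B.slice_first_leg[OF g'(1)] C.slice_second_leg[OF g'(2)]
        B.slice_first_leg C.slice_second_leg)
qed

lemma coassoc_CB_lists:
  assumes g: "balanced3 (baseC \<A>) (\<lambda>y a. tC \<A> y \<rightharpoonup> a) (\<lambda>y b. y \<rightharpoonup> b)
    (baseB \<A>) (\<lambda>x a. a \<leftharpoonup> x) (\<lambda>x b. b \<leftharpoonup> tB \<A> x) (g :: 'a \<Rightarrow> 'a \<Rightarrow> 'a \<Rightarrow> complex)"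
  shows "tsum (\<lambda>d s. tsum (\<lambda>p q. g p q s) (C.leg1 d a)) (B.leg2 b c) =
    tsum (\<lambda>p d. tsum (\<lambda>q r. g p q r) (B.leg2 d c)) (C.leg1 b a)"
proof -
  have g': "C.bal (\<lambda>u p. g u p q)" "B.bal (g p)" for p q
    using g by (auto simp: balanced3_def)
  have "B.bal (\<lambda>d s. tsum (\<lambda>u v. g u v s) (C.leg1 d a))"
    using C.leg1_bilin[OF g'(1)] C_legs_ract(1)[OF g'(1)] balancedD[OF g'(2)]
    by (simp add: balanced_def bilin_def tsum_add tsum_scale)
  moreover have "C.bal (\<lambda>u d. tsum (\<lambda>p q. g u p q) (B.leg2 d c))"
  proof -
    have "g (a + a') = (\<lambda>p q. g a p q + g a' p q)" "g (z *\<^sub>C a) = (\<lambda>p q. z *\<^sub>C g a p q)"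
      "d \<in> baseC \<A> \<Longrightarrow> g (tC \<A> d \<rightharpoonup> a) = (\<lambda>p q. g a (d \<rightharpoonup> p) q)" for a a' z d
      using balancedD[OF g'(1)] by (auto simp: fun_eq_iff)
    then show ?thesis
      using B.leg2_bilin[OF g'(2)] B_legs_lact(2)[OF g'(2)]
      by (simp add: balanced_def bilin_def tsum_add tsum_scale)
  qed
  ultimately show ?thesis
    using leg_values[OF g relCB_def coassoc_CB[of a b c]]
    by (simp add: legs C.slice_first_leg[OF g'(1)] B.slice_second_leg[OF g'(2)]
        C.slice_first_leg B.slice_second_leg)
qed

end

section \<open>Regular multiplier Hopf algebroids as instances\<close>

context regular_multiplier_Hopf_algebroid
begin

lemma S_props: "bij S" "clinear S" "S (a * b) = S b * S a"
  using antipode by (auto simp: antipode_def anti_iso_def clinear_on_def clinear_iff)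

text \<open>The extension of \<open>S\<close> to a multiplier \<open>m\<close> exists, namely as the pair of maps
  \<open>a \<mapsto> S(S\<^sup>-\<^sup>1(a)m)\<close> and \<open>a \<mapsto> S(mS\<^sup>-\<^sup>1(a))\<close>.\<close>

lemma ext_anti_props:
  "ext_anti S m \<rightharpoonup> S a = S (a \<leftharpoonup> m)" "S a \<leftharpoonup> ext_anti S m = S (m \<rightharpoonup> a)"
proof -
  let ?T = "inv S"
  have ST: "S (?T a) = a" and TS: "?T (S a) = a" for a
    using S_props(1) by (simp_all add: bij_is_surj surj_f_inv_f bij_is_inj)
  have lin: "S (u + v) = S u + S v" "S (c *\<^sub>C u) = c *\<^sub>C S u" for u v c
    using S_props(2) by (simp_all add: clinear_iff)
  have T: "?T (a * b) = ?T b * ?T a" "?T (a + b) = ?T a + ?T b" "?T (c *\<^sub>C a) = c *\<^sub>C ?T a" for a b c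
    using TS[of "?T b * ?T a"] TS[of "?T a + ?T b"] TS[of "c *\<^sub>C ?T a"] by (simp_all add: S_props(3) ST lin)
  let ?L = "\<lambda>a. S (?T a \<leftharpoonup> m)" and ?R = "\<lambda>a. S (m \<rightharpoonup> ?T a)"
  define n where "n = Abs_multiplier (?L, ?R)"
  have mem: "(?L, ?R) \<in> {(L, R). clinear L \<and> clinear R \<and>
     (\<forall>a b. L (a * b) = L a * b \<and> R (a * b) = a * R b \<and> R a * b = a * L b)}"
  proof -
    have "S (m \<rightharpoonup> ?T a) * b = a * S (?T b \<leftharpoonup> m)" for a b
    proof -
      have "S (m \<rightharpoonup> ?T a) * b = S (?T b * (m \<rightharpoonup> ?T a))" by (simp add: S_props(3) ST)
      also have "\<dots> = a * S (?T b \<leftharpoonup> m)" by (simp add: ract_times_lact[symmetric] S_props(3) ST)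
      finally show ?thesis .
    qed
    then show ?thesis
      by (simp add: clinear_iff T lin act_linear ract_times lact_times S_props(3) ST)
  qed
  have Rep: "Rep_multiplier n = (?L, ?R)"
    unfolding n_def by (rule Abs_multiplier_inverse[OF mem])
  have n: "n \<rightharpoonup> a = ?L a" "a \<leftharpoonup> n = ?R a" for a
    by (subst lact.rep_eq, simp add: Rep) (subst ract.rep_eq, simp add: Rep)
  have "ext_anti S m = n"
    unfolding ext_anti_def
  proof (rule the_equality)
    show "\<forall>a. n \<rightharpoonup> S a = S (a \<leftharpoonup> m) \<and> S a \<leftharpoonup> n = S (m \<rightharpoonup> a)"
      by (simp add: n TS)
    fix k assume k: "\<forall>a. k \<rightharpoonup> S a = S (a \<leftharpoonup> m) \<and> S a \<leftharpoonup> k = S (m \<rightharpoonup> a)"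
    show "k = n"
      by (rule multiplier_eqI) (use k ST n in metis)+
  qed
  then show "ext_anti S m \<rightharpoonup> S a = S (a \<leftharpoonup> m)" "S a \<leftharpoonup> ext_anti S m = S (m \<rightharpoonup> a)"
    by (simp_all add: n TS)
qed

lemma ext_anti_B: "x \<in> baseB \<A> \<Longrightarrow> ext_anti S x = inv_into (baseC \<A>) (tC \<A>) x"
  using antipode by (simp add: antipode_def)

lemma ext_anti_tC: "y \<in> baseC \<A> \<Longrightarrow> ext_anti S (tC \<A> y) = y"
  and ext_anti_tB: "x \<in> baseB \<A> \<Longrightarrow> ext_anti S (tB \<A> x) = x"
  using antipode tC_props tB_props by (simp_all add: antipode_def bij_betw_def inv_into_f_f)

lemma S_acts:
  "y \<in> baseC \<A> \<Longrightarrow> S (tC \<A> y \<rightharpoonup> a) = S a \<leftharpoonup> y" "y \<in> baseC \<A> \<Longrightarrow> S (a \<leftharpoonup> tC \<A> y) = y \<rightharpoonup> S a"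
  "x \<in> baseB \<A> \<Longrightarrow> S (tB \<A> x \<rightharpoonup> a) = S a \<leftharpoonup> x" "x \<in> baseB \<A> \<Longrightarrow> S (a \<leftharpoonup> tB \<A> x) = x \<rightharpoonup> S a"
  using ext_anti_props(1)[where m = "tC \<A> y" and a = a] ext_anti_props(2)[where m = "tC \<A> y" and a = a]
    ext_anti_props(1)[where m = "tB \<A> x" and a = a] ext_anti_props(2)[where m = "tB \<A> x" and a = a]
  by (simp_all add: ext_anti_tC ext_anti_tB)

lemma epsC_props: "clinear epsC" "epsC a \<in> baseC \<A>" "y \<in> baseC \<A> \<Longrightarrow> epsC (y \<rightharpoonup> a) = y * epsC a"
    "y \<in> baseC \<A> \<Longrightarrow> epsC (tC \<A> y \<rightharpoonup> a) = epsC a * y"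
  using left_counit by (auto simp: left_counit_def)

lemma epsB_props: "clinear epsB" "epsB a \<in> baseB \<A>" "x \<in> baseB \<A> \<Longrightarrow> epsB (a \<leftharpoonup> x) = epsB a * x"
    "x \<in> baseB \<A> \<Longrightarrow> epsB (a \<leftharpoonup> tB \<A> x) = x * epsB a"
  using right_counit by (auto simp: right_counit_def)

lemmas tC_linear' = tC_props(2)[unfolded clinear_on_def, THEN conjunct1, rule_format]
  tC_props(2)[unfolded clinear_on_def, THEN conjunct2, rule_format]
  tB_props(2)[unfolded clinear_on_def, THEN conjunct1, rule_format]
  tB_props(2)[unfolded clinear_on_def, THEN conjunct2, rule_format]

lemmas S_linear' = S_props(2)[unfolded clinear_iff, THEN conjunct1, rule_format]
  S_props(2)[unfolded clinear_iff, THEN conjunct2, rule_format]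

lemma balanced_slices:
  assumes w: "clinear w" "\<And>a. w a \<in> baseC \<A>" "\<And>y a. y \<in> baseC \<A> \<Longrightarrow> w (y \<rightharpoonup> a) = y * w a"
  shows "balanced (baseC \<A>) (\<lambda>y a. tC \<A> y \<rightharpoonup> a) (\<lambda>y b. y \<rightharpoonup> b) (\<lambda>p q. tC \<A> (w q) \<rightharpoonup> p)"
  by (auto simp: balanced_def bilin_def act_linear w clinear_add[OF w(1)] clinear_scale[OF w(1)]
      tC_linear' tC_props lact_mult)

lemma balanced_slices':
  assumes w: "clinear w" "\<And>a. w a \<in> baseB \<A>" "\<And>y a. y \<in> baseB \<A> \<Longrightarrow> w (a \<leftharpoonup> y) = w a * y"
  shows "balanced (baseB \<A>) (\<lambda>x a. a \<leftharpoonup> x) (\<lambda>x b. b \<leftharpoonup> tB \<A> x) (\<lambda>p q. q \<leftharpoonup> tB \<A> (w p))"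
  by (auto simp: balanced_def bilin_def act_linear w clinear_add[OF w(1)] clinear_scale[OF w(1)]
      tC_linear' tB_props ract_mult)

lemma counit_lists:
  "tsum (\<lambda>p q. epsC p \<rightharpoonup> q) (C.leg2 a b) = a * b"
  "tsum (\<lambda>p q. tC \<A> (epsC q) \<rightharpoonup> p) (C.leg1 a b) = a * b"
  "tsum (\<lambda>p q. q \<leftharpoonup> tB \<A> (epsB p)) (B.leg2 a b) = b * a"
  "tsum (\<lambda>p q. p \<leftharpoonup> epsB q) (B.leg1 a b) = b * a"
proof -
  have C: "slice (\<lambda>p q. epsC p \<rightharpoonup> q) (DeltaC_second \<A> a b) = a * b"
    "slice (\<lambda>p q. tC \<A> (epsC q) \<rightharpoonup> p) (DeltaC_first \<A> a b) = a * b"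
    using left_counit by (simp_all add: left_counit_def)
  have B: "slice (\<lambda>p q. q \<leftharpoonup> tB \<A> (epsB p)) (DeltaB_second \<A> a b) = b * a"
    "slice (\<lambda>p q. p \<leftharpoonup> epsB q) (DeltaB_first \<A> a b) = b * a"
    using right_counit by (simp_all add: right_counit_def)
  have "balanced (baseC \<A>) (\<lambda>y a. tC \<A> y \<rightharpoonup> a) (\<lambda>y b. y \<rightharpoonup> b) (\<lambda>p q. epsC p \<rightharpoonup> q)"
    by (auto simp: balanced_def bilin_def act_linear clinear_add[OF epsC_props(1)] clinear_scale[OF epsC_props(1)]
        epsC_props lact_mult)
  then show "tsum (\<lambda>p q. epsC p \<rightharpoonup> q) (C.leg2 a b) = a * b"
    using C(1) by (simp add: C.slice_second_leg legs)
  show "tsum (\<lambda>p q. tC \<A> (epsC q) \<rightharpoonup> p) (C.leg1 a b) = a * b"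
    using C(2) by (simp add: C.slice_first_leg legs balanced_slices epsC_props)
  show "tsum (\<lambda>p q. q \<leftharpoonup> tB \<A> (epsB p)) (B.leg2 a b) = b * a"
    using B(1) by (simp add: B.slice_second_leg legs balanced_slices' epsB_props)
  have "balanced (baseB \<A>) (\<lambda>x a. a \<leftharpoonup> x) (\<lambda>x b. b \<leftharpoonup> tB \<A> x) (\<lambda>p q. p \<leftharpoonup> epsB q)"
    by (auto simp: balanced_def bilin_def act_linear clinear_add[OF epsB_props(1)] clinear_scale[OF epsB_props(1)]
        epsB_props ract_mult)
  then show "tsum (\<lambda>p q. p \<leftharpoonup> epsB q) (B.leg1 a b) = b * a"
    using B(2) by (simp add: B.slice_first_leg legs)
qed

lemma antipode_lists:
  "tsum (\<lambda>p q. S p * q) (C.leg2 a b) = epsB a \<rightharpoonup> b"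
  "tsum (\<lambda>p q. p * S q) (B.leg1 b a) = a \<leftharpoonup> epsC b"
proof -
  have ax: "slice (\<lambda>p q. S p * q) (DeltaC_second \<A> a b) = epsB a \<rightharpoonup> b"
    "slice (\<lambda>p q. p * S q) (DeltaB_first \<A> b a) = a \<leftharpoonup> epsC b"
    using antipode by (simp_all add: antipode_def)
  have "balanced (baseC \<A>) (\<lambda>y a. tC \<A> y \<rightharpoonup> a) (\<lambda>y b. y \<rightharpoonup> b) (\<lambda>p q. S p * q)"
    "balanced (baseB \<A>) (\<lambda>x a. a \<leftharpoonup> x) (\<lambda>x b. b \<leftharpoonup> tB \<A> x) (\<lambda>p q. p * S q)"
    by (auto simp: balanced_def bilin_def S_linear' S_acts ract_times_lact algebra_simps
        scaleC_mult_left scaleC_mult_right)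
  then show "tsum (\<lambda>p q. S p * q) (C.leg2 a b) = epsB a \<rightharpoonup> b"
    "tsum (\<lambda>p q. p * S q) (B.leg1 b a) = a \<leftharpoonup> epsC b"
    using ax by (simp_all add: C.slice_second_leg B.slice_first_leg legs)
qed

lemma Hopf_half_C:
  "Hopf_half (*) (*) lact (\<lambda>m a. a \<leftharpoonup> m) (baseB \<A>) (baseC \<A>) (tB \<A>) (tC \<A>)
    B.leg1 B.leg2 C.leg1 C.leg2 epsC S"
  \<comment> \<open>the numbers of the cases are the positions of the axioms in \<open>Hopf_half\<close>\<close>
proof (rule Hopf_half.intro, goal_cases)
  case 1 show ?case by (rule bilin_times)
next
  case 2 show ?case by (rule mult.assoc)
next
  case (3 a) then show ?case using mult_cancel(1)[of a 0] by simp
next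
  case 4 show ?case by (rule bilin_lact)
next
  case 5 show ?case by (rule lact_mult)
next
  case 6 show ?case by (rule lact_times)
next
  case 7 show ?case by (rule ract_times_lact)
next
  case 8 show ?case by (rule lact_ract)
next
  case 9 then show ?case by (rule lact_faithful)
next
  case 10 show ?case by (rule mult.assoc)
next
  case 11 show ?case by (rule base_props)
next
  case 12 then show ?case by (rule base_props)
next
  case 13 then show ?case by (rule tC_props)
next
  case 14 show ?case by (rule tC_props)
next
  case 15 then show ?case by (rule tC_props)
next
  case 16 show ?case by (rule tC_props)
next
  case 17 then show ?case using idempotent_mod_induct[OF idempotent_C(1)] by blast
next
  case 18 then show ?case by (rule C.legs_rel)
next
  case 19 show ?case by (rule C.separate_lists1) (use 19 in blast)+
next
  case 20 show ?case by (rule C.separate_lists2) (use 20 in blast)+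
next
  case 21 then show ?case by (rule C.leg1_bilin)
next
  case 22 then show ?case by (rule C.leg2_bilin)
next
  case 23 then show ?case by (rule C.leg1_mult)
next
  case 24 then show ?case by (rule C_legs_ract)
next
  case 25 then show ?case by (rule C_legs_ract)
next
  case 26 then show ?case by (rule C.leg1_r)
next
  case 27 then show ?case by (rule C.leg2_l)
next
  case 28 then show ?case by (rule coassoc_BC_lists)
next
  case 29 then show ?case by (rule coassoc_CB_lists)
next
  case 30 show ?case by (rule epsC_props)
next
  case 31 show ?case by (rule epsC_props)
next
  case 32 then show ?case by (rule epsC_props)
next
  case 33 then show ?case by (rule epsC_props)
next
  case 34 show ?case by (rule counit_lists)
next
  case 35 show ?case by (rule counit_lists)
next
  case 36 show ?case by (rule S_props)
next
  case 37 show ?case by (rule S_props)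
next
  case 38 show ?case by (rule S_props)
next
  case 39 then show ?case by (rule S_acts)
next
  case 40 then show ?case by (rule S_acts)
next
  case 41 show ?case by (rule antipode_lists)
qed

lemma B_flip: "balanced (baseB \<A>) (\<lambda>x a. a \<leftharpoonup> tB \<A> x) (\<lambda>m a. a \<leftharpoonup> m) f \<Longrightarrow> B.bal (\<lambda>p q. f q p)"
  using balanced_flip[of "baseB \<A>" "\<lambda>x a. a \<leftharpoonup> x" "\<lambda>x a. a \<leftharpoonup> tB \<A> x" f] by blast

lemma balanced3_flip:
  "balanced3 D r l E r' l' g \<Longrightarrow> balanced3 E l' r' D l r (\<lambda>p q s. g s q p)"
  by (auto simp: balanced3_def balanced_def bilin_def)

lemma Hopf_half_B:
  "Hopf_half (\<lambda>a b. b * a) (\<lambda>m n. n * m) (\<lambda>m a. a \<leftharpoonup> m) lact (baseC \<A>) (baseB \<A>) (tC \<A>) (tB \<A>)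
    (flipped C.leg2) (flipped C.leg1) (flipped B.leg2) (flipped B.leg1) epsB S"
proof (rule Hopf_half.intro, goal_cases)
  case 1 show ?case by (rule bilin_times)
next
  case 2 show ?case by (rule mult.assoc[symmetric])
next
  case (3 a) then show ?case using mult_cancel(2)[of a 0] by simp
next
  case 4 show ?case by (rule bilin_ract)
next
  case 5 show ?case by (rule ract_mult)
next
  case 6 show ?case by (rule ract_times)
next
  case 7 show ?case by (rule ract_times_lact[symmetric])
next
  case 8 show ?case by (rule lact_ract[symmetric])
next
  case 9 then show ?case by (rule ract_faithful)
next
  case 10 show ?case by (rule mult.assoc[symmetric])
next
  case 11 show ?case by (rule base_props)
next
  case 12 then show ?case by (intro base_props)
next
  case 13 then show ?case by (rule tB_props)
next
  case 14 show ?case by (rule tB_props)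
next
  case 15 then show ?case by (intro tB_props)
next
  case 16 show ?case by (rule tB_props)
next
  case 17 then show ?case using idempotent_mod_induct[OF idempotent_B(2)] by blast
next
  case (18 f b d a) then show ?case using B.legs_rel[OF B_flip[OF 18], of a d b] by simp
next
  case (19 xs ys f)
  have "tsum (\<lambda>p q. f q p) (map prod.swap xs) = tsum (\<lambda>p q. f q p) (map prod.swap ys)"
  proof (rule B.separate_lists2[OF _ B_flip[OF 19(2)]])
    fix g :: "'a \<Rightarrow> 'a \<Rightarrow> complex" and c assume "B.bal g"
    then show "tsum (\<lambda>p q. g (c * p) q) (map prod.swap xs) = tsum (\<lambda>p q. g (c * p) q) (map prod.swap ys)"
      using 19(1)[of "\<lambda>p q. g q p" c] balanced_flip[of "baseB \<A>" _ _ g] by simp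
  qed
  then show ?case by simp
next
  case (20 xs ys f)
  have "tsum (\<lambda>p q. f q p) (map prod.swap xs) = tsum (\<lambda>p q. f q p) (map prod.swap ys)"
  proof (rule B.separate_lists1[OF _ B_flip[OF 20(2)]])
    fix g :: "'a \<Rightarrow> 'a \<Rightarrow> complex" and c assume "B.bal g"
    then show "tsum (\<lambda>p q. g p (c * q)) (map prod.swap xs) = tsum (\<lambda>p q. g p (c * q)) (map prod.swap ys)"
      using 20(1)[of "\<lambda>p q. g q p" c] balanced_flip[of "baseB \<A>" _ _ g] by simp
  qed
  then show ?case by simp
next
  case (21 f) then show ?case using B.leg2_bilin[OF B_flip[OF 21]] by simp
next
  case (22 f) then show ?case using B.leg1_bilin[OF B_flip[OF 22]] by simp
next
  case (23 f a b c) then show ?case using B.leg2_mult[OF B_flip[OF 23], of b a c] by simp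
next
  case (24 f x a b) then show ?case using B_legs_lact(2)[OF B_flip[OF 24(1)]] by simp
next
  case (25 f y a b) then show ?case using B_legs_lact(1)[OF B_flip[OF 25(1)]] by simp
next
  case (26 f y d a) then show ?case using B.leg2_l[OF B_flip[OF 26(1)]] by simp
next
  case (27 f y d b) then show ?case using B.leg1_r[OF B_flip[OF 27(1)]] by simp
next
  case (28 g a b c) then show ?case using coassoc_BC_lists[OF balanced3_flip[OF 28]] by simp
next
  case (29 g a b c) then show ?case using coassoc_CB_lists[OF balanced3_flip[OF 29]] by simp
next
  case 30 show ?case by (rule epsB_props)
next
  case 31 show ?case by (rule epsB_props)
next
  case 32 then show ?case by (rule epsB_props)
next
  case 33 then show ?case by (rule epsB_props)
next
  case 34 show ?case by (simp add: counit_lists)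
next
  case 35 show ?case by (simp add: counit_lists)
next
  case 36 show ?case by (rule S_props)
next
  case 37 show ?case by (rule S_props)
next
  case 38 show ?case by (rule S_props)
next
  case 39 then show ?case by (rule S_acts)
next
  case 40 then show ?case by (rule S_acts)
next
  case 41 show ?case by (simp add: antipode_lists)
qed

sublocale H: Hopf "(*)" "(*)" lact "\<lambda>m a. a \<leftharpoonup> m" "baseB \<A>" "baseC \<A>" "tB \<A>" "tC \<A>"
    B.leg1 B.leg2 C.leg1 C.leg2 epsB epsC S
  by (intro Hopf.intro Hopf_half_C Hopf_half_B)

end

section \<open>The dual algebra and cointegrals\<close>

context measured_regular_multiplier_Hopf_algebroid
begin

text \<open>In this context \<open>\<phi>\<close> and \<open>\<psi>\<close> are the maps with values in \<open>C\<close> and \<open>B\<close>, so far called \<open>\<Phi>\<close> and \<open>\<Psi>\<close>; the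
  functionals obtained from them are \<open>M.\<phi>\<close> and \<open>M.\<psi>\<close>.\<close>

lemma mu_props: "clinear_on (baseB \<A>) \<mu>\<^sub>B" "clinear_on (baseC \<A>) \<mu>\<^sub>C"
  by (rule functional_muB functional_muC)+

lemma base_diff: "y \<in> baseC \<A> \<Longrightarrow> y' \<in> baseC \<A> \<Longrightarrow> y - y' \<in> baseC \<A>"
  "x \<in> baseB \<A> \<Longrightarrow> x' \<in> baseB \<A> \<Longrightarrow> x - x' \<in> baseB \<A>"
  by (simp_all add: complex_space.subspace_diff base_props)

lemma clinear_on_diff: "csubspace V \<Longrightarrow> clinear_on V f \<Longrightarrow> u \<in> V \<Longrightarrow> v \<in> V \<Longrightarrow> f (u - v) = f u - f v"
proof -
  assume V: "csubspace V" and f: "clinear_on V f" and uv: "u \<in> V" "v \<in> V"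
  have "f ((u - v) + v) = f (u - v) + f v"
    using f uv complex_space.subspace_diff[OF V uv] unfolding clinear_on_def by blast
  then show ?thesis by simp
qed

lemma muC_separates:
  assumes y: "y \<in> baseC \<A>" "y' \<in> baseC \<A>" and eq: "\<And>z. z \<in> baseC \<A> \<Longrightarrow> \<mu>\<^sub>C (z * y) = \<mu>\<^sub>C (z * y')"
  shows "y = y'"
proof (rule ccontr)
  assume "y \<noteq> y'"
  then obtain z where z: "z \<in> baseC \<A>" "\<mu>\<^sub>C (z * (y - y')) \<noteq> 0"
    using faithful_muC base_diff(1)[OF y] unfolding faithful_def by (metis right_minus_eq)
  then show False
    using eq[OF z(1)] y clinear_on_diff[OF base_props(2) mu_props(2), of "z * y" "z * y'"]
    by (simp add: base_props right_diff_distrib)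
qed

lemma muB_separates:
  assumes x: "x \<in> baseB \<A>" "x' \<in> baseB \<A>" and eq: "\<And>z. z \<in> baseB \<A> \<Longrightarrow> \<mu>\<^sub>B (x * z) = \<mu>\<^sub>B (x' * z)"
  shows "x = x'"
proof (rule ccontr)
  assume "x \<noteq> x'"
  then obtain z where z: "z \<in> baseB \<A>" "\<mu>\<^sub>B ((x - x') * z) \<noteq> 0"
    using faithful_muB base_diff(2)[OF x] unfolding faithful_def by (metis right_minus_eq)
  then show False
    using eq[OF z(1)] x clinear_on_diff[OF base_props(1) mu_props(1), of "x * z" "x' * z"]
    by (simp add: base_props left_diff_distrib)
qed

lemma Phi_props: "clinear \<phi>" "\<phi> a \<in> baseC \<A>" "y \<in> baseC \<A> \<Longrightarrow> \<phi> (y \<rightharpoonup> a) = y * \<phi> a"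
    "y \<in> baseC \<A> \<Longrightarrow> \<phi> (a \<leftharpoonup> y) = \<phi> a * y"
  using bimodule_phi by (auto simp: module_map_def clinear_on_def clinear_iff)

lemma Psi_props: "clinear \<psi>" "\<psi> a \<in> baseB \<A>" "x \<in> baseB \<A> \<Longrightarrow> \<psi> (x \<rightharpoonup> a) = x * \<psi> a"
    "x \<in> baseB \<A> \<Longrightarrow> \<psi> (a \<leftharpoonup> x) = \<psi> a * x"
  using bimodule_psi by (auto simp: module_map_def clinear_on_def clinear_iff)

lemma left_integral_list: "tsum (\<lambda>p q. tC \<A> (\<phi> q) \<rightharpoonup> p) (C.leg1 b a) = \<phi> b \<rightharpoonup> a"
  using left_integral[of b a] by (simp add: C.slice_first_leg legs balanced_slices Phi_props)

text \<open>The right integral is given in terms of \<open>\<Delta>\<^sub>C\<close>; its form for \<open>\<Delta>\<^sub>B\<close> is the mirror image of left invariance.\<close>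

lemma right_integral_list: "tsum (\<lambda>p q. q \<leftharpoonup> tB \<A> (\<psi> p)) (B.leg2 b a) = a \<leftharpoonup> \<psi> b"
proof (rule H.right_integral_DB2)
  fix a b
  have "H.tCi (\<psi> (tC \<A> y \<rightharpoonup> p)) = H.tCi (\<psi> p) * y" if "y \<in> baseC \<A>" for y p
    using that by (simp add: Psi_props tC_props H.tCi_mult)
  then have "balanced (baseC \<A>) (\<lambda>y a. tC \<A> y \<rightharpoonup> a) (\<lambda>y b. y \<rightharpoonup> b) (\<lambda>p q. H.tCi (\<psi> p) \<rightharpoonup> q)"
    by (auto simp: balanced_def bilin_def act_linear clinear_add[OF Psi_props(1)] clinear_scale[OF Psi_props(1)]
        Psi_props H.tCi_add H.tCi_scale lact_mult)
  moreover have "slice (\<lambda>p q. H.tCi (\<psi> p) \<rightharpoonup> q) (DeltaC_second \<A> a b) = \<psi> a \<rightharpoonup> b"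
    using right_integral[of a b] by (simp add: ext_anti_B Psi_props H.tCi_def)
  ultimately show "tsum (\<lambda>p q. H.tCi (\<psi> p) \<rightharpoonup> q) (C.leg2 a b) = \<psi> a \<rightharpoonup> b"
    by (simp add: C.slice_second_leg legs)
qed (rule Psi_props; assumption?)+

lemma factors:
  "\<exists>g. clinear g \<and> range g = baseC \<A> \<and> (\<forall>y\<in>baseC \<A>. \<forall>a. g (a \<leftharpoonup> y) = g a * y) \<and> (\<forall>a. \<mu>\<^sub>C (g a) = \<mu>\<^sub>B (\<psi> a))"
  "\<exists>g. clinear g \<and> range g \<subseteq> baseB \<A> \<and> (\<forall>x\<in>baseB \<A>. \<forall>a. g (a \<leftharpoonup> x) = g a * x) \<and> (\<forall>a. \<mu>\<^sub>B (g a) = \<mu>\<^sub>C (\<phi> a))"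
  "\<exists>g. clinear g \<and> range g = baseB \<A> \<and> (\<forall>x\<in>baseB \<A>. \<forall>a. g (x \<rightharpoonup> a) = x * g a) \<and> (\<forall>a. \<mu>\<^sub>B (g a) = \<mu>\<^sub>C (\<phi> a))"
  "\<exists>g. clinear g \<and> range g \<subseteq> baseC \<A> \<and> (\<forall>y\<in>baseC \<A>. \<forall>a. g (y \<rightharpoonup> a) = y * g a) \<and> (\<forall>a. \<mu>\<^sub>C (g a) = \<mu>\<^sub>B (\<psi> a))"
proof -
  have *: "clinear f \<and> range f = D \<and> (\<forall>d\<in>D. \<forall>a. f (r d a) = s d (f a)) \<and> (\<forall>a. \<mu> (f a) = \<omega> a)"
    if "surjective_factor D r s \<mu> \<omega> f" for D r s \<mu> \<omega> f
    using that unfolding surjective_factor_def module_map_def clinear_on_def clinear_iff by simp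
  obtain f1 f2 f3 f4 where
    "surjective_factor (baseC \<A>) (\<lambda>y a. a \<leftharpoonup> y) (\<lambda>y z. z * y) \<mu>\<^sub>C (\<lambda>a. \<mu>\<^sub>B (\<psi> a)) f1"
    "surjective_factor (baseB \<A>) (\<lambda>x a. a \<leftharpoonup> x) (\<lambda>x z. z * x) \<mu>\<^sub>B (\<lambda>a. \<mu>\<^sub>C (\<phi> a)) f2"
    "surjective_factor (baseB \<A>) (\<lambda>x a. x \<rightharpoonup> a) (\<lambda>x z. x * z) \<mu>\<^sub>B (\<lambda>a. \<mu>\<^sub>C (\<phi> a)) f3"
    "surjective_factor (baseC \<A>) (\<lambda>y a. y \<rightharpoonup> a) (\<lambda>y z. y * z) \<mu>\<^sub>C (\<lambda>a. \<mu>\<^sub>B (\<psi> a)) f4"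
    using factor_psi factor_phi by blast
  note f = this[THEN *]
  show "\<exists>g. clinear g \<and> range g = baseC \<A> \<and> (\<forall>y\<in>baseC \<A>. \<forall>a. g (a \<leftharpoonup> y) = g a * y) \<and> (\<forall>a. \<mu>\<^sub>C (g a) = \<mu>\<^sub>B (\<psi> a))"
    using f(1) by (intro exI[of _ f1]) simp
  show "\<exists>g. clinear g \<and> range g \<subseteq> baseB \<A> \<and> (\<forall>x\<in>baseB \<A>. \<forall>a. g (a \<leftharpoonup> x) = g a * x) \<and> (\<forall>a. \<mu>\<^sub>B (g a) = \<mu>\<^sub>C (\<phi> a))"
    using f(2) by (intro exI[of _ f2]) simp
  show "\<exists>g. clinear g \<and> range g = baseB \<A> \<and> (\<forall>x\<in>baseB \<A>. \<forall>a. g (x \<rightharpoonup> a) = x * g a) \<and> (\<forall>a. \<mu>\<^sub>B (g a) = \<mu>\<^sub>C (\<phi> a))"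
    using f(3) by (intro exI[of _ f3]) simp
  show "\<exists>g. clinear g \<and> range g \<subseteq> baseC \<A> \<and> (\<forall>y\<in>baseC \<A>. \<forall>a. g (y \<rightharpoonup> a) = y * g a) \<and> (\<forall>a. \<mu>\<^sub>C (g a) = \<mu>\<^sub>B (\<psi> a))"
    using f(4) by (intro exI[of _ f4]) simp
qed

sublocale M: measured_Hopf "(*)" "(*)" lact "\<lambda>m a. a \<leftharpoonup> m" "baseB \<A>" "baseC \<A>" "tB \<A>" "tC \<A>"
    B.leg1 B.leg2 C.leg1 C.leg2 epsB epsC S \<mu>\<^sub>B \<mu>\<^sub>C \<psi> \<phi>
proof (intro measured_Hopf.intro measured_half.intro Hopf_half_C Hopf_half_B measured_half_axioms.intro, goal_cases)
  case 1 then show ?case by (rule mu_tB)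
next
  case 2 show ?case by (rule mu_eps)
next
  case 3 show ?case by (rule mu_props)
next
  case 4 then show ?case by (rule muC_separates)
next
  case 5 show ?case by (rule Phi_props)
next
  case 6 show ?case by (rule Phi_props)
next
  case 7 then show ?case by (rule Phi_props)
next
  case 8 then show ?case by (rule Phi_props)
next
  case 9 show ?case by (rule left_integral_list)
next
  case (10 a) then show ?case using faithful_phi unfolding faithful_def by blast
next
  case (11 a) then show ?case using faithful_phi unfolding faithful_def by blast
next
  case 12 show ?case by (rule factors)
next
  case 13 show ?case by (rule factors)
next
  case 14 then show ?case by (rule mu_tC)
next
  case 15 show ?case by (rule mu_eps[symmetric])
next
  case 16 show ?case by (rule mu_props)
next
  case 17 then show ?case by (rule muB_separates)
next
  case 18 show ?case by (rule Psi_props)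
next
  case 19 show ?case by (rule Psi_props)
next
  case 20 then show ?case by (rule Psi_props)
next
  case 21 then show ?case by (rule Psi_props)
next
  case 22 show ?case by (simp add: right_integral_list)
next
  case (23 a) then show ?case using faithful_psi unfolding faithful_def by blast
next
  case (24 a) then show ?case using faithful_psi unfolding faithful_def by blast
next
  case 25 show ?case by (rule factors)
next
  case 26 show ?case by (rule factors)
qed

text \<open>Faithfulness of \<open>\<mu>\<^sub>C\<close> makes the \<open>C\<close>-linear map underlying a functional unique.\<close>

lemma left_C_eq:
  assumes f: "clinear f" "\<And>a. f a \<in> baseC \<A>" "\<And>y a. y \<in> baseC \<A> \<Longrightarrow> f (y \<rightharpoonup> a) = y * f a"
    and \<omega>: "\<And>a. \<mu>\<^sub>C (f a) = \<omega> a"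
  shows "left_C \<A> \<mu>\<^sub>C \<omega> = f"
  unfolding left_C_def mod_factor_def
proof (rule the_equality, goal_cases)
  case 1 show ?case using f \<omega> by (auto simp: module_map_def clinear_on_def clinear_iff)
next
  case (2 g)
  then have g: "g a \<in> baseC \<A>" "y \<in> baseC \<A> \<Longrightarrow> g (y \<rightharpoonup> a) = y * g a" "\<mu>\<^sub>C (g a) = \<omega> a" for y a
    by (auto simp: module_map_def)
  show ?case
  proof (rule ext, rule muC_separates[OF g(1) f(2)])
    fix a z assume "z \<in> baseC \<A>"
    then show "\<mu>\<^sub>C (z * g a) = \<mu>\<^sub>C (z * f a)" using g \<omega> f(3) by metis
  qed
qed

lemma right_B_eq:
  assumes f: "clinear f" "\<And>a. f a \<in> baseB \<A>" "\<And>x a. x \<in> baseB \<A> \<Longrightarrow> f (a \<leftharpoonup> x) = f a * x"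
    and \<omega>: "\<And>a. \<mu>\<^sub>B (f a) = \<omega> a"
  shows "right_B \<A> \<mu>\<^sub>B \<omega> = f"
  unfolding right_B_def mod_factor_def
proof (rule the_equality, goal_cases)
  case 1 show ?case using f \<omega> by (auto simp: module_map_def clinear_on_def clinear_iff)
next
  case (2 g)
  then have g: "g a \<in> baseB \<A>" "y \<in> baseB \<A> \<Longrightarrow> g (a \<leftharpoonup> y) = g a * y" "\<mu>\<^sub>B (g a) = \<omega> a" for y a
    by (auto simp: module_map_def)
  show ?case
  proof (rule ext, rule muB_separates[OF g(1) f(2)])
    fix a z assume "z \<in> baseB \<A>"
    then show "\<mu>\<^sub>B (g a * z) = \<mu>\<^sub>B (f a * z)" using g \<omega> f(3) by metis
  qed
qed

lemma dual_left_eq: "dual_left \<A> \<mu>\<^sub>C (\<lambda>b. \<mu>\<^sub>C (\<phi> (b * d))) a = M.convC \<phi> d a"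
proof -
  let ?f = "\<lambda>b. \<phi> (b * d)"
  have f: "clinear ?f" "\<And>a. ?f a \<in> baseC \<A>" "\<And>y a. y \<in> baseC \<A> \<Longrightarrow> ?f (y \<rightharpoonup> a) = y * ?f a"
    using Phi_props(1) by (simp_all add: Phi_props lact_times[symmetric] clinear_iff distrib_right scaleC_mult_left)
  have "left_C \<A> \<mu>\<^sub>C (\<lambda>b. \<mu>\<^sub>C (\<phi> (b * d))) = ?f"
    by (rule left_C_eq[OF f]) simp_all
  then have slice: "slice (\<lambda>p q. tC \<A> (left_C \<A> \<mu>\<^sub>C (\<lambda>b. \<mu>\<^sub>C (\<phi> (b * d))) q) \<rightharpoonup> p) (DeltaC_first \<A> a b) = M.convC \<phi> d a * b" for b
    using balanced_slices[OF f] by (simp add: M.convC_mul[OF M.Phi_leftC] C.slice_first_leg legs)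
  show ?thesis
    unfolding dual_left_def slice
    by (rule the_equality) (auto intro: mult_cancel(1))
qed

lemma dual_right_eq: "dual_right \<A> \<mu>\<^sub>B a (\<lambda>b. \<mu>\<^sub>B (\<psi> (d * b))) = M.convB \<psi> d a"
proof -
  let ?f = "\<lambda>b. \<psi> (d * b)"
  have f: "clinear ?f" "\<And>a. ?f a \<in> baseB \<A>" "\<And>y a. y \<in> baseB \<A> \<Longrightarrow> ?f (a \<leftharpoonup> y) = ?f a * y"
    using Psi_props(1) by (simp_all add: Psi_props ract_times[symmetric] clinear_iff distrib_left scaleC_mult_right)
  have "right_B \<A> \<mu>\<^sub>B (\<lambda>b. \<mu>\<^sub>B (\<psi> (d * b))) = ?f"
    by (rule right_B_eq[OF f]) simp_all
  then have slice: "slice (\<lambda>p q. q \<leftharpoonup> tB \<A> (right_B \<A> \<mu>\<^sub>B (\<lambda>b. \<mu>\<^sub>B (\<psi> (d * b))) p)) (DeltaB_second \<A> a b) = b * M.convB \<psi> d a" for b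
    using balanced_slices'[OF f] by (simp add: M.convB_Psi_mul B.slice_second_leg legs)
  show ?thesis
    unfolding dual_right_def slice
    by (rule the_equality) (auto intro: mult_cancel(2))
qed

lemma dual_space_unit_iff:
  "(\<exists>e. unit_element (dual_space \<mu>\<^sub>C \<phi>) (dual_mult \<A> \<mu>\<^sub>C) e) \<longleftrightarrow> (\<exists>l. \<forall>x. M.\<phi> (x * l) = M.\<epsilon> x)"
proof -
  define E where "E d = (\<lambda>b. \<mu>\<^sub>C (\<phi> (b * d)))" for d
  have E: "dual_space \<mu>\<^sub>C \<phi> = range E" by (auto simp: dual_space_def E_def)
  have mult: "dual_mult \<A> \<mu>\<^sub>C (E a) (E b) = (\<lambda>x. M.\<phi> (M.convC \<phi> b x * a))" for a b
    by (simp add: dual_mult_def dual_left_eq E_def M.\<phi>_def)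
  have "unit_element (range E) (dual_mult \<A> \<mu>\<^sub>C) (E l) \<longleftrightarrow> (\<forall>x. M.\<phi> (x * l) = M.\<epsilon> x)" for l
  proof -
    have "unit_element (range E) (dual_mult \<A> \<mu>\<^sub>C) (E l) \<longleftrightarrow>
        (\<forall>b. dual_mult \<A> \<mu>\<^sub>C (E l) (E b) = E b \<and> dual_mult \<A> \<mu>\<^sub>C (E b) (E l) = E b)"
      by (auto simp: unit_element_def)
    also have "\<dots> \<longleftrightarrow> (\<forall>b x. M.\<phi> (M.convC \<phi> b x * l) = M.\<phi> (x * b) \<and> M.\<phi> (M.convC \<phi> l x * b) = M.\<phi> (x * b))"
      unfolding mult fun_eq_iff by (auto simp: E_def M.\<phi>_def)
    finally show ?thesis by (simp only: M.dual_unit_iff)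
  qed
  then show ?thesis unfolding E unit_element_def by blast
qed

lemma left_cointegral_iff:
  "left_cointegral epsC l \<and> unit_element (baseC \<A>) (*) (\<phi> l) \<longleftrightarrow> (\<forall>x. M.\<phi> (x * l) = M.\<epsilon> x)"
  unfolding M.counit_left_cointegral_iff left_cointegral_def unit_element_def by blast

lemma right_cointegral_iff:
  "right_cointegral epsB r \<and> unit_element (baseB \<A>) (*) (\<psi> r) \<longleftrightarrow> (\<forall>x. M.\<psi> (r * x) = M.\<epsilon> x)"
  unfolding M.counit_right_cointegral_iff right_cointegral_def unit_element_def by blast

text \<open>Here the equality \<open>A\<cdot>\<phi> = \<psi>\<cdot>A\<close> is used: \<open>\<epsilon>\<close> lies in one of the two spaces if and only if it lies in the other.\<close>

lemma left_right_iff: "(\<exists>l. \<forall>x. M.\<phi> (x * l) = M.\<epsilon> x) \<longleftrightarrow> (\<exists>r. \<forall>x. M.\<psi> (r * x) = M.\<epsilon> x)"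
  using M.phi_dual_subset M.psi_dual_subset by metis

lemma left_orbit:
  assumes l: "\<forall>x. M.\<phi> (x * l) = M.\<epsilon> x"
  shows "{dual_left \<A> \<mu>\<^sub>C \<omega> l |\<omega>. \<omega> \<in> dual_space \<mu>\<^sub>C \<phi>} = UNIV"
proof -
  have "a \<in> {dual_left \<A> \<mu>\<^sub>C \<omega> l |\<omega>. \<omega> \<in> dual_space \<mu>\<^sub>C \<phi>}" for a
  proof -
    obtain d where "M.convC \<phi> d l = S (H.Si a)"
      using M.cointegral_generates[of l "H.Si a"] l by blast
    then have "a = dual_left \<A> \<mu>\<^sub>C (\<lambda>b. \<mu>\<^sub>C (\<phi> (b * d))) l"
      by (simp add: dual_left_eq)
    then show ?thesis by (auto simp: dual_space_def)
  qed
  then show ?thesis by blast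
qed

text \<open>The mirror image of the generation lemma yields elements of \<open>\<psi>\<cdot>A\<close>; these belong to the dual space \<open>A\<cdot>\<phi>\<close>.\<close>

lemma right_orbit:
  assumes r: "\<forall>x. M.\<psi> (r * x) = M.\<epsilon> x"
  shows "{dual_right \<A> \<mu>\<^sub>B r \<omega> |\<omega>. \<omega> \<in> dual_space \<mu>\<^sub>C \<phi>} = UNIV"
proof -
  have "a \<in> {dual_right \<A> \<mu>\<^sub>B r \<omega> |\<omega>. \<omega> \<in> dual_space \<mu>\<^sub>C \<phi>}" for a
  proof -
    obtain d where "M.convB \<psi> d r = S (H.Si a)"
      using M.right_cointegral_generates[of r "H.Si a"] r by blast
    then have a: "a = dual_right \<A> \<mu>\<^sub>B r (\<lambda>b. \<mu>\<^sub>B (\<psi> (d * b)))"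
      by (simp add: dual_right_eq)
    obtain c where "M.\<psi> (d * b) = M.\<phi> (b * c)" for b
      using M.psi_dual_subset by metis
    then have "(\<lambda>b. \<mu>\<^sub>B (\<psi> (d * b))) = (\<lambda>b. \<mu>\<^sub>C (\<phi> (b * c)))"
      by (simp add: fun_eq_iff M.\<phi>_def M.\<psi>_def)
    then have "(\<lambda>b. \<mu>\<^sub>B (\<psi> (d * b))) \<in> dual_space \<mu>\<^sub>C \<phi>"
      unfolding dual_space_def by blast
    with a show ?thesis by blast
  qed
  then show ?thesis by blast
qed

end

theorem proposition3p5p3:
  fixes \<A> :: "'a::complex_alg bialgebroid"
    and epsC epsB :: "'a \<Rightarrow> 'a multiplier"
    and S :: "'a \<Rightarrow> 'a"
    and \<mu>\<^sub>B \<mu>\<^sub>C :: "'a multiplier \<Rightarrow> complex"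
    and \<psi> \<phi> :: "'a \<Rightarrow> 'a multiplier"
  assumes "measured_regular_multiplier_Hopf_algebroid \<A> epsC epsB S \<mu>\<^sub>B \<mu>\<^sub>C \<psi> \<phi>"
    and "locally_projective \<A>"
  shows "((\<exists>e. unit_element (dual_space \<mu>\<^sub>C \<phi>) (dual_mult \<A> \<mu>\<^sub>C) e) \<longleftrightarrow>
        (\<exists>l. left_cointegral epsC l \<and> unit_element (baseC \<A>) (*) (\<phi> l)))
    \<and> ((\<exists>e. unit_element (dual_space \<mu>\<^sub>C \<phi>) (dual_mult \<A> \<mu>\<^sub>C) e) \<longleftrightarrow>
        (\<exists>r. right_cointegral epsB r \<and> unit_element (baseB \<A>) (*) (\<psi> r)))
    \<and> ((\<exists>e. unit_element (dual_space \<mu>\<^sub>C \<phi>) (dual_mult \<A> \<mu>\<^sub>C) e) \<longrightarrow>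
        (\<exists>l. left_cointegral epsC l \<and> unit_element (baseC \<A>) (*) (\<phi> l) \<and>
          {dual_left \<A> \<mu>\<^sub>C \<omega> l |\<omega>. \<omega> \<in> dual_space \<mu>\<^sub>C \<phi>} = UNIV) \<and>
        (\<exists>r. right_cointegral epsB r \<and> unit_element (baseB \<A>) (*) (\<psi> r) \<and>
          {dual_right \<A> \<mu>\<^sub>B r \<omega> |\<omega>. \<omega> \<in> dual_space \<mu>\<^sub>C \<phi>} = UNIV))"
proof -
  interpret measured_regular_multiplier_Hopf_algebroid \<A> epsC epsB S \<mu>\<^sub>B \<mu>\<^sub>C \<psi> \<phi>
    by (rule assms(1))
  show ?thesis
    unfolding conj_assoc[symmetric] left_cointegral_iff right_cointegral_iff
      dual_space_unit_iff left_right_iff[symmetric]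
    using left_right_iff left_orbit right_orbit by blast
qed

end
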